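(* Let $(M;\le_1,\ldots,\le_n)$ be a countable structure, homogeneous in the language $\{\le_1,\dots,\le_n\}$, primitive, and such that each $\le_i$ is a linear order on $M$. Assume that no two of these orders are equal or reverse of each other. Then $M$ is (isomorphic to) the Fraïssé limit of the class of finite sets equipped with $n$ linear orders.
   Context: Homogeneous: every isomorphism between finite substructures extends to an automorphism. Primitive: there is no nontrivial $\emptyset$-definable equivalence relation on $M$.
   Formalization: "Countable" is taken as countably infinite: a one-point M with n = 1 satisfies all the other hypotheses but is not the Fraïssé limit, and no finite M can be. *)

theory Defs
  imports "HOL-Library.Countable_Set"
begin

text \<open>
  Structures in a relational language all of whose symbols are binary. The language is a set
  \<open>L\<close> of symbols; the values of \<open>rel\<close> at symbols outside \<open>L\<close> are irrelevant.
\<close>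

record ('s, 'a) bin_struct =
  univ :: "'a set"
  rel :: "'s \<Rightarrow> 'a rel"

definition is_struct :: "'s set \<Rightarrow> ('s, 'a) bin_struct \<Rightarrow> bool" where
  "is_struct L M \<longleftrightarrow> (\<forall>s\<in>L. rel M s \<subseteq> univ M \<times> univ M)"

definition iso :: "'s set \<Rightarrow> ('s, 'a) bin_struct \<Rightarrow> ('s, 'b) bin_struct \<Rightarrow> ('a \<Rightarrow> 'b) \<Rightarrow> bool" where
  "iso L M N f \<longleftrightarrow> bij_betw f (univ M) (univ N) \<and>
     (\<forall>s\<in>L. \<forall>x\<in>univ M. \<forall>y\<in>univ M. (x, y) \<in> rel M s \<longleftrightarrow> (f x, f y) \<in> rel N s)"

abbreviation automorphism :: "'s set \<Rightarrow> ('s, 'a) bin_struct \<Rightarrow> ('a \<Rightarrow> 'a) \<Rightarrow> bool" where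
  "automorphism L M g \<equiv> iso L M M g"

text \<open>The language is relational, so every subset of the universe carries a substructure.\<close>

definition substruct :: "('s, 'a) bin_struct \<Rightarrow> 'a set \<Rightarrow> ('s, 'a) bin_struct" where
  "substruct M A = \<lparr>univ = A, rel = (\<lambda>s. rel M s \<inter> A \<times> A)\<rparr>"

definition homogeneous :: "'s set \<Rightarrow> ('s, 'a) bin_struct \<Rightarrow> bool" where
  "homogeneous L M \<longleftrightarrow>
     (\<forall>A B f. finite A \<and> A \<subseteq> univ M \<and> finite B \<and> B \<subseteq> univ M \<and>
        iso L (substruct M A) (substruct M B) f \<longrightarrow>
        (\<exists>g. automorphism L M g \<and> (\<forall>x\<in>A. g x = f x)))"

text \<open>First-order formulas with equality; variables are natural numbers.\<close>

datatype 's fm =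
    Eq nat nat
  | Rel 's nat nat
  | Neg "'s fm"
  | Conj "'s fm" "'s fm"
  | Forall nat "'s fm"

primrec sat :: "('s, 'a) bin_struct \<Rightarrow> (nat \<Rightarrow> 'a) \<Rightarrow> 's fm \<Rightarrow> bool" where
  "sat M v (Eq i j) \<longleftrightarrow> v i = v j"
| "sat M v (Rel s i j) \<longleftrightarrow> (v i, v j) \<in> rel M s"
| "sat M v (Neg p) \<longleftrightarrow> \<not> sat M v p"
| "sat M v (Conj p q) \<longleftrightarrow> sat M v p \<and> sat M v q"
| "sat M v (Forall i p) \<longleftrightarrow> (\<forall>a\<in>univ M. sat M (v(i := a)) p)"

primrec fv :: "'s fm \<Rightarrow> nat set" where
  "fv (Eq i j) = {i, j}"
| "fv (Rel s i j) = {i, j}"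
| "fv (Neg p) = fv p"
| "fv (Conj p q) = fv p \<union> fv q"
| "fv (Forall i p) = fv p - {i}"

text \<open>
  \<open>\<emptyset>\<close>-definability of a binary relation. The symbols occurring in a formula \<open>p\<close> are \<open>set_fm p\<close>.
  Only the variables 0 and 1 are free, so the values of the assignment elsewhere are immaterial.
\<close>

definition definable2 :: "'s set \<Rightarrow> ('s, 'a) bin_struct \<Rightarrow> 'a rel \<Rightarrow> bool" where
  "definable2 L M E \<longleftrightarrow>
     (\<exists>p. set_fm p \<subseteq> L \<and> fv p \<subseteq> {0, 1} \<and>
        E = {(a, b). a \<in> univ M \<and> b \<in> univ M \<and> sat M (\<lambda>k. if k = 0 then a else b) p})"

definition primitive :: "'s set \<Rightarrow> ('s, 'a) bin_struct \<Rightarrow> bool" where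
  "primitive L M \<longleftrightarrow>
     \<not> (\<exists>E. equiv (univ M) E \<and> definable2 L M E \<and> E \<noteq> Id_on (univ M) \<and> E \<noteq> univ M \<times> univ M)"

text \<open>
  Classes of finite structures are represented by their members with universe a finite set of
  natural numbers; every finite structure is isomorphic to one of these.
\<close>

definition age :: "'s set \<Rightarrow> ('s, 'a) bin_struct \<Rightarrow> ('s, nat) bin_struct set" where
  "age L M = {A. is_struct L A \<and> finite (univ A) \<and>
     (\<exists>B f. B \<subseteq> univ M \<and> iso L A (substruct M B) f)}"

text \<open>
  The Fraisse limit of a class \<open>K\<close> is the countable homogeneous structure with age \<open>K\<close>. By
  Fraisse's theorem it is unique up to isomorphism, and the predicate below is invariant under
  isomorphism, so it says that \<open>M\<close> is isomorphic to the Fraisse limit of \<open>K\<close>.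
\<close>

definition is_fraisse_limit ::
  "'s set \<Rightarrow> ('s, nat) bin_struct set \<Rightarrow> ('s, 'a) bin_struct \<Rightarrow> bool" where
  "is_fraisse_limit L K M \<longleftrightarrow>
     is_struct L M \<and> countable (univ M) \<and> homogeneous L M \<and> age L M = K"

definition finite_multi_orders :: "'s set \<Rightarrow> ('s, nat) bin_struct set" where
  "finite_multi_orders L = {A. finite (univ A) \<and> (\<forall>s\<in>L. linear_order_on (univ A) (rel A s))}"

end

theory Submission
  imports Defs "HOL-Library.Ramsey"
begin

text \<open>
  Finitely realizable tuples of cuts (one cut per order) describe limits of points of \<open>M\<close>. Call an order \<open>i\<close>
  an edge if all its cuts are realized by points that are at infinity in the other orders. Two such
  points have the same type over a finite set \<open>F\<close> unless an element of \<open>F\<close> separates them in the order \<open>i\<close>,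
  so the stabilizer of \<open>F\<close> fixes no cut of an edge except those next to elements of \<open>F\<close>. If all orders are edges,
  it follows that they are independent: all boxes are nonempty.

  Suppose that not all orders are edges. Among the limits that are not at infinity in some order that is not an edge,
  take one that is at infinity in as many orders as possible, and let \<open>J\<close> be the set of the remaining
  orders. Then \<open>J\<close> contains no edge and at least two orders. The key point is that the types of pairs are
  transitive relations, being intersections of linear orders and their reverses. Hence two intervals
  that are bounded by consecutive cuts fixed by the stabilizers of points \<open>a\<close> and \<open>b\<close> never
  overlap, and the intervals form a tree. On the other hand there are chains \<open>z\<^sub>1, z\<^sub>2, z\<^sub>3\<close> of
  the same type such that an interval of the tree separates \<open>z\<^sub>1, z\<^sub>2\<close> from \<open>z\<^sub>3\<close>, and
  such that one separates \<open>z\<^sub>1\<close> from \<open>z\<^sub>2, z\<^sub>3\<close>. By homogeneity both happen for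
  the same chain, which is a contradiction.
\<close>

section \<open>Automorphisms and limits of points\<close>

text \<open>Being at infinity in an order is not a property of points, as every point has points
  below and above it; it makes sense only for limits. Minimality of \<open>J\<close> enters through
  compactness: a limit at infinity in one order of \<open>J\<close> is at infinity in all orders of
  \<open>J\<close> that are not edges. So a set of tuples that is bounded in one such order is
  bounded in all orders of \<open>J\<close>, and without edges an unbounded set accumulates at a
  corner, a choice of one end for each order of \<open>J\<close>. Why \<open>J\<close> contains no
  edge: the infimum and the supremum, in an edge, of the tuples over an interval of another order of
  \<open>J\<close> would sit at the two ends of that interval. The edge would inherit betweenness
  and be equal or reverse to that order. Which intervals form the tree depends on the corners. For a
  corner without an opposite one they are the hulls of the tuples from which a point is seen in the
  direction of the corner. For opposite corners they would be the hulls of bounded orbits over a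
  point; if no orbit is bounded, there is no tree, and instead one order of \<open>J\<close>
  determines the others.\<close>

definition order_aut :: "nat set \<Rightarrow> (nat \<Rightarrow> nat \<Rightarrow> nat \<Rightarrow> bool) \<Rightarrow> (nat \<Rightarrow> nat) \<Rightarrow> bool" where
  "order_aut I lt g \<longleftrightarrow> bij g \<and> (\<forall>i\<in>I. \<forall>a b. lt i (g a) (g b) \<longleftrightarrow> lt i a b)"

text \<open>The orders are strict and total for every index, also outside \<open>I\<close>, so that
  order arguments need no side condition. Preservation in one direction suffices in
  \<open>homogeneous\<close>, because the orders are linear and the map is injective. Primitivity is
  stated for invariant instead of definable equivalence relations;
  \<open>homogeneous_orders_transfer\<close> bridges the two.\<close>

locale homogeneous_orders =
  fixes I :: "nat set" and lt :: "nat \<Rightarrow> nat \<Rightarrow> nat \<Rightarrow> bool"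
  assumes finite_I: "finite I"
    and lt_irrefl [simp]: "\<not> lt i a a"
    and lt_trans: "lt i a b \<Longrightarrow> lt i b c \<Longrightarrow> lt i a c"
    and lt_total: "a \<noteq> b \<Longrightarrow> lt i a b \<or> lt i b a"
    and homogeneous: "finite A \<Longrightarrow> inj_on f A \<Longrightarrow>
      (\<And>i a b. i \<in> I \<Longrightarrow> a \<in> A \<Longrightarrow> b \<in> A \<Longrightarrow> lt i a b \<Longrightarrow> lt i (f a) (f b)) \<Longrightarrow>
      \<exists>g. order_aut I lt g \<and> (\<forall>a\<in>A. g a = f a)"
    and primitive: "(\<And>a. R a a) \<Longrightarrow> (\<And>a b. R a b \<Longrightarrow> R b a) \<Longrightarrow>
      (\<And>a b c. R a b \<Longrightarrow> R b c \<Longrightarrow> R a c) \<Longrightarrow>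
      (\<And>g a b. order_aut I lt g \<Longrightarrow> R a b \<Longrightarrow> R (g a) (g b)) \<Longrightarrow>
      (\<forall>a b. R a b \<longrightarrow> a = b) \<or> (\<forall>a b. R a b)"
    and not_equal: "i \<in> I \<Longrightarrow> j \<in> I \<Longrightarrow> i \<noteq> j \<Longrightarrow> \<exists>a b. lt i a b \<and> lt j b a"
    and not_reverse: "i \<in> I \<Longrightarrow> j \<in> I \<Longrightarrow> i \<noteq> j \<Longrightarrow> \<exists>a b. lt i a b \<and> lt j a b"
begin

abbreviation aut :: "(nat \<Rightarrow> nat) \<Rightarrow> bool" where
  "aut \<equiv> order_aut I lt"

lemma lt_asym: "lt i a b \<Longrightarrow> \<not> lt i b a"
  using lt_irrefl lt_trans by blast

lemma not_lt: "\<not> lt i a b \<longleftrightarrow> a = b \<or> lt i b a"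
  using lt_asym lt_total by (metis lt_irrefl)

lemma lt_le_trans: "lt i a b \<Longrightarrow> \<not> lt i c b \<Longrightarrow> lt i a c"
  by (metis lt_trans not_lt)

lemma le_lt_trans: "\<not> lt i b a \<Longrightarrow> lt i b c \<Longrightarrow> lt i a c"
  by (metis lt_trans not_lt)

lemma finite_has_max:
  assumes "finite F" "F \<noteq> {}"
  shows "\<exists>m\<in>F. \<forall>x\<in>F. \<not> lt i m x"
  using assms
proof (induction F rule: finite_ne_induct)
  case (insert a F)
  then obtain m where m: "m \<in> F" "\<forall>x\<in>F. \<not> lt i m x" by blast
  show ?case
  proof (cases "lt i m a")
    case True
    then have "\<forall>x\<in>insert a F. \<not> lt i a x" using m lt_trans lt_irrefl by blast
    then show ?thesis by blast
  qed (use m in auto)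
qed auto

lemma finite_has_min:
  assumes "finite F" "F \<noteq> {}"
  shows "\<exists>m\<in>F. \<forall>x\<in>F. \<not> lt i x m"
  using assms
proof (induction F rule: finite_ne_induct)
  case (insert a F)
  then obtain m where m: "m \<in> F" "\<forall>x\<in>F. \<not> lt i x m" by blast
  show ?case
  proof (cases "lt i a m")
    case True
    then have "\<forall>x\<in>insert a F. \<not> lt i x a" using m lt_trans lt_irrefl by blast
    then show ?thesis by blast
  qed (use m in auto)
qed auto

lemma autD: "aut g \<Longrightarrow> i \<in> I \<Longrightarrow> lt i (g a) (g b) \<longleftrightarrow> lt i a b"
  by (simp add: order_aut_def)

lemma aut_bij: "aut g \<Longrightarrow> bij g"
  by (simp add: order_aut_def)

lemma aut_eq_iff: "aut g \<Longrightarrow> g a = g b \<longleftrightarrow> a = b"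
  by (meson aut_bij bij_is_inj inj_eq)

lemma aut_image_iff: "aut g \<Longrightarrow> g a \<in> g ` X \<longleftrightarrow> a \<in> X"
  by (metis aut_eq_iff imageE image_eqI)

lemma aut_surj: "aut g \<Longrightarrow> \<exists>b. a = g b"
  by (metis aut_bij bij_pointE)

lemma aut_inv: "aut g \<Longrightarrow> aut (inv g)"
  unfolding order_aut_def by (metis bij_imp_bij_inv bij_inv_eq_iff)

lemma aut_inv_apply: "aut g \<Longrightarrow> inv g (g a) = a" "aut g \<Longrightarrow> g (inv g a) = a"
  by (simp_all add: aut_bij bij_is_inj bij_is_surj surj_f_inv_f)

lemma aut_image_inv: "aut g \<Longrightarrow> g ` inv g ` X = X" "aut g \<Longrightarrow> inv g ` g ` X = X"
  by (auto simp: image_image aut_inv_apply)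

lemma aut_image_UNIV: "aut g \<Longrightarrow> g ` UNIV = UNIV"
  by (simp add: aut_bij bij_is_surj)

lemma ex_aut_one: "\<exists>g. aut g \<and> g a = b"
  using homogeneous[of "{a}" "\<lambda>_. b"] by auto

section \<open>Types of pairs and the automorphisms that homogeneity gives for them\<close>

definition same_type :: "nat \<Rightarrow> nat \<Rightarrow> nat \<Rightarrow> nat \<Rightarrow> bool" where
  "same_type a b c d \<longleftrightarrow> a \<noteq> b \<and> c \<noteq> d \<and> (\<forall>i\<in>I. lt i a b \<longleftrightarrow> lt i c d)"

lemma same_type_swap: "same_type a b c d \<Longrightarrow> same_type b a d c"
  unfolding same_type_def by (metis lt_asym lt_total)

lemma same_type_sym: "same_type a b c d \<Longrightarrow> same_type c d a b"
  unfolding same_type_def by auto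

lemma same_type_trans: "same_type a b c d \<Longrightarrow> same_type c d e f \<Longrightarrow> same_type a b e f"
  unfolding same_type_def by auto

text \<open>Each order or its reverse leads from \<open>a\<close> to \<open>b\<close> and from
  \<open>b\<close> to \<open>c\<close>, hence from \<open>a\<close> to \<open>c\<close>. A member of
  \<open>I\<close> is what excludes \<open>a = c\<close>.\<close>

lemma same_type_compose:
  assumes "same_type a b b c" "I \<noteq> {}"
  shows "same_type a b a c"
proof -
  obtain i where i: "i \<in> I" using assms(2) by blast
  have *: "lt j a b \<longleftrightarrow> lt j a c" if "j \<in> I" for j
    using assms(1) that unfolding same_type_def by (metis lt_trans not_lt)
  have "a \<noteq> c" using assms(1) i unfolding same_type_def by (metis lt_asym lt_total)
  then show ?thesis using * assms(1) unfolding same_type_def by auto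
qed

lemma same_type_aut: "aut g \<Longrightarrow> a \<noteq> b \<Longrightarrow> same_type a b (g a) (g b)"
  unfolding same_type_def by (simp add: autD aut_eq_iff)

lemma ex_aut_insert:
  assumes "finite B" "z \<notin> B" "z' \<notin> B"
    and "\<And>i b. i \<in> I \<Longrightarrow> b \<in> B \<Longrightarrow> lt i b z \<longleftrightarrow> lt i b z'"
  shows "\<exists>g. aut g \<and> (\<forall>b\<in>B. g b = b) \<and> g z = z'"
proof -
  let ?f = "\<lambda>x. if x = z then z' else x"
  have "lt i z b \<longleftrightarrow> lt i z' b" if "i \<in> I" "b \<in> B" for i b
    using assms(2,3) assms(4)[OF that] that(2) by (metis not_lt)
  then have "\<exists>g. aut g \<and> (\<forall>a\<in>insert z B. g a = ?f a)"
    using assms by (intro homogeneous) (auto simp: inj_on_def)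
  then obtain g where "aut g" "\<forall>a\<in>insert z B. g a = ?f a" by blast
  moreover have "?f b = b" if "b \<in> B" for b using assms(2) that by auto
  ultimately show ?thesis by (intro exI[of _ g]) simp
qed

lemma ex_aut_two:
  assumes "same_type a b c d"
  shows "\<exists>g. aut g \<and> g a = c \<and> g b = d"
proof -
  let ?f = "\<lambda>x. if x = a then c else d"
  have "\<exists>g. aut g \<and> (\<forall>x\<in>{a,b}. g x = ?f x)"
    using assms same_type_swap[OF assms] unfolding same_type_def
    by (intro homogeneous) (auto simp: inj_on_def)
  then show ?thesis using assms unfolding same_type_def by auto
qed

lemma ex_aut_three:
  assumes "same_type a b a' b'" "same_type a c a' c'" "same_type b c b' c'"
  shows "\<exists>g. aut g \<and> g a = a' \<and> g b = b' \<and> g c = c'"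
proof -
  let ?f = "\<lambda>x. if x = a then a' else if x = b then b' else c'"
  have "\<exists>g. aut g \<and> (\<forall>x\<in>{a,b,c}. g x = ?f x)"
    using assms assms[THEN same_type_swap] unfolding same_type_def
    by (intro homogeneous) (auto simp: inj_on_def)
  then show ?thesis using assms unfolding same_type_def by auto
qed

lemma invariant_set_trivial:
  assumes "\<And>g x. aut g \<Longrightarrow> x \<in> X \<Longrightarrow> g x \<in> X" and "X \<noteq> {}"
  shows "X = UNIV"
  using assms ex_aut_one by (metis UNIV_eq_I all_not_in_conv)

section \<open>Tuples of cuts as limits of points, and their compactness\<close>

definition down :: "nat \<Rightarrow> nat set \<Rightarrow> bool" where
  "down i X \<longleftrightarrow> (\<forall>a b. b \<in> X \<longrightarrow> lt i a b \<longrightarrow> a \<in> X)"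

definition realizes :: "nat set \<Rightarrow> nat \<Rightarrow> (nat \<Rightarrow> nat set) \<Rightarrow> bool" where
  "realizes F z \<zeta> \<longleftrightarrow> z \<notin> F \<and> (\<forall>i\<in>I. \<forall>b\<in>F. b \<in> \<zeta> i \<longleftrightarrow> lt i b z)"

text \<open>These are the quantifier-free 1-types over the whole structure that no point realizes:
  \<open>realizes\<close> keeps \<open>z\<close> outside \<open>F\<close>. Values at indices outside
  \<open>I\<close> are unconstrained.\<close>

definition realizable :: "(nat \<Rightarrow> nat set) \<Rightarrow> bool" where
  "realizable \<zeta> \<longleftrightarrow> (\<forall>F. finite F \<longrightarrow> (\<exists>z. realizes F z \<zeta>))"

definition proper :: "nat set \<Rightarrow> bool" where
  "proper X \<longleftrightarrow> X \<noteq> {} \<and> X \<noteq> UNIV"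

lemma downD: "down i X \<Longrightarrow> b \<in> X \<Longrightarrow> lt i a b \<Longrightarrow> a \<in> X"
  unfolding down_def by blast

lemma down_linear: "down i X \<Longrightarrow> down i Y \<Longrightarrow> X \<subseteq> Y \<or> Y \<subseteq> X"
  unfolding down_def by (metis lt_total subsetI)

lemma realizesD: "realizes F z \<zeta> \<Longrightarrow> i \<in> I \<Longrightarrow> b \<in> F \<Longrightarrow> b \<in> \<zeta> i \<longleftrightarrow> lt i b z"
  "realizes F z \<zeta> \<Longrightarrow> b \<in> F \<Longrightarrow> z \<noteq> b"
  unfolding realizes_def by auto

lemma realizes_above: "realizes F z \<zeta> \<Longrightarrow> i \<in> I \<Longrightarrow> b \<in> F \<Longrightarrow> b \<notin> \<zeta> i \<longleftrightarrow> lt i z b"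
  unfolding realizes_def by (metis lt_asym lt_total)

lemma realizes_subset: "realizes F z \<zeta> \<Longrightarrow> F' \<subseteq> F \<Longrightarrow> realizes F' z \<zeta>"
  unfolding realizes_def by blast

lemma realizable_down:
  assumes "realizable \<zeta>" "i \<in> I"
  shows "down i (\<zeta> i)"
  unfolding down_def
proof (intro allI impI)
  fix a b assume "b \<in> \<zeta> i" "lt i a b"
  moreover obtain z where z: "realizes {a, b} z \<zeta>"
    using assms(1) unfolding realizable_def by (meson finite.emptyI finite.insertI)
  have "a \<in> \<zeta> i \<longleftrightarrow> lt i a z" "b \<in> \<zeta> i \<longleftrightarrow> lt i b z" using realizesD(1)[OF z assms(2)] by auto
  ultimately show "a \<in> \<zeta> i" using lt_trans by auto
qed

lemma realizable_act:
  assumes "aut g" "realizable \<zeta>"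
  shows "realizable (\<lambda>i. g ` \<zeta> i)"
  unfolding realizable_def
proof (intro allI impI)
  fix F :: "nat set" assume "finite F"
  then obtain z where z: "realizes (inv g ` F) z \<zeta>" using assms(2) unfolding realizable_def by blast
  have "realizes F (g z) (\<lambda>i. g ` \<zeta> i)"
    unfolding realizes_def
  proof (intro conjI ballI)
    show "g z \<notin> F" using z assms(1) by (metis aut_inv_apply(1) image_eqI realizes_def)
    fix i b assume i: "i \<in> I" and "b \<in> F"
    then have "inv g b \<in> \<zeta> i \<longleftrightarrow> lt i (inv g b) z" using z by (simp add: realizesD)
    then show "b \<in> g ` \<zeta> i \<longleftrightarrow> lt i b (g z)"
      by (metis aut_image_iff aut_inv_apply(2) autD assms(1) i)
  qed
  then show "\<exists>z. realizes F z (\<lambda>i. g ` \<zeta> i)" by blast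
qed

lemma proper_act: "aut g \<Longrightarrow> proper (g ` X) \<longleftrightarrow> proper X"
  unfolding proper_def by (metis aut_image_UNIV aut_image_inv(2) image_is_empty)

text \<open>An argument in the style of Koenig's lemma: the cuts are decided at the points 0, 1, 2
  and so on, always keeping for every finite \<open>F\<close> a point that satisfies
  \<open>Q F\<close> and conforms to all decisions made so far.\<close>

lemma compactness:
  assumes ex: "\<And>F. finite F \<Longrightarrow> \<exists>z. z \<notin> F \<and> Q F z"
    and anti: "\<And>F F' z. F \<subseteq> F' \<Longrightarrow> Q F' z \<Longrightarrow> Q F z"
  shows "\<exists>\<zeta>. realizable \<zeta> \<and> (\<forall>F. finite F \<longrightarrow> (\<exists>z. realizes F z \<zeta> \<and> Q F z))"
proof -
  define good where "good N \<zeta> \<longleftrightarrow> (\<forall>F. finite F \<longrightarrow> (\<exists>z. z \<notin> F \<and> Q F z \<and>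
      (\<forall>i\<in>I. \<forall>b<N. b \<in> \<zeta> i \<longleftrightarrow> lt i b z)))" for N and \<zeta> :: "nat \<Rightarrow> nat set"
  have step: "\<exists>\<zeta>'. good (Suc N) \<zeta>' \<and> (\<forall>i\<in>I. \<forall>b<N. b \<in> \<zeta>' i \<longleftrightarrow> b \<in> \<zeta> i)"
    if gd: "good N \<zeta>" for N \<zeta>
  proof (rule ccontr)
    define ext where "ext v i = (\<zeta> i - {N}) \<union> (if i \<in> v then {N} else {})" for v i
    have ext_b: "b \<in> ext v i \<longleftrightarrow> b \<in> \<zeta> i" if "b < N" for b v i
      using that by (auto simp: ext_def)
    have ext_N: "N \<in> ext v i \<longleftrightarrow> i \<in> v" for v i by (auto simp: ext_def)
    assume "\<not> ?thesis"
    then have nb: "\<not> good (Suc N) (ext v)" for v using ext_b by blast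
    have "\<forall>v. \<exists>F. finite F \<and> \<not> (\<exists>z. z \<notin> F \<and> Q F z \<and>
        (\<forall>i\<in>I. \<forall>b<Suc N. b \<in> ext v i \<longleftrightarrow> lt i b z))"
      using nb unfolding good_def not_all not_imp by (intro allI)
    from choice[OF this] obtain \<Phi> where \<Phi>: "\<forall>v. finite (\<Phi> v) \<and> \<not> (\<exists>z. z \<notin> \<Phi> v \<and> Q (\<Phi> v) z \<and>
        (\<forall>i\<in>I. \<forall>b<Suc N. b \<in> ext v i \<longleftrightarrow> lt i b z))" ..
    have fin: "finite (\<Phi> v)" for v using \<Phi> by simp
    \<comment> \<open>Suppose that each of the finitely many decisions \<open>v\<close> at
      \<open>N\<close> is refuted by a finite set. A witness for the union of these sets makes one
      of the decisions, and by \<open>anti\<close> it contradicts the refutation of that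
      one.\<close>
    define F where "F = (\<Union>v\<in>Pow I. \<Phi> v)"
    have "finite F" using fin finite_I by (simp add: F_def)
    then obtain z where z: "z \<notin> F" "Q F z" "\<forall>i\<in>I. \<forall>b<N. b \<in> \<zeta> i \<longleftrightarrow> lt i b z"
      using gd unfolding good_def by blast
    define v where "v = {i\<in>I. lt i N z}"
    have sub: "\<Phi> v \<subseteq> F" unfolding F_def by (rule UN_upper) (simp add: v_def)
    have "\<forall>i\<in>I. \<forall>b<Suc N. b \<in> ext v i \<longleftrightarrow> lt i b z"
      using z(3) ext_b ext_N by (auto simp: less_Suc_eq v_def)
    moreover have "z \<notin> \<Phi> v" "Q (\<Phi> v) z" using sub z(1,2) anti[OF sub] by auto
    moreover have "\<not> (\<exists>z. z \<notin> \<Phi> v \<and> Q (\<Phi> v) z \<and> (\<forall>i\<in>I. \<forall>b<Suc N. b \<in> ext v i \<longleftrightarrow> lt i b z))"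
      using \<Phi> by (rule allE[of _ v]) (erule conjunct2)
    ultimately show False by blast
  qed
  have "\<exists>f. \<forall>N. good N (f N) \<and> (\<forall>i\<in>I. \<forall>b<N. b \<in> f (Suc N) i \<longleftrightarrow> b \<in> f N i)"
  proof (rule dependent_nat_choice)
    show "\<exists>\<zeta>. good 0 \<zeta>" using ex unfolding good_def by blast
  qed (use step in blast)
  then obtain f where f: "\<And>N. good N (f N)"
    and agree: "\<And>N i b. i \<in> I \<Longrightarrow> b < N \<Longrightarrow> b \<in> f (Suc N) i \<longleftrightarrow> b \<in> f N i"
    by blast
  \<comment> \<open>Stage \<open>Suc b\<close> is the first that has decided the point
    \<open>b\<close>, and later stages do not change the decision.\<close>
  define \<zeta> where "\<zeta> i = {b. b \<in> f (Suc b) i}" for i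
  have agree': "b \<in> f (Suc b + k) i \<longleftrightarrow> b \<in> \<zeta> i" if "i \<in> I" for b i k
    by (induction k) (use agree[OF that] in \<open>auto simp: \<zeta>_def\<close>)
  have main: "\<exists>z. realizes F z \<zeta> \<and> Q F z" if finF: "finite F" for F
  proof -
    obtain N where N: "\<forall>b\<in>F. b < N" using \<open>finite F\<close> finite_nat_set_iff_bounded by blast
    obtain z where z: "z \<notin> F" "Q F z" "\<forall>i\<in>I. \<forall>b<N. b \<in> f N i \<longleftrightarrow> lt i b z"
      using f[of N, unfolded good_def, rule_format, OF finF] by blast
    have "b \<in> f N i \<longleftrightarrow> b \<in> \<zeta> i" if "i \<in> I" "b \<in> F" for i b
      using agree'[OF that(1), of b "N - Suc b"] N that(2) by (metis Suc_leI le_add_diff_inverse)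
    then show ?thesis using z N by (auto simp: realizes_def)
  qed
  then show ?thesis unfolding realizable_def by blast
qed

text \<open>\<open>compactness\<close> is applied to the points that realize some admissible tuple
  over \<open>F\<close>. A point that realizes both the limit and an admissible tuple over
  \<open>F\<close> shows that the two agree on \<open>F\<close>.\<close>

lemma compactness_realizable:
  assumes ex: "\<And>F. finite F \<Longrightarrow> \<exists>\<zeta>. realizable \<zeta> \<and> Q F \<zeta>"
    and anti: "\<And>F F' \<zeta>. F \<subseteq> F' \<Longrightarrow> Q F' \<zeta> \<Longrightarrow> Q F \<zeta>"
  shows "\<exists>\<zeta>. realizable \<zeta> \<and> (\<forall>F. finite F \<longrightarrow>
    (\<exists>\<zeta>'. realizable \<zeta>' \<and> Q F \<zeta>' \<and> (\<forall>i\<in>I. \<forall>b\<in>F. b \<in> \<zeta>' i \<longleftrightarrow> b \<in> \<zeta> i)))"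
proof -
  let ?Q = "\<lambda>F z. \<exists>\<zeta>'. realizable \<zeta>' \<and> Q F \<zeta>' \<and> realizes F z \<zeta>'"
  have "\<exists>\<zeta>. realizable \<zeta> \<and> (\<forall>F. finite F \<longrightarrow> (\<exists>z. realizes F z \<zeta> \<and> ?Q F z))"
  proof (rule compactness[where Q = ?Q])
    fix F :: "nat set" assume "finite F"
    then obtain \<zeta>' z where "realizable \<zeta>'" "Q F \<zeta>'" "realizes F z \<zeta>'"
      using ex unfolding realizable_def by meson
    then show "\<exists>z. z \<notin> F \<and> ?Q F z" by (meson realizes_def)
  next
    fix F F' :: "nat set" and z assume "F \<subseteq> F'" "?Q F' z"
    then show "?Q F z" using anti realizes_subset by meson
  qed
  then obtain \<zeta> where \<zeta>: "realizable \<zeta>" "\<forall>F. finite F \<longrightarrow> (\<exists>z. realizes F z \<zeta> \<and> ?Q F z)"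
    by blast
  show ?thesis
  proof (rule exI[of _ \<zeta>], intro conjI allI impI)
    fix F :: "nat set" assume "finite F"
    then obtain z \<zeta>' where *: "realizes F z \<zeta>" "realizable \<zeta>'" "Q F \<zeta>'" "realizes F z \<zeta>'"
      using \<zeta>(2) by blast
    have "\<forall>i\<in>I. \<forall>b\<in>F. b \<in> \<zeta>' i \<longleftrightarrow> b \<in> \<zeta> i"
      using realizesD(1)[OF *(1)] realizesD(1)[OF *(4)] by blast
    with *(2,3) show "\<exists>\<zeta>'. realizable \<zeta>' \<and> Q F \<zeta>' \<and> (\<forall>i\<in>I. \<forall>b\<in>F. b \<in> \<zeta>' i \<longleftrightarrow> b \<in> \<zeta> i)"
      by blast
  qed (use \<zeta>(1) in blast)
qed

text \<open>By Ramsey's theorem there is a type whose intervals are arbitrarily large, hence infinite.\<close>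

lemma ex_infinite_interval:
  "\<exists>a b. infinite {x. same_type a b a x \<and> same_type a b x b}" if "I \<noteq> {}"
proof -
  define col where "col X = {i\<in>I. lt i (Min X) (Max X)}" for X
  obtain h where h: "bij_betw h (Pow I) {..<card (Pow I)}"
    using ex_bij_betw_finite_nat[of "Pow I"] finite_I by (auto simp: atLeast0LessThan)
  have "\<exists>Y t. Y \<subseteq> UNIV \<and> infinite Y \<and> t < card (Pow I) \<and>
     (\<forall>x\<in>Y. \<forall>y\<in>Y. x \<noteq> y \<longrightarrow> h (col {x, y}) = t)"
  proof (rule Ramsey2[where f = "\<lambda>X. h (col X)"])
    show "\<forall>x\<in>UNIV. \<forall>y\<in>UNIV. x \<noteq> y \<longrightarrow> h (col {x, y}) < card (Pow I)"
      using h bij_betwE[OF h] by (simp add: col_def)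
  qed simp
  then obtain Y t where Yt: "Y \<subseteq> UNIV \<and> infinite Y \<and> t < card (Pow I) \<and>
     (\<forall>x\<in>Y. \<forall>y\<in>Y. x \<noteq> y \<longrightarrow> h (col {x, y}) = t)"
    by (elim exE)
  then have Y: "infinite Y" and t: "\<And>x y. x \<in> Y \<Longrightarrow> y \<in> Y \<Longrightarrow> x \<noteq> y \<Longrightarrow> h (col {x, y}) = t"
    by simp_all
  have st: "same_type x y x' y'"
    if "x \<in> Y" "y \<in> Y" "x' \<in> Y" "y' \<in> Y" "x < y" "x' < y'" for x y x' y'
  proof -
    have "h (col {x, y}) = h (col {x', y'})" using t[of x y] t[of x' y'] that by auto
    then have "col {x, y} = col {x', y'}"
      using h by (auto simp: bij_betw_def col_def inj_on_def)
    then show ?thesis using that by (auto simp: same_type_def col_def min_def max_def)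
  qed
  define a where "a = enumerate Y 0"
  define b where "b = enumerate Y 1"
  let ?B = "\<lambda>u v. {x. same_type a b u x \<and> same_type a b x v}"
  have "\<not> card (?B a b) < Suc m \<or> infinite (?B a b)" for m
  proof -
    \<comment> \<open>The offset leaves the \<open>m + 1\<close> places 1 to \<open>m + 1\<close> of
      \<open>Y\<close> between \<open>a\<close> and \<open>c\<close>. As \<open>(a, c)\<close> has
      the type of \<open>(a, b)\<close>, an automorphism moves them between \<open>a\<close> and
      \<open>b\<close>.\<close>
    define c where "c = enumerate Y (m + 2)"
    have mem: "enumerate Y k \<in> Y" for k using Y by (simp add: enumerate_in_set)
    have less: "enumerate Y k < enumerate Y l \<longleftrightarrow> k < l" for k l
      using enumerate_mono_iff[OF Y] by blast
    have "same_type a b a c" unfolding a_def b_def c_def by (intro st mem) (simp_all add: less)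
    then have "\<exists>g. aut g \<and> g a = a \<and> g c = b" by (rule ex_aut_two[OF same_type_sym])
    then obtain g where g: "aut g" "g a = a" "g c = b" by blast
    have "(g \<circ> enumerate Y) ` {1..m + 1} \<subseteq> ?B a b"
    proof
      fix y assume "y \<in> (g \<circ> enumerate Y) ` {1..m + 1}"
      then obtain k where k: "1 \<le> k" "k \<le> m + 1" "y = g (enumerate Y k)" by auto
      have "same_type a b a (enumerate Y k)" "same_type a b (enumerate Y k) c"
        unfolding a_def b_def c_def using k by (auto intro!: st mem simp: less)
      then show "y \<in> ?B a b"
        using same_type_aut[OF g(1)] g(2,3) k(3) same_type_trans unfolding mem_Collect_eq
        by (metis same_type_def)
    qed
    moreover have "inj_on (g \<circ> enumerate Y) {1..m + 1}"
      using aut_eq_iff[OF g(1)] less by (auto simp: inj_on_def) (metis linorder_neq_iff)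
    ultimately have "card {1..m + 1} \<le> card (?B a b)" if "finite (?B a b)"
      using that card_inj_on_le by blast
    then show ?thesis by fastforce
  qed
  then have "infinite (?B a b)" by blast
  then show ?thesis by blast
qed

text \<open>Having only finitely many points in between is an invariant equivalence relation. It is
  not universal by \<open>ex_infinite_interval\<close>, so primitivity makes it equality.\<close>

lemma infinite_between:
  assumes "i \<in> I" "lt i a b"
  shows "infinite {x. lt i a x \<and> lt i x b}"
proof -
  define R where "R x y \<longleftrightarrow> finite {u. lt i x u \<and> lt i u y \<or> lt i y u \<and> lt i u x}" for x y
  have "(\<forall>x y. R x y \<longrightarrow> x = y) \<or> (\<forall>x y. R x y)"
  proof (rule primitive)
    have "{u. lt i x u \<and> lt i u x \<or> lt i x u \<and> lt i u x} = {}" for x using lt_asym by blast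
    then show "R x x" for x unfolding R_def by (simp only: finite.emptyI)
    show "R y x" if "R x y" for x y using that by (simp add: R_def disj_commute)
    show "R x z" if "R x y" "R y z" for x y z
      unfolding R_def
    proof (rule finite_subset)
      show "finite (insert y ({u. lt i x u \<and> lt i u y \<or> lt i y u \<and> lt i u x} \<union>
          {u. lt i y u \<and> lt i u z \<or> lt i z u \<and> lt i u y}))"
        using that by (simp add: R_def)
      show "{u. lt i x u \<and> lt i u z \<or> lt i z u \<and> lt i u x} \<subseteq>
          insert y ({u. lt i x u \<and> lt i u y \<or> lt i y u \<and> lt i u x} \<union>
          {u. lt i y u \<and> lt i u z \<or> lt i z u \<and> lt i u y})"
        using lt_total by auto
    qed
    show "R (g x) (g y)" if g: "aut g" and "R x y" for g x y
    proof -
      have "{u. lt i (g x) u \<and> lt i u (g y) \<or> lt i (g y) u \<and> lt i u (g x)}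
          \<subseteq> g ` {u. lt i x u \<and> lt i u y \<or> lt i y u \<and> lt i u x}"
      proof
        fix u assume u: "u \<in> {u. lt i (g x) u \<and> lt i u (g y) \<or> lt i (g y) u \<and> lt i u (g x)}"
        obtain v where "u = g v" using aut_surj[OF g] by blast
        then show "u \<in> g ` {u. lt i x u \<and> lt i u y \<or> lt i y u \<and> lt i u x}"
          using u by (simp add: autD[OF that(1) assms(1)])
      qed
      then show ?thesis using that(2) unfolding R_def by (meson finite_imageI finite_subset)
    qed
  qed
  moreover obtain c d where cd: "infinite {x. same_type c d c x \<and> same_type c d x d}"
    using ex_infinite_interval assms(1) by blast
  have "{x. same_type c d c x \<and> same_type c d x d} \<subseteq> {u. lt i c u \<and> lt i u d \<or> lt i d u \<and> lt i u c}"
    using assms(1) unfolding same_type_def by (auto simp: not_lt)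
  then have "\<not> R c d" using cd unfolding R_def using finite_subset by blast
  ultimately have "\<not> R a b" using assms(2) lt_irrefl by blast
  moreover have "\<not> (lt i b u \<and> lt i u a)" for u using assms(2) lt_asym lt_trans by metis
  then have "{u. lt i a u \<and> lt i u b \<or> lt i b u \<and> lt i u a} = {x. lt i a x \<and> lt i x b}" by blast
  ultimately show ?thesis by (simp add: R_def)
qed

lemma dense: "i \<in> I \<Longrightarrow> lt i a b \<Longrightarrow> \<exists>x. lt i a x \<and> lt i x b"
  using infinite_between by (metis (no_types, lifting) Collect_empty_eq finite.emptyI)

lemma no_max: assumes "i \<in> I" shows "\<exists>b. lt i a b"
proof (rule ccontr)
  assume *: "\<nexists>b. lt i a b"
  have "\<not> lt i x b" for x b
  proof -
    obtain g where g: "aut g" "g x = a" using ex_aut_one by blast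
    then show ?thesis using * autD[OF g(1) assms] by metis
  qed
  then show False using lt_total[of 0 1 i] by simp
qed

lemma no_min: assumes "i \<in> I" shows "\<exists>b. lt i b a"
proof (rule ccontr)
  assume *: "\<nexists>b. lt i b a"
  have "\<not> lt i b x" for x b
  proof -
    obtain g where g: "aut g" "g x = a" using ex_aut_one by blast
    then show ?thesis using * autD[OF g(1) assms] by metis
  qed
  then show False using lt_total[of 0 1 i] by simp
qed

text \<open>A limit of points from an infinite interval of a type has the two ends of that interval
  on different sides in every order.\<close>

lemma ex_all_proper: "\<exists>\<zeta>. realizable \<zeta> \<and> (\<forall>i\<in>I. proper (\<zeta> i))"
proof (cases "I = {}")
  case True
  have "\<exists>z::nat. z \<notin> F" if "finite F" for F using that ex_new_if_finite infinite_UNIV_nat by blast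
  then have "realizable (\<lambda>_. {})" unfolding realizable_def realizes_def using True by blast
  then show ?thesis using True by blast
next
  case False
  then obtain a b where inf: "infinite {x. same_type a b a x \<and> same_type a b x b}"
    using ex_infinite_interval by blast
  have "\<exists>z. z \<notin> F \<and> same_type a b a z \<and> same_type a b z b" if "finite F" for F
  proof -
    have "infinite ({x. same_type a b a x \<and> same_type a b x b} - F)" using inf that by simp
    then show ?thesis using infinite_imp_nonempty by blast
  qed
  then obtain \<zeta> where \<zeta>: "realizable \<zeta>"
    "\<And>F. finite F \<Longrightarrow> \<exists>z. realizes F z \<zeta> \<and> same_type a b a z \<and> same_type a b z b"
    using compactness[of "\<lambda>F z. same_type a b a z \<and> same_type a b z b"] by blast
  obtain z where z: "realizes {a,b} z \<zeta>" "same_type a b a z" "same_type a b z b"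
    using \<zeta>(2)[of "{a,b}"] by auto
  have "proper (\<zeta> i)" if i: "i \<in> I" for i
  proof -
    have "a \<in> \<zeta> i \<longleftrightarrow> lt i a z" "b \<in> \<zeta> i \<longleftrightarrow> lt i b z" using z(1) i realizesD by auto
    moreover have "lt i a z \<longleftrightarrow> \<not> lt i b z"
      using z(2,3) i unfolding same_type_def by (metis lt_asym lt_total)
    ultimately show ?thesis unfolding proper_def by blast
  qed
  then show ?thesis using \<zeta>(1) by blast
qed

section \<open>Edges\<close>

text \<open>All cuts of the order \<open>i\<close> are realized at infinity in the other orders; \<open>\<eta>\<close> tells at which end.\<close>

definition edge :: "nat \<Rightarrow> bool" where
  "edge i \<longleftrightarrow> (\<exists>\<eta>. (\<forall>j. \<eta> j = {} \<or> \<eta> j = UNIV) \<and> (\<forall>a b. lt i a b \<longrightarrow>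
     (\<exists>\<zeta>. realizable \<zeta> \<and> a \<in> \<zeta> i \<and> b \<notin> \<zeta> i \<and> (\<forall>j\<in>I - {i}. \<zeta> j = \<eta> j))))"

text \<open>Points of an edge on the two sides of a cut that is not next to \<open>F\<close> have the same type over
  \<open>F\<close>, so the cut is not fixed by the automorphisms fixing \<open>F\<close>.\<close>

lemma edge_invariant_cut:
  assumes "edge e" and e: "e \<in> I" and "finite F" and X: "down e X" "proper X"
    and inv: "\<And>g x. aut g \<Longrightarrow> (\<forall>f\<in>F. g f = f) \<Longrightarrow> x \<in> X \<Longrightarrow> g x \<in> X"
  shows "\<exists>f\<in>F. X = {x. lt e x f} \<or> X = {x. \<not> lt e f x}"
proof (rule ccontr)
  assume no: "\<not> ?thesis"
  \<comment> \<open>As \<open>X\<close> is not next to a point of \<open>F\<close>, there is room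
    for an interval \<open>(x', x)\<close> inside \<open>X\<close> above
    \<open>F \<inter> X\<close>, and below for an interval \<open>(y, y')\<close> outside
    \<open>X\<close> and below \<open>F - X\<close>.\<close>
  have "\<exists>x' x. lt e x' x \<and> x \<in> X \<and> (\<forall>f\<in>F \<inter> X. lt e f x')"
  proof (cases "F \<inter> X = {}")
    case True
    then show ?thesis using X(2) no_min[OF e] unfolding proper_def by blast
  next
    case False
    then obtain m where m: "m \<in> F \<inter> X" "\<forall>f\<in>F \<inter> X. \<not> lt e m f"
      using finite_has_max[of "F \<inter> X"] assms(3) by blast
    have "{x. \<not> lt e m x} \<subseteq> X" using X(1) m(1) unfolding down_def by (metis IntD2 mem_Collect_eq not_lt subsetI)
    then obtain x where "x \<in> X" "lt e m x" using no m(1) by blast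
    then show ?thesis using dense[OF e, of m x] m(2) le_lt_trans by blast
  qed
  then obtain x' x where x: "lt e x' x" "x \<in> X" "\<And>f. f \<in> F \<Longrightarrow> f \<in> X \<Longrightarrow> lt e f x'" by blast
  have "\<exists>y y'. lt e y y' \<and> y \<notin> X \<and> (\<forall>f\<in>F - X. lt e y' f)"
  proof (cases "F - X = {}")
    case True
    then show ?thesis using X(2) no_max[OF e] unfolding proper_def by blast
  next
    case False
    then obtain m where m: "m \<in> F - X" "\<forall>f\<in>F - X. \<not> lt e f m"
      using finite_has_min[of "F - X"] assms(3) by blast
    have "X \<subseteq> {x. lt e x m}" using X(1) m(1) unfolding down_def by (metis DiffD2 mem_Collect_eq not_lt subsetI)
    then obtain y where "y \<notin> X" "lt e y m" using no m(1) by blast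
    then show ?thesis using dense[OF e, of y m] m(2) lt_le_trans by blast
  qed
  then obtain y y' where y: "lt e y y'" "y \<notin> X" "\<And>f. f \<in> F \<Longrightarrow> f \<notin> X \<Longrightarrow> lt e y' f" by blast
  obtain \<eta> where \<eta>: "\<And>a b. lt e a b \<Longrightarrow>
      \<exists>\<zeta>. realizable \<zeta> \<and> a \<in> \<zeta> e \<and> b \<notin> \<zeta> e \<and> (\<forall>j\<in>I - {e}. \<zeta> j = \<eta> j)"
    using assms(1) unfolding edge_def by blast
  obtain \<zeta> where \<zeta>: "realizable \<zeta>" "x' \<in> \<zeta> e" "x \<notin> \<zeta> e" "\<forall>j\<in>I - {e}. \<zeta> j = \<eta> j"
    using \<eta>[OF x(1)] by blast
  obtain \<xi> where \<xi>: "realizable \<xi>" "y \<in> \<xi> e" "y' \<notin> \<xi> e" "\<forall>j\<in>I - {e}. \<xi> j = \<eta> j"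
    using \<eta>[OF y(1)] by blast
  let ?H = "F \<union> {x, x', y, y'}"
  obtain z where z: "realizes ?H z \<zeta>" using \<zeta>(1) assms(3) unfolding realizable_def by fastforce
  obtain z' where z': "realizes ?H z' \<xi>" using \<xi>(1) assms(3) unfolding realizable_def by fastforce
  have d\<zeta>: "down e (\<zeta> e)" and d\<xi>: "down e (\<xi> e)"
    using realizable_down[OF \<zeta>(1) e] realizable_down[OF \<xi>(1) e] by auto
  \<comment> \<open>The two limits are at the ends given by \<open>\<eta>\<close> in the other
    orders, and in \<open>e\<close> they leave each point of \<open>F\<close> on the same
    side.\<close>
  have same: "lt i f z \<longleftrightarrow> lt i f z'" if i: "i \<in> I" and f: "f \<in> F" for i f
  proof -
    have "f \<in> \<zeta> i \<longleftrightarrow> f \<in> \<xi> i"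
    proof (cases "i = e")
      case False
      then show ?thesis using \<zeta>(4) \<xi>(4) i by simp
    next
      case True
      show ?thesis
      proof (cases "f \<in> X")
        case fX: True
        have "lt e f y" using fX y(2) X(1) downD by (metis not_lt)
        then show ?thesis using True x(3)[OF f fX] \<zeta>(2) \<xi>(2) d\<zeta> d\<xi> downD by blast
      next
        case fX: False
        have "lt e x f" using fX x(2) X(1) downD by (metis not_lt)
        then show ?thesis using True y(3)[OF f fX] \<zeta>(3) \<xi>(3) d\<zeta> d\<xi> downD by blast
      qed
    qed
    then show ?thesis using realizesD(1)[OF z i] realizesD(1)[OF z' i] f by auto
  qed
  have "z \<notin> F" "z' \<notin> F" using z z' unfolding realizes_def by auto
  then obtain g where g: "aut g" "\<forall>f\<in>F. g f = f" "g z = z'"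
    using ex_aut_insert[OF assms(3) _ _ same] by blast
  have "lt e z x" using realizes_above[OF z e, of x] \<zeta>(3) by simp
  then have "z \<in> X" using x(2) X(1) downD by blast
  then have "z' \<in> X" using inv[OF g(1,2)] g(3) by blast
  moreover have "lt e y z'" using realizesD(1)[OF z' e, of y] \<xi>(2) by simp
  ultimately show False using y(2) X(1) downD by blast
qed

text \<open>The pairs that no member of \<open>S\<close> separates in the order \<open>j\<close>
  form an invariant equivalence relation, which is not universal because of the proper cut
  \<open>\<zeta>' j\<close>. Primitivity makes it equality.\<close>

lemma ex_separating:
  assumes S: "\<And>\<zeta>. \<zeta> \<in> S \<Longrightarrow> realizable \<zeta>"
    and inv: "\<And>g \<zeta>. aut g \<Longrightarrow> \<zeta> \<in> S \<Longrightarrow> (\<lambda>i. g ` \<zeta> i) \<in> S"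
    and "\<zeta>' \<in> S" "proper (\<zeta>' j)" and j: "j \<in> I" and "lt j a b"
  shows "\<exists>\<zeta>\<in>S. a \<in> \<zeta> j \<and> b \<notin> \<zeta> j"
proof -
  define R where "R x y \<longleftrightarrow> (\<forall>\<zeta>\<in>S. x \<in> \<zeta> j \<longleftrightarrow> y \<in> \<zeta> j)" for x y
  have "(\<forall>x y. R x y \<longrightarrow> x = y) \<or> (\<forall>x y. R x y)"
  proof (rule primitive)
    fix g x y assume g: "aut g" and R: "R x y"
    show "R (g x) (g y)"
      unfolding R_def
    proof
      fix \<zeta> assume "\<zeta> \<in> S"
      then have "(\<lambda>i. inv g ` \<zeta> i) \<in> S" using inv[OF aut_inv[OF g]] by blast
      from bspec[OF R[unfolded R_def] this]
      have "x \<in> inv g ` \<zeta> j \<longleftrightarrow> y \<in> inv g ` \<zeta> j" .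
      then show "g x \<in> \<zeta> j \<longleftrightarrow> g y \<in> \<zeta> j" by (metis g aut_image_iff aut_image_inv(1))
    qed
  qed (auto simp: R_def)
  moreover have "\<exists>x y. \<not> R x y" using assms(3,4) unfolding R_def proper_def by blast
  ultimately have "\<not> R a b" using assms(6) lt_irrefl by blast
  then obtain \<zeta> where \<zeta>: "\<zeta> \<in> S" "(a \<in> \<zeta> j) \<noteq> (b \<in> \<zeta> j)" unfolding R_def by blast
  then have "a \<in> \<zeta> j \<and> b \<notin> \<zeta> j"
    using downD[OF realizable_down[OF S j] _ assms(6)] by blast
  then show ?thesis using \<zeta>(1) by blast
qed

text \<open>Otherwise one pair keeps and another reverses its direction. Both pairs lie inside a
  common interval \<open>(p, q)\<close> of the order \<open>i\<close>, and each of them imposes its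
  direction on \<open>p\<close> and \<open>q\<close>.\<close>

lemma between_imp_monotone:
  assumes i: "i \<in> I"
    and btw: "\<And>a b c. lt i a c \<Longrightarrow> lt i c b \<Longrightarrow> lt e a c \<and> lt e c b \<or> lt e b c \<and> lt e c a"
  shows "(\<forall>a b. lt i a b \<longrightarrow> lt e a b) \<or> (\<forall>a b. lt i a b \<longrightarrow> lt e b a)"
proof (rule ccontr)
  assume "\<not> ?thesis"
  then obtain a b c d where ab: "lt i a b" "\<not> lt e b a" and cd: "lt i c d" "\<not> lt e c d" by blast
  have e_ab: "lt e a b" using ab lt_irrefl not_lt by metis
  have e_cd: "lt e d c" using cd lt_irrefl not_lt by metis
  obtain m where "m \<in> {a, c}" "\<forall>x\<in>{a, c}. \<not> lt i x m" using finite_has_min[of "{a, c}"] by blast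
  moreover obtain p where "lt i p m" using no_min[OF i] by blast
  ultimately have p: "lt i p a" "lt i p c" using lt_le_trans by blast+
  obtain M where "M \<in> {b, d}" "\<forall>x\<in>{b, d}. \<not> lt i M x" using finite_has_max[of "{b, d}"] by blast
  moreover obtain q where "lt i M q" using no_max[OF i] by blast
  ultimately have q: "lt i b q" "lt i d q" using le_lt_trans by blast+
  have "lt e p b" using btw[OF p(1) ab(1)] e_ab lt_asym lt_trans by blast
  then have "lt e p q" using btw[of p b q] lt_trans[OF p(1) ab(1)] q(1) lt_asym lt_trans by blast
  moreover have "lt e d p" using btw[OF p(2) cd(1)] e_cd lt_asym lt_trans by blast
  then have "lt e q p" using btw[of p d q] lt_trans[OF p(2) cd(1)] q(2) lt_asym lt_trans by blast
  ultimately show False using lt_asym by blast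
qed

section \<open>Balls\<close>

text \<open>The ball of \<open>w\<close> is \<open>X w - Y w\<close>; its ends are lower sets, so
  that they may be cuts not next to any point. By equivariance both are fixed by the stabilizer of
  \<open>w\<close>, and by the last condition no cut fixed by it lies strictly between them.\<close>

definition ball_family :: "nat \<Rightarrow> (nat \<Rightarrow> nat set) \<Rightarrow> (nat \<Rightarrow> nat set) \<Rightarrow> bool" where
  "ball_family i X Y \<longleftrightarrow> (\<forall>w. down i (X w) \<and> down i (Y w)) \<and>
     (\<forall>g w. aut g \<longrightarrow> X (g w) = g ` X w \<and> Y (g w) = g ` Y w) \<and>
     (\<forall>w D. down i D \<longrightarrow> (\<forall>g x. aut g \<longrightarrow> g w = w \<longrightarrow> x \<in> D \<longrightarrow> g x \<in> D) \<longrightarrow> \<not> (Y w \<subset> D \<and> D \<subset> X w))"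

lemma equivariantI:
  assumes *: "\<And>g w u. aut g \<Longrightarrow> u \<in> A w \<Longrightarrow> g u \<in> A (g w)" and g: "aut g"
  shows "A (g w) = g ` A w"
proof
  show "A (g w) \<subseteq> g ` A w"
  proof
    fix u assume "u \<in> A (g w)"
    then have "inv g u \<in> A w" using *[OF aut_inv[OF g]] aut_inv_apply(1)[OF g] by metis
    then show "u \<in> g ` A w" using aut_inv_apply(2)[OF g] by (metis image_eqI)
  qed
qed (use *[OF g] in blast)

lemma ball_familyI:
  assumes "\<And>w. down i (X w)" "\<And>w. down i (Y w)"
    and X: "\<And>g w u. aut g \<Longrightarrow> u \<in> X w \<Longrightarrow> g u \<in> X (g w)"
    and Y: "\<And>g w u. aut g \<Longrightarrow> u \<in> Y w \<Longrightarrow> g u \<in> Y (g w)"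
    and nc: "\<And>w D. down i D \<Longrightarrow> (\<And>g x. aut g \<Longrightarrow> g w = w \<Longrightarrow> x \<in> D \<Longrightarrow> g x \<in> D) \<Longrightarrow>
      Y w \<subset> D \<Longrightarrow> D \<subset> X w \<Longrightarrow> False"
  shows "ball_family i X Y"
proof -
  have "X (g w) = g ` X w \<and> Y (g w) = g ` Y w" if g: "aut g" for g w
  proof
    show "X (g w) = g ` X w" using X g by (rule equivariantI[where A = X])
    show "Y (g w) = g ` Y w" using Y g by (rule equivariantI[where A = Y])
  qed
  moreover have "\<not> (Y w \<subset> D \<and> D \<subset> X w)"
    if "down i D" "\<forall>g x. aut g \<longrightarrow> g w = w \<longrightarrow> x \<in> D \<longrightarrow> g x \<in> D" for w D
    using nc[OF that(1), of w] that(2) by auto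
  ultimately show ?thesis using assms(1,2) unfolding ball_family_def by simp
qed

lemma aut_image_psubset: "aut g \<Longrightarrow> g ` A \<subset> g ` B \<longleftrightarrow> A \<subset> B"
  by (metis aut_image_inv(2) image_mono psubset_eq)

text \<open>The relation of having a given type is transitive, so if two balls overlapped then the
  supremum of the lower ends of all balls overlapping \<open>b\<close> in the same way would be a forbidden cut.\<close>

lemma balls_do_not_overlap:
  assumes bf: "ball_family i X Y" and i: "i \<in> I"
  shows "\<not> (Y a \<subset> Y b \<and> Y b \<subset> X a \<and> X a \<subset> X b)"
proof
  assume ov: "Y a \<subset> Y b \<and> Y b \<subset> X a \<and> X a \<subset> X b"
  have eqv: "X (g w) = g ` X w" "Y (g w) = g ` Y w" if "aut g" for g w
    using bf that unfolding ball_family_def by auto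
  have ne: "a \<noteq> b" using ov by blast
  define D where "D = \<Union> (Y ` {c. same_type a b b c})"
  have Yc: "Y b \<subset> Y c" "Y c \<subset> X a" if c: "same_type a b b c" for c
  proof -
    obtain g where g: "aut g" "g a = b" "g b = c" using ex_aut_two[OF c] by blast
    then show "Y b \<subset> Y c" using ov eqv(2)[OF g(1)] aut_image_psubset[OF g(1)] by metis
    have "same_type a b a c" using same_type_compose[OF c] i by blast
    then obtain h where h: "aut h" "h a = a" "h b = c" using ex_aut_two by blast
    then show "Y c \<subset> X a" using ov eqv[OF h(1)] aut_image_psubset[OF h(1)] by metis
  qed
  obtain g where g: "aut g" "g a = b" using ex_aut_one by blast
  have "same_type a b b (g b)" using same_type_aut[OF g(1) ne] g(2) by simp
  then have "Y b \<subset> D" using Yc(1) unfolding D_def by blast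
  moreover have "D \<subset> X b" using Yc(2) ov unfolding D_def by blast
  moreover have "down i (Y w)" for w using bf unfolding ball_family_def by simp
  then have "down i D" unfolding D_def down_def by blast
  moreover have "g x \<in> D" if g: "aut g" "g b = b" and x: "x \<in> D" for g x
  proof -
    obtain c where c: "same_type a b b c" "x \<in> Y c" using x unfolding D_def by blast
    have "b \<noteq> c" using c(1) unfolding same_type_def by blast
    then have "same_type a b b (g c)"
      using same_type_trans[OF c(1) same_type_aut[OF g(1)]] g(2) by metis
    moreover have "g x \<in> Y (g c)" using c(2) eqv(2)[OF g(1)] by blast
    ultimately show ?thesis unfolding D_def by blast
  qed
  ultimately show False using bf unfolding ball_family_def by blast
qed

text \<open>Lower sets of one linear order are comparable, so two balls that meet without being
  nested are, up to exchanging them, in the position excluded by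
  \<open>balls_do_not_overlap\<close>.\<close>

lemma balls_nested:
  assumes bf: "ball_family i X Y" and i: "i \<in> I" and x: "x \<in> X a - Y a" "x \<in> X b - Y b"
  shows "X a - Y a \<subseteq> X b - Y b \<or> X b - Y b \<subseteq> X a - Y a"
proof -
  have dn: "down i (X w)" "down i (Y w)" for w using bf unfolding ball_family_def by auto
  have lin: "X a \<subseteq> X b \<or> X b \<subseteq> X a" "Y a \<subseteq> Y b \<or> Y b \<subseteq> Y a" using dn down_linear by blast+
  have "Y b \<subset> X a" "Y a \<subset> X b" using down_linear[OF dn(2) dn(1)] x by blast+
  then show ?thesis
    using lin balls_do_not_overlap[OF bf i, of a b] balls_do_not_overlap[OF bf i, of b a] by blast
qed

text \<open>Homogeneity carries the first triple to the second. Then two balls contain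
  \<open>z2'\<close>, of which one contains \<open>z1'\<close> but not \<open>z3'\<close> and the
  other \<open>z3'\<close> but not \<open>z1'\<close>, so they are not nested.\<close>

lemma no_two_combs:
  assumes bf: "ball_family i X Y" and i: "i \<in> I"
    and w: "z1 \<in> X w - Y w" "z2 \<in> X w - Y w" "z3 \<notin> X w - Y w"
    and w': "z1' \<notin> X w' - Y w'" "z2' \<in> X w' - Y w'" "z3' \<in> X w' - Y w'"
    and t: "same_type z1 z2 z1' z2'" "same_type z1 z3 z1' z3'" "same_type z2 z3 z2' z3'"
  shows False
proof -
  obtain g where g: "aut g" "g z1 = z1'" "g z2 = z2'" "g z3 = z3'" using ex_aut_three[OF t] by blast
  have "X (g w) = g ` X w" "Y (g w) = g ` Y w" using bf g(1) unfolding ball_family_def by auto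
  then have "z1' \<in> X (g w) - Y (g w)" "z2' \<in> X (g w) - Y (g w)" "z3' \<notin> X (g w) - Y (g w)"
    using w g(2-4) aut_image_iff[OF g(1)] by (metis Diff_iff)+
  then show False using balls_nested[OF bf i, of z2' "g w" w'] w' by blast
qed

text \<open>These balls are the convex hulls of the orbits over \<open>w\<close>. The stabilizer of
  \<open>w\<close> is transitive on such an orbit, so an invariant lower set that contains one of
  its points contains all of them.\<close>

lemma type_hull_ball_family:
  assumes i: "i \<in> I" and ne: "w0 \<noteq> x0"
  shows "ball_family i (\<lambda>w. {u. \<exists>x. same_type w0 x0 w x \<and> \<not> lt i x u})
    (\<lambda>w. {u. \<forall>x. same_type w0 x0 w x \<longrightarrow> lt i u x})"
    (is "ball_family i ?X ?Y")
proof -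
  have t_act: "same_type w0 x0 (g w) (g x)" if "aut g" "same_type w0 x0 w x" for g w x
    using that same_type_trans[OF that(2) same_type_aut[OF that(1)]] unfolding same_type_def by auto
  show ?thesis
  proof (rule ball_familyI)
    fix g w u assume g: "aut g" and "u \<in> ?X w"
    then obtain x where "same_type w0 x0 w x" "\<not> lt i x u" by blast
    then have "same_type w0 x0 (g w) (g x)" "\<not> lt i (g x) (g u)" using t_act[OF g] autD[OF g i] by auto
    then show "g u \<in> ?X (g w)" by blast
  next
    fix g w u assume g: "aut g" and u: "u \<in> ?Y w"
    have "lt i (g u) x" if "same_type w0 x0 (g w) x" for x
    proof -
      have "same_type w0 x0 w (inv g x)" using t_act[OF aut_inv[OF g] that] aut_inv_apply(1)[OF g] by simp
      then have "lt i u (inv g x)" using u by blast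
      then show ?thesis using autD[OF g i] aut_inv_apply(2)[OF g] by metis
    qed
    then show "g u \<in> ?Y (g w)" by blast
  next
    fix w C assume C: "down i C" and inv: "\<And>g x. aut g \<Longrightarrow> g w = w \<Longrightarrow> x \<in> C \<Longrightarrow> g x \<in> C"
      and YC: "?Y w \<subset> C" and CX: "C \<subset> ?X w"
    obtain k where "k \<in> C" "k \<notin> ?Y w" using YC by blast
    then obtain x where x: "same_type w0 x0 w x" "\<not> lt i k x" by blast
    then have xC: "x \<in> C" using \<open>k \<in> C\<close> C downD not_lt by metis
    have tC: "x' \<in> C" if x': "same_type w0 x0 w x'" for x'
    proof -
      obtain g where "aut g" "g w = w" "g x = x'"
        using ex_aut_two[OF same_type_trans[OF same_type_sym[OF x(1)] x']] by blast
      then show ?thesis using inv xC by blast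
    qed
    have "?X w \<subseteq> C"
    proof
      fix u assume "u \<in> ?X w"
      then obtain x' where "same_type w0 x0 w x'" "\<not> lt i x' u" by blast
      then show "u \<in> C" using tC C downD not_lt by metis
    qed
    then show False using CX by blast
  next
    show "down i (?X w)" for w unfolding down_def using lt_trans by blast
    show "down i (?Y w)" for w unfolding down_def using lt_trans by blast
  qed
qed

end

section \<open>Minimal faces\<close>

text \<open>The face consists of the tuples that have the ends \<open>\<eta>\<close> outside
  \<open>J\<close>. \<open>all_or_none\<close> is the only form in which minimality is used;
  \<open>all_edges\<close> derives it from a least possible number of proper entries.\<close>

locale minimal_face = homogeneous_orders +
  fixes \<eta> :: "nat \<Rightarrow> nat set" and J :: "nat set"
  assumes J_sub: "J \<subseteq> I"
    and ex_proper: "\<exists>\<zeta>. realizable \<zeta> \<and> (\<forall>j\<in>I - J. \<zeta> j = \<eta> j) \<and> (\<forall>j\<in>J. proper (\<zeta> j))"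
    and \<eta>_improper: "j \<in> I - J \<Longrightarrow> \<eta> j = {} \<or> \<eta> j = UNIV"
    and all_or_none: "realizable \<zeta> \<Longrightarrow> (\<And>j. j \<in> I - J \<Longrightarrow> \<zeta> j = \<eta> j) \<Longrightarrow>
      i \<in> J \<Longrightarrow> \<not> edge i \<Longrightarrow> proper (\<zeta> i) \<Longrightarrow> k \<in> J \<Longrightarrow> proper (\<zeta> k)"
begin

text \<open>The interior of the face; its limits may acquire further entries at infinity.\<close>

definition S :: "(nat \<Rightarrow> nat set) set" where
  "S = {\<zeta>. realizable \<zeta> \<and> (\<forall>j\<in>I - J. \<zeta> j = \<eta> j) \<and> (\<forall>j\<in>J. proper (\<zeta> j))}"

lemma JI: "j \<in> J \<Longrightarrow> j \<in> I"
  using J_sub by blast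

lemma finite_J: "finite J"
  using J_sub finite_I finite_subset by blast

lemma S_realizable: "\<zeta> \<in> S \<Longrightarrow> realizable \<zeta>"
  and S_off: "\<zeta> \<in> S \<Longrightarrow> j \<in> I \<Longrightarrow> j \<notin> J \<Longrightarrow> \<zeta> j = \<eta> j"
  and S_proper: "\<zeta> \<in> S \<Longrightarrow> j \<in> J \<Longrightarrow> proper (\<zeta> j)"
  unfolding S_def by auto

lemma S_down: "\<zeta> \<in> S \<Longrightarrow> j \<in> J \<Longrightarrow> b \<in> \<zeta> j \<Longrightarrow> lt j a b \<Longrightarrow> a \<in> \<zeta> j"
  using downD realizable_down S_realizable JI by blast

lemma S_lt: "\<zeta> \<in> S \<Longrightarrow> j \<in> J \<Longrightarrow> a \<in> \<zeta> j \<Longrightarrow> b \<notin> \<zeta> j \<Longrightarrow> lt j a b"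
  using S_down by (metis not_lt)

lemma S_members: "\<zeta> \<in> S \<Longrightarrow> j \<in> J \<Longrightarrow> \<exists>a. a \<in> \<zeta> j" "\<zeta> \<in> S \<Longrightarrow> j \<in> J \<Longrightarrow> \<exists>a. a \<notin> \<zeta> j"
  using S_proper unfolding proper_def by blast+

lemma S_nonempty: "\<exists>\<zeta>. \<zeta> \<in> S"
  using ex_proper unfolding S_def by blast

lemma S_act:
  assumes "aut g" "\<zeta> \<in> S"
  shows "(\<lambda>i. g ` \<zeta> i) \<in> S"
proof -
  have "g ` \<zeta> j = \<eta> j" if "j \<in> I - J" for j
    using S_off[OF assms(2), of j] \<eta>_improper[OF that] that aut_image_UNIV[OF assms(1)] by auto
  then show ?thesis
    using assms realizable_act[OF assms(1)] proper_act[OF assms(1)] unfolding S_def by auto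
qed

lemma S_realize: "\<zeta> \<in> S \<Longrightarrow> finite F \<Longrightarrow> \<exists>z. realizes F z \<zeta>"
  using S_realizable unfolding realizable_def by blast

lemma S_separate:
  assumes "j \<in> J" "lt j a b"
  shows "\<exists>\<zeta>\<in>S. a \<in> \<zeta> j \<and> b \<notin> \<zeta> j"
proof -
  obtain \<zeta>' where \<zeta>': "\<zeta>' \<in> S" using S_nonempty by blast
  show ?thesis
    using ex_separating[OF S_realizable S_act \<zeta>' S_proper[OF \<zeta>' assms(1)] JI[OF assms(1)] assms(2)] .
qed

lemma S_ex_below: assumes "j \<in> J" shows "\<exists>\<zeta>\<in>S. a \<notin> \<zeta> j"
proof -
  obtain b where "lt j b a" using no_min[OF JI[OF assms]] by blast
  then show ?thesis using S_separate[OF assms] by blast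
qed

lemma S_ex_above: assumes "j \<in> J" shows "\<exists>\<zeta>\<in>S. a \<in> \<zeta> j"
proof -
  obtain b where "lt j a b" using no_max[OF JI[OF assms]] by blast
  then show ?thesis using S_separate[OF assms] by blast
qed

section \<open>Limits of tuples in a face, and boundedness\<close>

definition agree :: "nat set \<Rightarrow> (nat \<Rightarrow> nat set) \<Rightarrow> (nat \<Rightarrow> nat set) \<Rightarrow> bool" where
  "agree F \<zeta> \<kappa> \<longleftrightarrow> (\<forall>i\<in>I. \<forall>b\<in>F. b \<in> \<zeta> i \<longleftrightarrow> b \<in> \<kappa> i)"

lemma agreeD: "agree F \<zeta> \<kappa> \<Longrightarrow> i \<in> I \<Longrightarrow> b \<in> F \<Longrightarrow> b \<in> \<zeta> i \<longleftrightarrow> b \<in> \<kappa> i"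
  unfolding agree_def by blast

text \<open>Membership in the closure of \<open>T\<close>; the limit keeps the ends
  \<open>\<eta>\<close> but may be improper at indices in \<open>J\<close>.\<close>

definition limit_of :: "(nat \<Rightarrow> nat set) set \<Rightarrow> (nat \<Rightarrow> nat set) \<Rightarrow> bool" where
  "limit_of T \<kappa> \<longleftrightarrow> realizable \<kappa> \<and> (\<forall>j\<in>I - J. \<kappa> j = \<eta> j) \<and>
     (\<forall>F. finite F \<longrightarrow> (\<exists>\<zeta>\<in>T. agree F \<zeta> \<kappa>))"

lemma ex_limit:
  assumes T: "T \<subseteq> S"
    and ex: "\<And>F. finite F \<Longrightarrow> \<exists>\<zeta>\<in>T. Q F \<zeta>"
    and anti: "\<And>F F' \<zeta>. F \<subseteq> F' \<Longrightarrow> Q F' \<zeta> \<Longrightarrow> Q F \<zeta>"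
  shows "\<exists>\<kappa>. limit_of T \<kappa> \<and> (\<forall>F. finite F \<longrightarrow> (\<exists>\<zeta>\<in>T. Q F \<zeta> \<and> agree F \<zeta> \<kappa>))"
proof -
  have "\<exists>\<kappa>. realizable \<kappa> \<and> (\<forall>F. finite F \<longrightarrow> (\<exists>\<zeta>'. realizable \<zeta>' \<and> (\<zeta>' \<in> T \<and> Q F \<zeta>') \<and>
      agree F \<zeta>' \<kappa>))"
    unfolding agree_def
  proof (rule compactness_realizable[where Q = "\<lambda>F \<zeta>. \<zeta> \<in> T \<and> Q F \<zeta>"])
    fix F :: "nat set" assume "finite F"
    then show "\<exists>\<zeta>. realizable \<zeta> \<and> \<zeta> \<in> T \<and> Q F \<zeta>" using ex[of F] T S_realizable by blast
  qed (use anti in blast)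
  then obtain \<kappa> where \<kappa>: "realizable \<kappa>"
    and lim: "\<And>F. finite F \<Longrightarrow> \<exists>\<zeta>'. realizable \<zeta>' \<and> (\<zeta>' \<in> T \<and> Q F \<zeta>') \<and>
      agree F \<zeta>' \<kappa>"
    by blast
  have lim': "\<exists>\<zeta>\<in>T. Q F \<zeta> \<and> agree F \<zeta> \<kappa>" if "finite F" for F
    using lim[OF that] by blast
  have "b \<in> \<kappa> j \<longleftrightarrow> b \<in> \<eta> j" if j: "j \<in> I - J" for j b
  proof -
    obtain \<zeta> where "\<zeta> \<in> T" "agree {b} \<zeta> \<kappa>" using lim'[of "{b}"] by auto
    then show ?thesis using S_off[of \<zeta> j] T j agreeD[of "{b}" \<zeta> \<kappa> j b] by auto
  qed
  then have "\<forall>j\<in>I - J. \<kappa> j = \<eta> j" by blast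
  moreover have "\<forall>F. finite F \<longrightarrow> (\<exists>\<zeta>\<in>T. agree F \<zeta> \<kappa>)"
    using lim' by blast
  ultimately have "limit_of T \<kappa>" using \<kappa> unfolding limit_of_def by blast
  then show ?thesis using lim' by blast
qed

text \<open>The cuts are lower sets, so a tuple that avoids the least point of \<open>F\<close>
  avoids all of \<open>F\<close>. It is therefore enough to be able to avoid each single
  point.\<close>

lemma limit_below:
  assumes T: "T \<subseteq> S" and k: "k \<in> J" and ex: "\<And>c. \<exists>\<zeta>\<in>T. c \<notin> \<zeta> k"
  shows "\<exists>\<kappa>. limit_of T \<kappa> \<and> \<kappa> k = {}"
proof -
  have "\<exists>\<kappa>. limit_of T \<kappa> \<and> (\<forall>F. finite F \<longrightarrow> (\<exists>\<zeta>\<in>T. F \<inter> \<zeta> k = {} \<and> agree F \<zeta> \<kappa>))"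
  proof (rule ex_limit[OF T, where Q = "\<lambda>F \<zeta>. F \<inter> \<zeta> k = {}"])
    fix F :: "nat set" assume F: "finite F"
    show "\<exists>\<zeta>\<in>T. F \<inter> \<zeta> k = {}"
    proof (cases "F = {}")
      case True
      then show ?thesis using ex by blast
    next
      case False
      then obtain m where m: "m \<in> F" "\<forall>x\<in>F. \<not> lt k x m" using finite_has_min[OF F] by blast
      obtain \<zeta> where \<zeta>: "\<zeta> \<in> T" "m \<notin> \<zeta> k" using ex by blast
      have "x \<notin> \<zeta> k" if "x \<in> F" for x
        using m(2) that \<zeta> S_lt[OF subsetD[OF T \<zeta>(1)] k _ \<zeta>(2)] by blast
      then show ?thesis using \<zeta>(1) by blast
    qed
  qed blast
  then obtain \<kappa> where \<kappa>: "limit_of T \<kappa>" and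
    lim: "\<And>F. finite F \<Longrightarrow> \<exists>\<zeta>\<in>T. F \<inter> \<zeta> k = {} \<and> agree F \<zeta> \<kappa>"
    by blast
  have "b \<notin> \<kappa> k" for b using lim[of "{b}"] agreeD[OF _ JI[OF k], of "{b}" _ \<kappa> b] by auto
  then show ?thesis using \<kappa> by blast
qed

lemma limit_above:
  assumes T: "T \<subseteq> S" and k: "k \<in> J" and ex: "\<And>c. \<exists>\<zeta>\<in>T. c \<in> \<zeta> k"
  shows "\<exists>\<kappa>. limit_of T \<kappa> \<and> \<kappa> k = UNIV"
proof -
  have "\<exists>\<kappa>. limit_of T \<kappa> \<and> (\<forall>F. finite F \<longrightarrow> (\<exists>\<zeta>\<in>T. F \<subseteq> \<zeta> k \<and> agree F \<zeta> \<kappa>))"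
  proof (rule ex_limit[OF T, where Q = "\<lambda>F \<zeta>. F \<subseteq> \<zeta> k"])
    fix F :: "nat set" assume F: "finite F"
    show "\<exists>\<zeta>\<in>T. F \<subseteq> \<zeta> k"
    proof (cases "F = {}")
      case True
      then show ?thesis using ex by blast
    next
      case False
      then obtain m where m: "m \<in> F" "\<forall>x\<in>F. \<not> lt k m x" using finite_has_max[OF F] by blast
      obtain \<zeta> where \<zeta>: "\<zeta> \<in> T" "m \<in> \<zeta> k" using ex by blast
      have "x \<in> \<zeta> k" if "x \<in> F" for x
        using m(2) that \<zeta> S_lt[OF subsetD[OF T \<zeta>(1)] k \<zeta>(2)] by blast
      then show ?thesis using \<zeta>(1) by blast
    qed
  qed blast
  then obtain \<kappa> where \<kappa>: "limit_of T \<kappa>" and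
    lim: "\<And>F. finite F \<Longrightarrow> \<exists>\<zeta>\<in>T. F \<subseteq> \<zeta> k \<and> agree F \<zeta> \<kappa>"
    by blast
  have "b \<in> \<kappa> k" for b using lim[of "{b}"] agreeD[OF _ JI[OF k], of "{b}" _ \<kappa> b] by auto
  then show ?thesis using \<kappa> by blast
qed

lemma limit_improper:
  assumes "limit_of T \<kappa>" "k \<in> J" "\<not> proper (\<kappa> k)" "i \<in> J" "\<not> edge i"
  shows "\<not> proper (\<kappa> i)"
  using assms all_or_none[of \<kappa> i k] unfolding limit_of_def by blast

text \<open>If these tuples were unbounded in \<open>k\<close>, they would have a limit at infinity
  in \<open>k\<close>. It would still separate \<open>a\<close> from \<open>b\<close> in the order
  \<open>i\<close>, hence be proper there, against \<open>all_or_none\<close>.\<close>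

lemma bounded:
  assumes i: "i \<in> J" "\<not> edge i" and k: "k \<in> J"
  shows "\<exists>c d. \<forall>\<zeta>\<in>S. a \<in> \<zeta> i \<longrightarrow> b \<notin> \<zeta> i \<longrightarrow> c \<in> \<zeta> k \<and> d \<notin> \<zeta> k"
proof -
  let ?T = "{\<zeta>\<in>S. a \<in> \<zeta> i \<and> b \<notin> \<zeta> i}"
  have kp: "proper (\<kappa> i)" if lim: "limit_of ?T \<kappa>" for \<kappa>
  proof -
    obtain \<zeta> where \<zeta>: "\<zeta> \<in> ?T" "agree {a, b} \<zeta> \<kappa>"
      using lim unfolding limit_of_def by (meson finite.emptyI finite.insertI)
    have "a \<in> \<kappa> i" "b \<notin> \<kappa> i" using \<zeta>(1) agreeD[OF \<zeta>(2) JI[OF i(1)]] by auto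
    then show ?thesis unfolding proper_def by blast
  qed
  have "\<exists>c. \<forall>\<zeta>\<in>?T. c \<in> \<zeta> k"
  proof (rule ccontr)
    assume "\<not> ?thesis"
    then obtain \<kappa> where \<kappa>: "limit_of ?T \<kappa>" "\<kappa> k = {}" using limit_below[of ?T k] k by blast
    then have "\<not> proper (\<kappa> k)" by (simp add: proper_def)
    then show False using limit_improper[OF \<kappa>(1) k _ i] kp[OF \<kappa>(1)] by blast
  qed
  moreover have "\<exists>d. \<forall>\<zeta>\<in>?T. d \<notin> \<zeta> k"
  proof (rule ccontr)
    assume "\<not> ?thesis"
    then obtain \<kappa> where \<kappa>: "limit_of ?T \<kappa>" "\<kappa> k = UNIV" using limit_above[of ?T k] k by blast
    then have "\<not> proper (\<kappa> k)" by (simp add: proper_def)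
    then show False using limit_improper[OF \<kappa>(1) k _ i] kp[OF \<kappa>(1)] by blast
  qed
  ultimately show ?thesis by blast
qed

text \<open>Over an interval \<open>(a, b)\<close> of \<open>i\<close> the cuts in \<open>e\<close>
  have an infimum and a supremum that the stabilizer of \<open>a\<close> and \<open>b\<close> fixes.
  In an edge such cuts are next to \<open>a\<close> or to \<open>b\<close>. One is next to each end,
  so that \<open>e\<close> inherits betweenness from \<open>i\<close> and is equal or reverse to
  it.\<close>

lemma no_edge_in_face:
  assumes i: "i \<in> J" "\<not> edge i" and e: "e \<in> J" "edge e"
  shows False
proof -
  define T where "T a b = {\<zeta>\<in>S. a \<in> \<zeta> i \<and> b \<notin> \<zeta> i}" for a b
  define X where "X a b = (\<Union>\<zeta>\<in>T a b. \<zeta> e)" for a b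
  define Y where "Y a b = (\<Inter>\<zeta>\<in>T a b. \<zeta> e)" for a b
  define cut_at where "cut_at C f \<longleftrightarrow> C = {x. lt e x f} \<or> C = {x. \<not> lt e f x}" for C f
  have eI: "e \<in> I" and iI: "i \<in> I" using JI e i by auto
  have T_ne: "T a b \<noteq> {}" if "lt i a b" for a b
    using S_separate[OF i(1) that] by (auto simp: T_def)
  have T_mono: "T c d \<subseteq> T a b" if "\<not> lt i c a" "\<not> lt i b d" for a b c d
    using that S_down[OF _ i(1)] unfolding T_def by (auto simp: not_lt)
  have T_act: "(\<lambda>j. g ` \<zeta> j) \<in> T a b" if "aut g" "g a = a" "g b = b" "\<zeta> \<in> T a b" for g \<zeta> a b
    using S_act[OF that(1)] that(4) aut_image_iff[OF that(1)] that(2,3) unfolding T_def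
    by (metis (mono_tags, lifting) mem_Collect_eq)
  have YX: "Y a b \<subseteq> X a b" if "lt i a b" for a b using T_ne[OF that] by (auto simp: X_def Y_def)
  have bd: "\<exists>c d. \<forall>\<zeta>\<in>T a b. c \<in> \<zeta> e \<and> d \<notin> \<zeta> e" for a b
    using bounded[OF i e(1), of a b] unfolding T_def by blast
  have dn: "down e (\<zeta> e)" if "\<zeta> \<in> T a b" for \<zeta> a b
    using that realizable_down[OF S_realizable eI] by (auto simp: T_def)
  have inv_fix: "inv g f = f" if "aut g" "g f = f" for g f using that aut_inv_apply(1) by metis
  have X_cut: "\<exists>f\<in>{a, b}. cut_at (X a b) f" if ab: "lt i a b" for a b
    unfolding cut_at_def
  proof (rule edge_invariant_cut[OF e(2) eI])
    show "down e (X a b)" using dn unfolding X_def down_def by blast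
    show "proper (X a b)" using bd[of a b] T_ne[OF ab] unfolding X_def proper_def by blast
    show "g x \<in> X a b" if g: "aut g" "\<forall>f\<in>{a, b}. g f = f" "x \<in> X a b" for g x
    proof -
      obtain \<zeta> where "\<zeta> \<in> T a b" "x \<in> \<zeta> e" using g(3) by (auto simp: X_def)
      then show ?thesis using T_act[OF g(1), of a b \<zeta>] g(2) unfolding X_def by blast
    qed
  qed simp
  have Y_cut: "\<exists>f\<in>{a, b}. cut_at (Y a b) f" if ab: "lt i a b" for a b
    unfolding cut_at_def
  proof (rule edge_invariant_cut[OF e(2) eI])
    show "down e (Y a b)" using dn unfolding Y_def down_def by blast
    show "proper (Y a b)" using bd[of a b] T_ne[OF ab] unfolding Y_def proper_def by blast
    show "g x \<in> Y a b" if g: "aut g" "\<forall>f\<in>{a, b}. g f = f" "x \<in> Y a b" for g x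
      unfolding Y_def
    proof
      fix \<zeta> assume "\<zeta> \<in> T a b"
      then have "(\<lambda>j. inv g ` \<zeta> j) \<in> T a b"
        using T_act[OF aut_inv[OF g(1)], of a b \<zeta>] inv_fix[OF g(1)] g(2) by blast
      then have "x \<in> inv g ` \<zeta> e" using g(3) unfolding Y_def by blast
      then show "g x \<in> \<zeta> e" using aut_image_iff[OF g(1)] aut_image_inv(1)[OF g(1)] by metis
    qed
  qed simp
  have mono: "\<not> lt e f' f" if "cut_at C f" "cut_at C' f'" "C \<subseteq> C'" for C C' f f'
  proof
    assume "lt e f' f"
    then obtain m where "lt e f' m" "lt e m f" using dense[OF eI] by blast
    then have "m \<in> C" "m \<notin> C'" using that(1,2) lt_asym unfolding cut_at_def by auto
    then show False using that(3) by blast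
  qed
  have distinct_cuts: "\<not> (cut_at (X a b) f \<and> cut_at (Y a b) f)" if ab: "lt i a b" for a b f
  proof
    assume f: "cut_at (X a b) f \<and> cut_at (Y a b) f"
    \<comment> \<open>The cuts of a smaller interval lie between \<open>Y a b\<close> and
      \<open>X a b\<close>. If both of these are next to \<open>f\<close>, then \<open>f\<close>
      must be an end of the smaller interval as well.\<close>
    have *: "f = c \<or> f = d" if cd: "\<not> lt i c a" "lt i c d" "\<not> lt i b d" for c d
    proof -
      have "Y a b \<subseteq> Y c d" "X c d \<subseteq> X a b"
        using T_mono[OF cd(1,3)] by (auto simp: X_def Y_def)
      moreover obtain p where p: "p = c \<or> p = d" "cut_at (X c d) p" using X_cut[OF cd(2)] by blast
      ultimately have "\<not> lt e p f" "\<not> lt e f p"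
        using mono f YX[OF cd(2)] by (meson order_trans)+
      then show ?thesis using p(1) not_lt by blast
    qed
    \<comment> \<open>The intervals \<open>(a, c)\<close> and \<open>(d, b)\<close> have no end in
      common, although \<open>f\<close> would be an end of both.\<close>
    obtain m where m: "lt i a m" "lt i m b" using dense[OF iI ab] by blast
    obtain c where c: "lt i a c" "lt i c m" using dense[OF iI m(1)] by blast
    obtain d where d: "lt i m d" "lt i d b" using dense[OF iI m(2)] by blast
    have "f = a \<or> f = c" using *[of a c] c m lt_asym lt_trans lt_irrefl by blast
    moreover have "f = d \<or> f = b" using *[of d b] d m lt_asym lt_trans lt_irrefl by blast
    moreover have "lt i a d" "lt i a b" "lt i c d" "lt i c b" using c d m lt_trans by blast+
    ultimately show False using lt_irrefl by metis
  qed
  have ends: "(lt e a b \<longrightarrow> cut_at (Y a b) a \<and> cut_at (X a b) b) \<and>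
      (lt e b a \<longrightarrow> cut_at (Y a b) b \<and> cut_at (X a b) a)" if ab: "lt i a b" for a b
  proof -
    obtain p q where pq: "p \<in> {a, b}" "q \<in> {a, b}" "cut_at (X a b) p" "cut_at (Y a b) q"
      using X_cut[OF ab] Y_cut[OF ab] by blast
    have "p \<noteq> q" using distinct_cuts[OF ab] pq by blast
    moreover have "\<not> lt e p q" using mono[OF pq(4,3) YX[OF ab]] .
    ultimately show ?thesis using pq lt_asym by blast
  qed
  have "(\<forall>a b. lt i a b \<longrightarrow> lt e a b) \<or> (\<forall>a b. lt i a b \<longrightarrow> lt e b a)"
  proof (rule between_imp_monotone[OF iI])
    fix a b c assume ac: "lt i a c" and cb: "lt i c b"
    have ab: "lt i a b" using ac cb lt_trans by blast
    have ne: "a \<noteq> b" "a \<noteq> c" "c \<noteq> b" using ab ac cb by auto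
    have "T a c \<subseteq> T a b" "T c b \<subseteq> T a b" using T_mono ac cb lt_asym lt_irrefl by blast+
    then have sub: "X a c \<subseteq> X a b" "Y a b \<subseteq> Y a c" "X c b \<subseteq> X a b" "Y a b \<subseteq> Y c b"
      by (auto simp: X_def Y_def)
    show "lt e a c \<and> lt e c b \<or> lt e b c \<and> lt e c a"
    proof (cases "lt e a b")
      case True
      have "lt e c b"
      proof (rule ccontr)
        assume "\<not> lt e c b"
        then have "lt e b c" using ne not_lt by blast
        then show False
          using mono[OF _ _ sub(1)] ends[OF ac] ends[OF ab] True lt_trans[OF True] by blast
      qed
      moreover have "lt e a c"
      proof (rule ccontr)
        assume "\<not> lt e a c"
        then have "lt e c a" using ne not_lt by blast
        then show False
          using mono[OF _ _ sub(2)] ends[OF ac] ends[OF ab] True by blast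
      qed
      ultimately show ?thesis by blast
    next
      case False
      then have ba: "lt e b a" using ne not_lt by blast
      have "lt e b c"
      proof (rule ccontr)
        assume "\<not> lt e b c"
        then have "lt e c b" using ne not_lt by blast
        then show False
          using mono[OF _ _ sub(4)] ends[OF cb] ends[OF ab] ba by blast
      qed
      moreover have "lt e c a"
      proof (rule ccontr)
        assume "\<not> lt e c a"
        then have "lt e a c" using ne not_lt by blast
        then show False
          using mono[OF _ _ sub(1)] ends[OF ac] ends[OF ab] ba by blast
      qed
      ultimately show ?thesis by blast
    qed
  qed
  moreover have "i \<noteq> e" using i e by blast
  ultimately show False using not_equal[OF iI eI] not_reverse[OF iI eI] lt_asym by blast
qed

end

locale edgeless_face = minimal_face +
  assumes edgeless: "j \<in> J \<Longrightarrow> \<not> edge j"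
begin

text \<open>The set \<open>\<sigma>\<close> consists of the orders that have the corner at their upper end, and \<open>D \<sigma> w\<close> of the
  tuples from which \<open>w\<close> is seen in the direction of the corner.\<close>

definition corner :: "nat set \<Rightarrow> bool" where
  "corner \<sigma> \<longleftrightarrow> (\<forall>F. finite F \<longrightarrow> (\<exists>\<zeta>\<in>S. \<forall>j\<in>J. \<forall>b\<in>F. b \<in> \<zeta> j \<longleftrightarrow> j \<in> \<sigma>))"

definition D :: "nat set \<Rightarrow> nat \<Rightarrow> (nat \<Rightarrow> nat set) set" where
  "D \<sigma> w = {\<zeta>\<in>S. \<forall>j\<in>J. w \<in> \<zeta> j \<longleftrightarrow> j \<notin> \<sigma>}"

text \<open>If \<open>z'\<close> realizes a member of \<open>S\<close> over a set containing
  \<open>z\<close>, the relations outside \<open>J\<close> are dictated by \<open>\<eta>\<close>. So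
  \<open>\<theta>\<close> is the only free part of the type of such a pair.\<close>

definition chain :: "nat set \<Rightarrow> nat \<Rightarrow> nat \<Rightarrow> bool" where
  "chain \<theta> z z' \<longleftrightarrow> z \<noteq> z' \<and> (\<forall>j\<in>I. lt j z z' \<longleftrightarrow> (if j \<in> J then j \<in> \<theta> else \<eta> j = UNIV))"

lemma cornerE:
  assumes "corner \<sigma>" "finite F"
  obtains \<zeta> where "\<zeta> \<in> S" "\<And>j b. j \<in> J \<Longrightarrow> b \<in> F \<Longrightarrow> b \<in> \<zeta> j \<longleftrightarrow> j \<in> \<sigma>"
  using assms unfolding corner_def by meson

lemma chain_same_type: "chain \<theta> z1 z2 \<Longrightarrow> chain \<theta> z1' z2' \<Longrightarrow> same_type z1 z2 z1' z2'"
  unfolding chain_def same_type_def by auto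

lemma D_S: "\<zeta> \<in> D \<sigma> w \<Longrightarrow> \<zeta> \<in> S"
  and D_iff: "\<zeta> \<in> D \<sigma> w \<Longrightarrow> j \<in> J \<Longrightarrow> w \<in> \<zeta> j \<longleftrightarrow> j \<notin> \<sigma>"
  unfolding D_def by auto

lemma D_act:
  assumes g: "aut g" and "\<zeta> \<in> D \<sigma> w"
  shows "(\<lambda>i. g ` \<zeta> i) \<in> D \<sigma> (g w)"
  using assms S_act[OF g] aut_image_iff[OF g] unfolding D_def by auto

lemma D_act_inv:
  assumes g: "aut g" and "\<zeta> \<in> D \<sigma> (g w)"
  shows "(\<lambda>i. inv g ` \<zeta> i) \<in> D \<sigma> w"
  using D_act[OF aut_inv[OF g] assms(2)] by (simp add: aut_inv_apply[OF g])

text \<open>Without edges in \<open>J\<close>, a limit that is improper in one order of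
  \<open>J\<close> is improper in all of them. Members of \<open>T\<close> that agree with it on
  \<open>F\<close> are then as close to its corner as \<open>F\<close> can tell.\<close>

lemma limit_corner:
  assumes lim: "limit_of T \<kappa>" and T: "T \<subseteq> S" and k: "k \<in> J" "\<not> proper (\<kappa> k)" and "finite F"
  shows "\<exists>\<zeta>\<in>T. \<forall>j\<in>J. \<forall>b\<in>F. b \<in> \<zeta> j \<longleftrightarrow> \<kappa> j = UNIV"
proof -
  obtain \<zeta> where \<zeta>: "\<zeta> \<in> T" "agree F \<zeta> \<kappa>" using lim assms(5) unfolding limit_of_def by blast
  have "\<kappa> j = {} \<or> \<kappa> j = UNIV" if "j \<in> J" for j
    using limit_improper[OF lim k that edgeless[OF that]] unfolding proper_def by blast
  then have "b \<in> \<zeta> j \<longleftrightarrow> \<kappa> j = UNIV" if "j \<in> J" "b \<in> F" for j b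
    using that agreeD[OF \<zeta>(2) JI[OF that(1)] that(2)] by (metis UNIV_I empty_iff)
  then show ?thesis using \<zeta>(1) by blast
qed

lemma ex_corner:
  assumes "J \<noteq> {}"
  shows "\<exists>\<sigma>. corner \<sigma>"
proof -
  obtain k where k: "k \<in> J" using assms by blast
  obtain \<kappa> where \<kappa>: "limit_of S \<kappa>" "\<kappa> k = UNIV"
    using limit_above[OF subset_refl k] S_ex_above[OF k] by blast
  have np: "\<not> proper (\<kappa> k)" using \<kappa>(2) by (simp add: proper_def)
  have "corner {j\<in>J. \<kappa> j = UNIV}"
    using limit_corner[OF \<kappa>(1) subset_refl k np] unfolding corner_def by simp
  then show ?thesis by blast
qed

text \<open>A realization \<open>w\<close> of a tuple close to the corner, taken over bounds for
  \<open>T\<close> in every order of \<open>J\<close>, lies beyond these bounds in the direction of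
  the corner.\<close>

lemma absorb:
  assumes cor: "corner \<sigma>" and T: "T \<subseteq> S"
    and bd: "\<And>k. k \<in> J \<Longrightarrow> \<exists>c d. \<forall>\<zeta>\<in>T. c \<in> \<zeta> k \<and> d \<notin> \<zeta> k"
  shows "\<exists>w. T \<subseteq> D \<sigma> w"
proof -
  obtain c d where cd: "\<And>k \<zeta>. k \<in> J \<Longrightarrow> \<zeta> \<in> T \<Longrightarrow> c k \<in> \<zeta> k \<and> d k \<notin> \<zeta> k"
    using bd by metis
  let ?H = "c ` J \<union> d ` J"
  have fin: "finite ?H" using finite_J by simp
  obtain \<gamma> where \<gamma>: "\<gamma> \<in> S" "\<And>j b. j \<in> J \<Longrightarrow> b \<in> ?H \<Longrightarrow> b \<in> \<gamma> j \<longleftrightarrow> j \<in> \<sigma>"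
    using cornerE[OF cor fin] by blast
  obtain w where w: "realizes ?H w \<gamma>" using S_realize[OF \<gamma>(1) fin] by blast
  have "w \<in> \<zeta> j \<longleftrightarrow> j \<notin> \<sigma>" if "\<zeta> \<in> T" and j: "j \<in> J" for \<zeta> j
  proof -
    have \<zeta>S: "\<zeta> \<in> S" using T that by blast
    have H: "c j \<in> ?H" "d j \<in> ?H" using j by auto
    show ?thesis
    proof (cases "j \<in> \<sigma>")
      case True
      then have "lt j (d j) w" using \<gamma>(2)[OF j H(2)] realizesD(1)[OF w JI[OF j] H(2)] by simp
      then show ?thesis using True cd[OF j \<open>\<zeta> \<in> T\<close>] S_down[OF \<zeta>S j] by blast
    next
      case False
      then have "lt j w (c j)" using \<gamma>(2)[OF j H(1)] realizes_above[OF w JI[OF j] H(1)] by simp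
      then show ?thesis using False cd[OF j \<open>\<zeta> \<in> T\<close>] S_down[OF \<zeta>S j] by blast
    qed
  qed
  then have "T \<subseteq> D \<sigma> w" using T unfolding D_def by blast
  then show ?thesis by blast
qed

lemma absorb_finite:
  assumes cor: "corner \<sigma>" and T: "T \<subseteq> S" "finite T"
  shows "\<exists>w. T \<subseteq> D \<sigma> w"
proof (rule absorb[OF cor T(1)])
  fix k assume k: "k \<in> J"
  obtain l h where lh: "\<And>\<zeta>. \<zeta> \<in> T \<Longrightarrow> l \<zeta> \<in> \<zeta> k" "\<And>\<zeta>. \<zeta> \<in> T \<Longrightarrow> h \<zeta> \<notin> \<zeta> k"
    using S_members[OF _ k] T(1) by (metis subsetD)
  show "\<exists>c d. \<forall>\<zeta>\<in>T. c \<in> \<zeta> k \<and> d \<notin> \<zeta> k"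
  proof (cases "T = {}")
    case False
    obtain c where c: "\<forall>x\<in>l ` T. \<not> lt k x c" using finite_has_min[of "l ` T" k] T(2) False by blast
    obtain d where d: "\<forall>x\<in>h ` T. \<not> lt k d x" using finite_has_max[of "h ` T" k] T(2) False by blast
    have "c \<in> \<zeta> k \<and> d \<notin> \<zeta> k" if "\<zeta> \<in> T" for \<zeta>
      using lh that c d S_lt[of \<zeta> k] T(1) k by blast
    then show ?thesis by blast
  qed blast
qed

lemma absorb_interval:
  assumes cor: "corner \<sigma>" and i: "i \<in> J"
  shows "\<exists>w. {\<zeta>\<in>S. a \<in> \<zeta> i \<and> b \<notin> \<zeta> i} \<subseteq> D \<sigma> w"
proof (rule absorb[OF cor])
  fix k assume "k \<in> J"
  then show "\<exists>c d. \<forall>\<zeta>\<in>{\<zeta>\<in>S. a \<in> \<zeta> i \<and> b \<notin> \<zeta> i}. c \<in> \<zeta> k \<and> d \<notin> \<zeta> k"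
    using bounded[OF i edgeless[OF i], of k a b] by blast
qed blast

text \<open>Relative to the realizations of \<open>\<beta>\<close> and \<open>\<beta>'\<close> the point \<open>w\<close> looks like a point so close to the
  corner that it lies beyond all of \<open>S\<close> between \<open>\<beta>\<close> and \<open>\<beta>'\<close>.\<close>

lemma D_convex:
  assumes cor: "corner \<sigma>" and i: "i \<in> J" and \<beta>: "\<beta> \<in> D \<sigma> w" "\<beta>' \<in> D \<sigma> w" and \<xi>: "\<xi> \<in> S"
    and s: "s \<in> \<xi> i" "s \<notin> \<beta> i" and s': "s' \<in> \<beta>' i" "s' \<notin> \<xi> i"
  shows "\<xi> \<in> D \<sigma> w"
proof -
  have iI: "i \<in> I" using JI[OF i] .
  have S: "\<beta> \<in> S" "\<beta>' \<in> S" using \<beta> D_S by auto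
  obtain a where a: "a \<in> \<beta> i" using S_members(1)[OF S(1) i] by blast
  obtain b where b: "b \<notin> \<beta>' i" using S_members(2)[OF S(2) i] by blast
  have as: "lt i a s" using S_lt[OF S(1) i a s(2)] .
  have ss': "lt i s s'" using S_lt[OF \<xi> i s(1) s'(2)] .
  have s'b: "lt i s' b" using S_lt[OF S(2) i s'(1) b] .
  have a': "a \<in> \<beta>' i" using S_down[OF S(2) i s'(1)] as ss' lt_trans by blast
  have b': "b \<notin> \<beta> i" using S_down[OF S(1) i] s(2) ss' s'b lt_trans by blast
  \<comment> \<open>\<open>w0\<close> lies so close to the corner that it is beyond every member of
    \<open>S\<close> whose cut in \<open>i\<close> separates \<open>a\<close> from \<open>b\<close>.
    The type of \<open>(w, z)\<close> will be that of \<open>(w0, z)\<close>, and likewise for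
    \<open>z'\<close>.\<close>
  obtain w0 where w0: "{\<zeta>\<in>S. a \<in> \<zeta> i \<and> b \<notin> \<zeta> i} \<subseteq> D \<sigma> w0" using absorb_interval[OF cor i] by blast
  let ?H = "{w, w0, a, b, s, s'}"
  obtain z where z: "realizes ?H z \<beta>" using S_realize[OF S(1), of ?H] by blast
  obtain z' where z': "realizes (insert z ?H) z' \<beta>'" using S_realize[OF S(2), of "insert z ?H"] by blast
  have \<beta>0: "\<beta> \<in> D \<sigma> w0" "\<beta>' \<in> D \<sigma> w0" using w0 S a a' b b' by blast+
  have wj: "w \<in> \<zeta> j \<longleftrightarrow> w0 \<in> \<zeta> j" if "\<zeta> \<in> D \<sigma> w" "\<zeta> \<in> D \<sigma> w0" "j \<in> I" for \<zeta> j
  proof (cases "j \<in> J")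
    case False
    then show ?thesis using S_off[OF D_S[OF that(1)] that(3)] \<eta>_improper[of j] that(3) by auto
  qed (use that D_iff in blast)
  have "z \<noteq> w" "z \<noteq> w0" "z' \<noteq> w" "z' \<noteq> w0" "z' \<noteq> z" using z z' unfolding realizes_def by auto
  moreover have "lt j w z \<longleftrightarrow> lt j w0 z" "lt j w z' \<longleftrightarrow> lt j w0 z'" if j: "j \<in> I" for j
    using wj[OF \<beta>(1) \<beta>0(1) j] wj[OF \<beta>(2) \<beta>0(2) j] realizesD(1)[OF z j] realizesD(1)[OF z' j] by auto
  ultimately have "same_type w z w0 z" "same_type w z' w0 z'" "same_type z z' z z'"
    unfolding same_type_def by auto
  then obtain g where g: "aut g" "g w = w0" "g z = z" "g z' = z'" using ex_aut_three by blast
  have "lt i z s" using realizes_above[OF z iI, of s] s(2) by simp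
  then have "z \<in> \<xi> i" using S_down[OF \<xi> i s(1)] by blast
  moreover have "lt i s' z'" using realizesD(1)[OF z' iI, of s'] s'(1) by simp
  then have "z' \<notin> \<xi> i" using S_down[OF \<xi> i] s'(2) by blast
  \<comment> \<open>As \<open>g\<close> fixes \<open>z\<close> and \<open>z'\<close>, the image of
    \<open>\<xi>\<close> still separates them in \<open>i\<close>, hence also \<open>a\<close> from
    \<open>b\<close>, and \<open>w0\<close> absorbs it. Applying the inverse of \<open>g\<close>
    returns from \<open>w0\<close> to \<open>w\<close>.\<close>
  ultimately have "z \<in> g ` \<xi> i" "z' \<notin> g ` \<xi> i" using aut_image_iff[OF g(1)] g(3,4) by metis+
  moreover have "lt i a z" using realizesD(1)[OF z iI, of a] a by simp
  moreover have "lt i z' b" using realizes_above[OF z' iI, of b] b by simp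
  moreover have g\<xi>: "(\<lambda>j. g ` \<xi> j) \<in> S" using S_act[OF g(1) \<xi>] .
  ultimately have "a \<in> g ` \<xi> i" "b \<notin> g ` \<xi> i" using S_down[OF g\<xi> i] by blast+
  then have "(\<lambda>j. g ` \<xi> j) \<in> D \<sigma> (g w)" using w0 g\<xi> g(2) by blast
  then have "(\<lambda>j. inv g ` g ` \<xi> j) \<in> D \<sigma> w" using D_act_inv[OF g(1)] by blast
  then show ?thesis by (simp add: aut_image_inv(2)[OF g(1)])
qed

text \<open>Each point is chosen over a set that contains the earlier ones. This settles the
  relations outside \<open>J\<close>, so an application has to check only the orders in
  \<open>J\<close>.\<close>

lemma ex_chain_realization:
  assumes "\<alpha> \<in> S" "\<beta> \<in> S" "\<gamma> \<in> S" "finite H"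
  shows "\<exists>z1 z2 z3. realizes H z1 \<alpha> \<and> realizes H z2 \<beta> \<and> realizes H z3 \<gamma> \<and>
    z1 \<noteq> z2 \<and> z1 \<noteq> z3 \<and> z2 \<noteq> z3 \<and>
    (\<forall>\<theta>. (\<forall>j\<in>J. (lt j z1 z2 \<longleftrightarrow> j \<in> \<theta>) \<and> (lt j z1 z3 \<longleftrightarrow> j \<in> \<theta>) \<and> (lt j z2 z3 \<longleftrightarrow> j \<in> \<theta>)) \<longrightarrow>
      chain \<theta> z1 z2 \<and> chain \<theta> z1 z3 \<and> chain \<theta> z2 z3)"
proof -
  obtain z1 where z1: "realizes H z1 \<alpha>" using S_realize[OF assms(1,4)] by blast
  obtain z2 where z2: "realizes (insert z1 H) z2 \<beta>" using S_realize[OF assms(2), of "insert z1 H"] assms(4) by auto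
  obtain z3 where z3: "realizes (insert z1 (insert z2 H)) z3 \<gamma>"
    using S_realize[OF assms(3), of "insert z1 (insert z2 H)"] assms(4) by auto
  have off: "b \<in> \<zeta> j \<longleftrightarrow> \<eta> j = UNIV" if "\<zeta> \<in> S" "j \<in> I" "j \<notin> J" for \<zeta> j b
    using S_off[OF that] \<eta>_improper[of j] that(2,3) by auto
  have "lt j z1 z2 \<longleftrightarrow> \<eta> j = UNIV" "lt j z1 z3 \<longleftrightarrow> \<eta> j = UNIV" "lt j z2 z3 \<longleftrightarrow> \<eta> j = UNIV"
    if "j \<in> I" "j \<notin> J" for j
    using off[OF assms(2) that] off[OF assms(3) that] realizesD(1)[OF z2 that(1), of z1]
      realizesD(1)[OF z3 that(1), of z1] realizesD(1)[OF z3 that(1), of z2]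
    by (simp_all only: insert_iff simp_thms)
  moreover have ne: "z1 \<noteq> z2" "z1 \<noteq> z3" "z2 \<noteq> z3" using z2 z3 unfolding realizes_def by auto
  ultimately have "\<forall>\<theta>. (\<forall>j\<in>J. (lt j z1 z2 \<longleftrightarrow> j \<in> \<theta>) \<and> (lt j z1 z3 \<longleftrightarrow> j \<in> \<theta>) \<and> (lt j z2 z3 \<longleftrightarrow> j \<in> \<theta>)) \<longrightarrow>
      chain \<theta> z1 z2 \<and> chain \<theta> z1 z3 \<and> chain \<theta> z2 z3"
    unfolding chain_def by auto
  moreover have "realizes H z2 \<beta>" "realizes H z3 \<gamma>"
    using realizes_subset[OF z2] realizes_subset[OF z3] by blast+
  ultimately show ?thesis using z1 ne by blast
qed

section \<open>Faces with two opposite corners\<close>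

lemma ex_common_low:
  assumes "\<alpha> \<in> S" "\<beta> \<in> S" "i \<in> J"
  shows "\<exists>p. p \<in> \<alpha> i \<and> p \<in> \<beta> i"
proof -
  obtain a b where "a \<in> \<alpha> i" "b \<in> \<beta> i" using S_members(1) assms by meson
  then show ?thesis using S_down[OF assms(1,3)] S_down[OF assms(2,3)] lt_total[of a b i] by blast
qed

lemma ex_common_high:
  assumes "\<alpha> \<in> S" "\<beta> \<in> S" "i \<in> J"
  shows "\<exists>q. q \<notin> \<alpha> i \<and> q \<notin> \<beta> i"
proof -
  obtain a b where "a \<notin> \<alpha> i" "b \<notin> \<beta> i" using S_members(2) assms by meson
  then show ?thesis using S_down[OF assms(1,3)] S_down[OF assms(2,3)] lt_total[of a b i] by blast
qed

text \<open>\<open>H\<close> contains points on both sides of every cut of \<open>T\<close>, so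
  realizations over \<open>H\<close> are bounded by members of \<open>H\<close>. The tuple
  \<open>\<gamma>\<close> is taken close enough to the corner to lie beyond all of these
  bounds.\<close>

lemma corner_beyond:
  assumes cor: "corner \<sigma>" and T: "T \<subseteq> S" "finite T" and F: "finite F"
  shows "\<exists>\<gamma>\<in>S. \<exists>H. finite H \<and> (\<forall>j\<in>J. \<forall>b\<in>F. b \<in> \<gamma> j \<longleftrightarrow> j \<in> \<sigma>) \<and>
    (\<forall>\<alpha>\<in>T. \<forall>z z'. realizes H z \<alpha> \<longrightarrow> realizes H z' \<gamma> \<longrightarrow> (\<forall>j\<in>J. lt j z z' \<longleftrightarrow> j \<in> \<sigma>))"
proof -
  obtain l h where lh: "\<And>\<alpha> j. \<alpha> \<in> T \<Longrightarrow> j \<in> J \<Longrightarrow> l \<alpha> j \<in> \<alpha> j" "\<And>\<alpha> j. \<alpha> \<in> T \<Longrightarrow> j \<in> J \<Longrightarrow> h \<alpha> j \<notin> \<alpha> j"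
    using S_members T(1) by (metis subsetD)
  define H where "H = (\<Union>\<alpha>\<in>T. \<Union>j\<in>J. {l \<alpha> j, h \<alpha> j})"
  have finH: "finite H" using T(2) finite_J by (simp add: H_def)
  have mem: "l \<alpha> j \<in> H" "h \<alpha> j \<in> H" if "\<alpha> \<in> T" "j \<in> J" for \<alpha> j using that unfolding H_def by blast+
  have "finite (F \<union> H)" using F finH by simp
  then obtain \<gamma> where \<gamma>: "\<gamma> \<in> S" "\<And>j b. j \<in> J \<Longrightarrow> b \<in> F \<union> H \<Longrightarrow> b \<in> \<gamma> j \<longleftrightarrow> j \<in> \<sigma>"
    by (rule cornerE[OF cor]) (rule that)
  have "lt j z z' \<longleftrightarrow> j \<in> \<sigma>"
    if \<alpha>: "\<alpha> \<in> T" and z: "realizes H z \<alpha>" "realizes H z' \<gamma>" and j: "j \<in> J" for \<alpha> z z' j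
  proof (cases "j \<in> \<sigma>")
    case True
    have "lt j z (h \<alpha> j)" using realizes_above[OF z(1) JI[OF j] mem(2)[OF \<alpha> j]] lh(2)[OF \<alpha> j] by blast
    moreover have "lt j (h \<alpha> j) z'"
      using realizesD(1)[OF z(2) JI[OF j] mem(2)[OF \<alpha> j]] \<gamma>(2)[OF j, of "h \<alpha> j"] mem(2)[OF \<alpha> j] True by blast
    ultimately show ?thesis using True lt_trans by blast
  next
    case False
    have "lt j (l \<alpha> j) z" using realizesD(1)[OF z(1) JI[OF j] mem(1)[OF \<alpha> j]] lh(1)[OF \<alpha> j] by blast
    moreover have "lt j z' (l \<alpha> j)"
      using realizes_above[OF z(2) JI[OF j] mem(1)[OF \<alpha> j]] \<gamma>(2)[OF j, of "l \<alpha> j"] mem(1)[OF \<alpha> j] False by blast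
    ultimately show ?thesis using False lt_trans lt_asym by blast
  qed
  then show ?thesis using \<gamma> finH by (intro bexI[of _ \<gamma>] exI[of _ H]) auto
qed

text \<open>Points far out at the two corners are outside a bounded ball, on opposite ends of a chain.\<close>

lemma opposite_corners_unbounded_types:
  assumes cor: "corner \<sigma>" "corner \<tau>" and opp: "\<And>j. j \<in> J \<Longrightarrow> j \<in> \<tau> \<longleftrightarrow> j \<notin> \<sigma>"
    and i: "i \<in> J" and ne: "w0 \<noteq> x0"
    and bd: "\<And>x. same_type w0 x0 w0 x \<Longrightarrow> lt i p0 x \<and> lt i x q0"
  shows False
proof -
  define X where "X w = {u. \<exists>x. same_type w0 x0 w x \<and> \<not> lt i x u}" for w
  define Y where "Y w = {u. \<forall>x. same_type w0 x0 w x \<longrightarrow> lt i u x}" for w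
  define B where "B w = X w - Y w" for w
  have iI: "i \<in> I" using JI[OF i] .
  have bf: "ball_family i X Y" using type_hull_ball_family[OF iI ne] unfolding X_def Y_def .
  have B_iff: "u \<in> B w \<longleftrightarrow> (\<exists>x. same_type w0 x0 w x \<and> \<not> lt i x u) \<and> (\<exists>x. same_type w0 x0 w x \<and> \<not> lt i u x)" for u w
    unfolding B_def X_def Y_def by blast
  have B_act: "g u \<in> B (g w)" if "aut g" "u \<in> B w" for g u w
    using bf that aut_image_iff[OF that(1)] unfolding ball_family_def B_def by auto
  have B_bd: "\<exists>p q. \<forall>u\<in>B w. lt i p u \<and> lt i u q" for w
  proof -
    obtain g where g: "aut g" "g w0 = w" using ex_aut_one by blast
    have "lt i (g p0) x \<and> lt i x (g q0)" if "same_type w0 x0 w x" for x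
    proof -
      have "same_type w0 x0 w0 (inv g x)"
        using same_type_trans[OF that same_type_aut[OF aut_inv[OF g(1)]]] that g aut_inv_apply(1)[OF g(1)]
        unfolding same_type_def by metis
      then show ?thesis using bd[of "inv g x"] autD[OF g(1) iI] aut_inv_apply(2)[OF g(1)] by metis
    qed
    then have "lt i (g p0) u \<and> lt i u (g q0)" if "u \<in> B w" for u
      using that le_lt_trans lt_le_trans unfolding B_iff by blast
    then show ?thesis by blast
  qed
  have B_conv: "z \<in> B w" if "p \<in> B w" "q \<in> B w" "lt i p z" "lt i z q" for p q z w
    using that lt_trans unfolding B_iff by blast
  have B_type: "x \<in> B w" if "same_type w0 x0 w x" for x w using that unfolding B_iff by auto
  \<comment> \<open>Since balls that meet are nested, lying in a common ball is transitive.
    Primitivity then puts any two distinct points into a common ball.\<close>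
  define R where "R a b \<longleftrightarrow> a = b \<or> (\<exists>w. a \<in> B w \<and> b \<in> B w)" for a b
  have "(\<forall>a b. R a b \<longrightarrow> a = b) \<or> (\<forall>a b. R a b)"
  proof (rule primitive)
    fix a b c assume R: "R a b" "R b c"
    show "R a c"
    proof (cases "a = b \<or> b = c")
      case False
      then obtain w w' where "a \<in> B w" "b \<in> B w" "b \<in> B w'" "c \<in> B w'" using R unfolding R_def by blast
      then show ?thesis using balls_nested[OF bf iI, of b w w'] unfolding R_def B_def by blast
    qed (use R in auto)
  next
    fix g a b assume "aut g" "R a b"
    then show "R (g a) (g b)" using B_act unfolding R_def by blast
  qed (auto simp: R_def)
  moreover have "\<exists>a b. R a b \<and> a \<noteq> b"
  proof -
    obtain g where g: "aut g" "g w0 = x0" using ex_aut_one by blast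
    have st: "same_type w0 x0 x0 (g x0)" using same_type_aut[OF g(1) ne] g(2) by simp
    then have "same_type w0 x0 w0 (g x0)" using same_type_compose iI by blast
    moreover have "same_type w0 x0 w0 x0" using ne unfolding same_type_def by blast
    ultimately have "R x0 (g x0)" unfolding R_def using B_type by blast
    moreover have "x0 \<noteq> g x0" using st unfolding same_type_def by blast
    ultimately show ?thesis by blast
  qed
  ultimately have common: "\<exists>w. a \<in> B w \<and> b \<in> B w" if "a \<noteq> b" for a b
    using that unfolding R_def by blast
  have ball: "\<exists>p q r r' w. p \<in> \<alpha> i \<and> p \<in> \<beta> i \<and> q \<notin> \<alpha> i \<and> q \<notin> \<beta> i \<and> p \<in> B w \<and> q \<in> B w \<and>
      (\<forall>u\<in>B w. lt i r u \<and> lt i u r')" if S: "\<alpha> \<in> S" "\<beta> \<in> S" for \<alpha> \<beta>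
  proof -
    obtain p q where pq: "p \<in> \<alpha> i" "p \<in> \<beta> i" "q \<notin> \<alpha> i" "q \<notin> \<beta> i"
      using ex_common_low[OF S i] ex_common_high[OF S i] by blast
    then obtain w where w: "p \<in> B w" "q \<in> B w" using common[of p q] by blast
    obtain r r' where "\<forall>u\<in>B w. lt i r u \<and> lt i u r'" using B_bd by blast
    then show ?thesis using pq w by blast
  qed
  have in_ball: "z \<in> B w"
    if "realizes H z \<zeta>" "p \<in> H" "q \<in> H" "p \<in> \<zeta> i" "q \<notin> \<zeta> i" "p \<in> B w" "q \<in> B w" for H z \<zeta> p q w
    using B_conv[OF that(6,7)] realizesD(1)[OF that(1) iI that(2)] realizes_above[OF that(1) iI that(3)] that(4,5)
    by blast
  have out_ball: "z \<notin> B w"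
    if "realizes H z \<zeta>" "r \<in> H" "r' \<in> H" "r \<in> \<zeta> i \<longleftrightarrow> r' \<in> \<zeta> i" "\<forall>u\<in>B w. lt i r u \<and> lt i u r'" for H z \<zeta> r r' w
    using realizesD(1)[OF that(1) iI that(2)] realizesD(1)[OF that(1) iI that(3)] that(4,5) lt_asym by blast
  obtain \<beta> where \<beta>: "\<beta> \<in> S" using S_nonempty by blast
  obtain \<gamma> H1 where \<gamma>: "\<gamma> \<in> S" "finite H1"
    "\<And>z z' j. realizes H1 z \<beta> \<Longrightarrow> realizes H1 z' \<gamma> \<Longrightarrow> j \<in> J \<Longrightarrow> lt j z z' \<longleftrightarrow> j \<in> \<sigma>"
    using corner_beyond[OF cor(1), of "{\<beta>}" "{}"] \<beta> by auto
  \<comment> \<open>Realizations of \<open>\<beta>\<close> and \<open>\<gamma>\<close> over a set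
    with \<open>p\<close> and \<open>q\<close> lie between these two points in the order
    \<open>i\<close>, hence in the ball. The points \<open>r\<close> and \<open>r'\<close> enclose
    the ball, so a point with both of them on the same side is outside.\<close>
  obtain p q r r' w where w: "p \<in> \<beta> i" "p \<in> \<gamma> i" "q \<notin> \<beta> i" "q \<notin> \<gamma> i" "p \<in> B w" "q \<in> B w"
    "\<forall>u\<in>B w. lt i r u \<and> lt i u r'" using ball[OF \<beta> \<gamma>(1)] by blast
  obtain \<omega> H2 where \<omega>: "\<omega> \<in> S" "finite H2" "r \<in> \<omega> i \<longleftrightarrow> r' \<in> \<omega> i"
    "\<And>z z' j. realizes H2 z \<beta> \<Longrightarrow> realizes H2 z' \<omega> \<Longrightarrow> j \<in> J \<Longrightarrow> lt j z z' \<longleftrightarrow> j \<in> \<sigma>"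
    "\<And>z z' j. realizes H2 z \<gamma> \<Longrightarrow> realizes H2 z' \<omega> \<Longrightarrow> j \<in> J \<Longrightarrow> lt j z z' \<longleftrightarrow> j \<in> \<sigma>"
    using corner_beyond[OF cor(1), of "{\<beta>, \<gamma>}" "{r, r'}"] \<beta> \<gamma>(1) i by auto
  \<comment> \<open>Near the corner \<open>\<tau>\<close> a point lies before the others with
    respect to \<open>\<sigma>\<close>. It starts a chain of type \<open>\<sigma>\<close>, whereas a
    realization of \<open>\<omega>\<close> ends one.\<close>
  obtain \<alpha> H3 where \<alpha>: "\<alpha> \<in> S" "finite H3" "r \<in> \<alpha> i \<longleftrightarrow> r' \<in> \<alpha> i"
    "\<And>z z' j. realizes H3 z \<beta> \<Longrightarrow> realizes H3 z' \<alpha> \<Longrightarrow> j \<in> J \<Longrightarrow> lt j z z' \<longleftrightarrow> j \<in> \<tau>"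
    "\<And>z z' j. realizes H3 z \<gamma> \<Longrightarrow> realizes H3 z' \<alpha> \<Longrightarrow> j \<in> J \<Longrightarrow> lt j z z' \<longleftrightarrow> j \<in> \<tau>"
    using corner_beyond[OF cor(2), of "{\<beta>, \<gamma>}" "{r, r'}"] \<beta> \<gamma>(1) i by auto
  let ?H = "H1 \<union> H2 \<union> H3 \<union> {p, q, r, r'}"
  have fin: "finite ?H" using \<gamma>(2) \<omega>(2) \<alpha>(2) by simp
  have sub: "H1 \<subseteq> ?H" "H2 \<subseteq> ?H" "H3 \<subseteq> ?H" by blast+
  obtain z1 z2 z3 where z: "realizes ?H z1 \<beta>" "realizes ?H z2 \<gamma>" "realizes ?H z3 \<omega>"
    and ch: "(\<forall>j\<in>J. (lt j z1 z2 \<longleftrightarrow> j \<in> \<sigma>) \<and> (lt j z1 z3 \<longleftrightarrow> j \<in> \<sigma>) \<and> (lt j z2 z3 \<longleftrightarrow> j \<in> \<sigma>)) \<Longrightarrow>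
      chain \<sigma> z1 z2 \<and> chain \<sigma> z1 z3 \<and> chain \<sigma> z2 z3"
    using ex_chain_realization[OF \<beta> \<gamma>(1) \<omega>(1) fin] by blast
  have ch: "chain \<sigma> z1 z2 \<and> chain \<sigma> z1 z3 \<and> chain \<sigma> z2 z3"
    using \<gamma>(3)[OF realizes_subset[OF z(1) sub(1)] realizes_subset[OF z(2) sub(1)]]
      \<omega>(4)[OF realizes_subset[OF z(1) sub(2)] realizes_subset[OF z(3) sub(2)]]
      \<omega>(5)[OF realizes_subset[OF z(2) sub(2)] realizes_subset[OF z(3) sub(2)]]
    by (intro ch) blast
  obtain z1' z2' z3' where z': "realizes ?H z1' \<alpha>" "realizes ?H z2' \<beta>" "realizes ?H z3' \<gamma>"
    and ch': "(\<forall>j\<in>J. (lt j z1' z2' \<longleftrightarrow> j \<in> \<sigma>) \<and> (lt j z1' z3' \<longleftrightarrow> j \<in> \<sigma>) \<and> (lt j z2' z3' \<longleftrightarrow> j \<in> \<sigma>)) \<Longrightarrow>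
      chain \<sigma> z1' z2' \<and> chain \<sigma> z1' z3' \<and> chain \<sigma> z2' z3'"
    and ne': "z1' \<noteq> z2'" "z1' \<noteq> z3'"
    using ex_chain_realization[OF \<alpha>(1) \<beta> \<gamma>(1) fin] by blast
  have "lt j z1' z2' \<longleftrightarrow> j \<in> \<sigma>" "lt j z1' z3' \<longleftrightarrow> j \<in> \<sigma>" if "j \<in> J" for j
    using \<alpha>(4)[OF realizes_subset[OF z'(2) sub(3)] realizes_subset[OF z'(1) sub(3)] that]
      \<alpha>(5)[OF realizes_subset[OF z'(3) sub(3)] realizes_subset[OF z'(1) sub(3)] that] opp[OF that]
      ne' lt_asym lt_total by blast+
  then have ch': "chain \<sigma> z1' z2' \<and> chain \<sigma> z1' z3' \<and> chain \<sigma> z2' z3'"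
    using \<gamma>(3)[OF realizes_subset[OF z'(2) sub(1)] realizes_subset[OF z'(3) sub(1)]]
    by (intro ch') blast
  have H: "p \<in> ?H" "q \<in> ?H" "r \<in> ?H" "r' \<in> ?H" by auto
  have "z1 \<in> B w" "z2 \<in> B w" "z3 \<notin> B w" "z1' \<notin> B w" "z2' \<in> B w" "z3' \<in> B w"
    using in_ball[OF z(1) H(1,2) w(1,3,5,6)] in_ball[OF z(2) H(1,2) w(2,4,5,6)]
      in_ball[OF z'(2) H(1,2) w(1,3,5,6)] in_ball[OF z'(3) H(1,2) w(2,4,5,6)]
      out_ball[OF z(3) H(3,4) \<omega>(3) w(7)] out_ball[OF z'(1) H(3,4) \<alpha>(3) w(7)] by blast+
  then show False
    using no_two_combs[OF bf iI, of z1 w z2 z3 z1' w z2' z3'] ch ch' chain_same_type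
    unfolding B_def by blast
qed

text \<open>As no orbit is bounded, \<open>D \<sigma> b\<close> comes up to \<open>b\<close> from
  below in the order \<open>i\<close>, and \<open>D \<tau> a\<close> comes down to \<open>a\<close>
  from above. A tuple that separates \<open>x\<close> from \<open>y\<close> in \<open>i\<close> lies
  in both, which fixes its position relative to \<open>a\<close> and \<open>b\<close> in
  \<open>k\<close> as well. So \<open>i\<close> determines \<open>k\<close>.\<close>

lemma opposite_corners_monotone:
  assumes cor: "corner \<sigma>" "corner \<tau>" and opp: "\<And>j. j \<in> J \<Longrightarrow> j \<in> \<tau> \<longleftrightarrow> j \<notin> \<sigma>"
    and i: "i \<in> J" "i \<in> \<sigma>" and k: "k \<in> J" "k \<noteq> i"
  shows False
proof -
  have iI: "i \<in> I" and kI: "k \<in> I" using JI i k by auto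
  have unbounded: "\<exists>x'. same_type w x w x' \<and> \<not> (lt i p x' \<and> lt i x' q)" if "w \<noteq> x" for w x p q
    using opposite_corners_unbounded_types[OF cor opp i(1) that] by blast
  have main: "if k \<in> \<sigma> then lt k a b else lt k b a" if ab: "lt i a b" for a b
  proof -
    obtain x where x: "lt i a x" "lt i x b" using dense[OF iI ab] by blast
    obtain y where y: "lt i x y" "lt i y b" using dense[OF iI x(2)] by blast
    obtain \<zeta> where \<zeta>: "\<zeta> \<in> S" "x \<in> \<zeta> i" "y \<notin> \<zeta> i" using S_separate[OF i(1) y(1)] by blast
    \<comment> \<open>If all cuts of \<open>D \<sigma> b\<close> avoided \<open>y\<close>, they
      would avoid its whole orbit over \<open>b\<close>. This orbit is below \<open>b\<close> and
      unbounded, so it has points not above \<open>p\<close>, and these belong to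
      \<open>\<xi> i\<close>.\<close>
    have "\<exists>\<xi>\<in>D \<sigma> b. y \<in> \<xi> i"
    proof (rule ccontr)
      assume "\<not> ?thesis"
      then have no: "y \<notin> \<xi> i" if "\<xi> \<in> D \<sigma> b" for \<xi> using that by blast
      obtain \<xi> where \<xi>: "\<xi> \<in> S" "\<And>j c. j \<in> J \<Longrightarrow> c \<in> {b} \<Longrightarrow> c \<in> \<xi> j \<longleftrightarrow> j \<in> \<tau>"
        by (rule cornerE[OF cor(2), of "{b}"]) auto
      then have \<xi>D: "\<xi> \<in> D \<sigma> b" using opp unfolding D_def by auto
      obtain p where p: "p \<in> \<xi> i" using S_members(1)[OF \<xi>(1) i(1)] by blast
      have "b \<noteq> y" using y(2) by auto
      then obtain x' where x': "same_type b y b x'" "\<not> (lt i p x' \<and> lt i x' b)" using unbounded by blast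
      obtain g where g: "aut g" "g b = b" "g y = x'" using ex_aut_two[OF x'(1)] by blast
      have "lt i x' b" using y(2) autD[OF g(1) iI] g(2,3) by metis
      moreover have "(\<lambda>j. inv g ` \<xi> j) \<in> D \<sigma> b" using D_act_inv[OF g(1)] \<xi>D g(2) by metis
      then have "y \<notin> inv g ` \<xi> i" by (rule no)
      then have "x' \<notin> \<xi> i" using g(1,3) aut_inv_apply(1) by (metis image_eqI)
      then have "lt i p x'" using S_lt[OF \<xi>(1) i(1) p] by blast
      ultimately show False using x'(2) by blast
    qed
    then obtain \<xi> where \<xi>: "\<xi> \<in> D \<sigma> b" "y \<in> \<xi> i" by blast
    \<comment> \<open>As \<open>i\<close> is not in \<open>\<tau>\<close>, a tuple near that corner
      is far down in \<open>i\<close>; it is the lower of the two tuples that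
      \<open>D_convex\<close> needs.\<close>
    obtain \<rho> where \<rho>: "\<rho> \<in> S" "\<And>j c. j \<in> J \<Longrightarrow> c \<in> {b, x} \<Longrightarrow> c \<in> \<rho> j \<longleftrightarrow> j \<in> \<tau>"
      by (rule cornerE[OF cor(2), of "{b, x}"]) auto
    have \<rho>D: "\<rho> \<in> D \<sigma> b" using \<rho> opp unfolding D_def by auto
    have "x \<notin> \<rho> i" using \<rho>(2)[OF i(1), of x] opp[OF i(1)] i(2) by simp
    then have \<zeta>b: "\<zeta> \<in> D \<sigma> b" using D_convex[OF cor(1) i(1) \<rho>D \<xi>(1) \<zeta>(1,2) _ \<xi>(2) \<zeta>(3)] by blast
    have "\<exists>\<xi>\<in>D \<tau> a. x \<notin> \<xi> i"
    proof (rule ccontr)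
      assume "\<not> ?thesis"
      then have no: "x \<in> \<xi> i" if "\<xi> \<in> D \<tau> a" for \<xi> using that by blast
      obtain \<xi> where \<xi>: "\<xi> \<in> S" "\<And>j c. j \<in> J \<Longrightarrow> c \<in> {a} \<Longrightarrow> c \<in> \<xi> j \<longleftrightarrow> j \<in> \<sigma>"
        by (rule cornerE[OF cor(1), of "{a}"]) auto
      then have \<xi>D: "\<xi> \<in> D \<tau> a" using opp unfolding D_def by auto
      obtain q where q: "q \<notin> \<xi> i" using S_members(2)[OF \<xi>(1) i(1)] by blast
      have "a \<noteq> x" using x(1) by auto
      then obtain x' where x': "same_type a x a x'" "\<not> (lt i a x' \<and> lt i x' q)" using unbounded by blast
      obtain g where g: "aut g" "g a = a" "g x = x'" using ex_aut_two[OF x'(1)] by blast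
      have "lt i a x'" using x(1) autD[OF g(1) iI] g(2,3) by metis
      moreover have "(\<lambda>j. inv g ` \<xi> j) \<in> D \<tau> a" using D_act_inv[OF g(1)] \<xi>D g(2) by metis
      then have "x \<in> inv g ` \<xi> i" by (rule no)
      then have "x' \<in> \<xi> i" using g(1,3) aut_inv_apply(2) by (metis imageE)
      then have "lt i x' q" using S_lt[OF \<xi>(1) i(1) _ q] by blast
      ultimately show False using x'(2) by blast
    qed
    then obtain \<xi>' where \<xi>': "\<xi>' \<in> D \<tau> a" "x \<notin> \<xi>' i" by blast
    obtain \<rho>' where \<rho>': "\<rho>' \<in> S" "\<And>j c. j \<in> J \<Longrightarrow> c \<in> {a, y} \<Longrightarrow> c \<in> \<rho>' j \<longleftrightarrow> j \<in> \<sigma>"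
      by (rule cornerE[OF cor(1), of "{a, y}"]) auto
    have \<rho>'D: "\<rho>' \<in> D \<tau> a" using \<rho>' opp unfolding D_def by auto
    have "y \<in> \<rho>' i" using \<rho>'(2)[OF i(1), of y] i(2) by simp
    then have \<zeta>a: "\<zeta> \<in> D \<tau> a" using D_convex[OF cor(2) i(1) \<xi>'(1) \<rho>'D \<zeta>(1,2) \<xi>'(2) _ \<zeta>(3)] by blast
    have "b \<in> \<zeta> k \<longleftrightarrow> k \<notin> \<sigma>" "a \<in> \<zeta> k \<longleftrightarrow> k \<in> \<sigma>"
      using D_iff[OF \<zeta>b k(1)] D_iff[OF \<zeta>a k(1)] opp[OF k(1)] by auto
    then show ?thesis using S_lt[OF \<zeta>(1) k(1)] by auto
  qed
  show False
  proof (cases "k \<in> \<sigma>")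
    case True
    then show ?thesis using main not_equal[OF iI kI] k(2) lt_asym by metis
  next
    case False
    then show ?thesis using main not_reverse[OF iI kI] k(2) lt_asym by metis
  qed
qed

section \<open>Corners without an opposite corner\<close>

context
  fixes \<sigma> :: "nat set"
  assumes cor: "corner \<sigma>" and no_opposite: "\<not> corner (J - \<sigma>)"
begin

definition hull_sup :: "nat \<Rightarrow> nat \<Rightarrow> nat set" where
  "hull_sup j w = (\<Union>\<zeta>\<in>D \<sigma> w. \<zeta> j)"

definition hull_inf :: "nat \<Rightarrow> nat \<Rightarrow> nat set" where
  "hull_inf j w = (\<Inter>\<zeta>\<in>D \<sigma> w. \<zeta> j)"

definition B :: "nat \<Rightarrow> nat \<Rightarrow> nat set" where
  "B j w = hull_sup j w - hull_inf j w"

lemma B_iff: "u \<in> B j w \<longleftrightarrow> (\<exists>\<xi>\<in>D \<sigma> w. u \<in> \<xi> j) \<and> (\<exists>\<zeta>\<in>D \<sigma> w. u \<notin> \<zeta> j)"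
  unfolding B_def hull_sup_def hull_inf_def by blast

text \<open>An unbounded \<open>D \<sigma> w\<close> would accumulate at a corner. All its members
  have \<open>w\<close> in the direction of \<open>\<sigma>\<close>, so this could only be the
  missing opposite corner.\<close>

lemma D_bounded:
  assumes j: "j \<in> J"
  shows "\<exists>p q. \<forall>\<zeta>\<in>D \<sigma> w. p \<in> \<zeta> j \<and> q \<notin> \<zeta> j"
proof -
  have DS: "D \<sigma> w \<subseteq> S" using D_S by blast
  have improper_limit: False if lim: "limit_of (D \<sigma> w) \<kappa>" and np: "\<not> proper (\<kappa> j)" for \<kappa>
  proof -
    have "\<exists>\<zeta>\<in>S. \<forall>k\<in>J. \<forall>b\<in>F. b \<in> \<zeta> k \<longleftrightarrow> k \<in> J - \<sigma>" if F: "finite F" for F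
    proof -
      \<comment> \<open>Testing at \<open>w\<close> as well identifies the corner, since membership
        of \<open>w\<close> in \<open>\<zeta> k\<close> is prescribed by \<open>D\<close>.\<close>
      obtain \<zeta> where \<zeta>: "\<zeta> \<in> D \<sigma> w" "\<forall>k\<in>J. \<forall>b\<in>insert w F. b \<in> \<zeta> k \<longleftrightarrow> \<kappa> k = UNIV"
        using limit_corner[OF lim DS j np, of "insert w F"] F by auto
      have "b \<in> \<zeta> k \<longleftrightarrow> k \<in> J - \<sigma>" if "k \<in> J" "b \<in> F" for k b
        using \<zeta>(2) D_iff[OF \<zeta>(1) that(1)] that by blast
      then show ?thesis using D_S[OF \<zeta>(1)] by blast
    qed
    then show False using no_opposite unfolding corner_def by blast
  qed
  have "\<exists>p. \<forall>\<zeta>\<in>D \<sigma> w. p \<in> \<zeta> j"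
  proof (rule ccontr)
    assume "\<not> ?thesis"
    then obtain \<kappa> where \<kappa>: "limit_of (D \<sigma> w) \<kappa>" "\<kappa> j = {}" using limit_below[OF DS j] by blast
    then show False using improper_limit[OF \<kappa>(1)] by (simp add: proper_def)
  qed
  moreover have "\<exists>q. \<forall>\<zeta>\<in>D \<sigma> w. q \<notin> \<zeta> j"
  proof (rule ccontr)
    assume "\<not> ?thesis"
    then obtain \<kappa> where \<kappa>: "limit_of (D \<sigma> w) \<kappa>" "\<kappa> j = UNIV" using limit_above[OF DS j] by blast
    then show False using improper_limit[OF \<kappa>(1)] by (simp add: proper_def)
  qed
  ultimately show ?thesis by blast
qed

text \<open>Realizations of members of \<open>D \<sigma> w\<close> all have the same type over
  \<open>w\<close>. For a cut strictly inside the hull there are such realizations on both sides,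
  and the stabilizer of \<open>w\<close> moves one to the other.\<close>

lemma hull_ball_family:
  assumes j: "j \<in> J"
  shows "ball_family j (hull_sup j) (hull_inf j)"
proof (rule ball_familyI)
  show "down j (hull_sup j w)" for w
    unfolding down_def hull_sup_def using S_down[OF D_S j] by blast
  show "down j (hull_inf j w)" for w
    unfolding down_def hull_inf_def using S_down[OF D_S j] by blast
next
  fix g w u assume g: "aut g" and "u \<in> hull_sup j w"
  then obtain \<zeta> where "\<zeta> \<in> D \<sigma> w" "u \<in> \<zeta> j" unfolding hull_sup_def by blast
  then show "g u \<in> hull_sup j (g w)" using D_act[OF g, of \<zeta>] unfolding hull_sup_def by blast
next
  fix g w u assume g: "aut g" and u: "u \<in> hull_inf j w"
  show "g u \<in> hull_inf j (g w)"
    unfolding hull_inf_def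
  proof
    fix \<zeta> assume "\<zeta> \<in> D \<sigma> (g w)"
    then have "(\<lambda>i. inv g ` \<zeta> i) \<in> D \<sigma> w" by (rule D_act_inv[OF g])
    then have "u \<in> inv g ` \<zeta> j" using u unfolding hull_inf_def by blast
    then show "g u \<in> \<zeta> j" using aut_inv_apply(2)[OF g] by auto
  qed
next
  fix w C assume C: "down j C" and inv: "\<And>g x. aut g \<Longrightarrow> g w = w \<Longrightarrow> x \<in> C \<Longrightarrow> g x \<in> C"
    and "hull_inf j w \<subset> C" "C \<subset> hull_sup j w"
  then obtain d d' where "d \<in> hull_sup j w" "d \<notin> C" "d' \<in> C" "d' \<notin> hull_inf j w" by blast
  then obtain \<zeta> \<xi> where \<xi>: "\<xi> \<in> D \<sigma> w" "d \<in> \<xi> j" "d \<notin> C" and \<zeta>: "\<zeta> \<in> D \<sigma> w" "d' \<notin> \<zeta> j" "d' \<in> C"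
    unfolding hull_sup_def hull_inf_def by blast
  obtain z where z: "realizes {w, d, d'} z \<zeta>" using S_realize[OF D_S[OF \<zeta>(1)], of "{w, d, d'}"] by auto
  obtain z' where z': "realizes {w, d, d'} z' \<xi>" using S_realize[OF D_S[OF \<xi>(1)], of "{w, d, d'}"] by auto
  have jI: "j \<in> I" using JI[OF j] .
  have "lt j z d'" using realizes_above[OF z jI, of d'] \<zeta>(2) by simp
  then have zC: "z \<in> C" using \<zeta>(3) C downD by blast
  have "lt j d z'" using realizesD(1)[OF z' jI, of d] \<xi>(2) by simp
  then have z'C: "z' \<notin> C" using \<xi>(3) C downD by blast
  have "w \<in> \<zeta> i \<longleftrightarrow> w \<in> \<xi> i" if "i \<in> I" for i
    using D_iff[OF \<zeta>(1), of i] D_iff[OF \<xi>(1), of i] S_off[OF D_S[OF \<zeta>(1)] that] S_off[OF D_S[OF \<xi>(1)] that]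
    by (cases "i \<in> J") auto
  then have same: "lt i b z \<longleftrightarrow> lt i b z'" if "i \<in> I" "b \<in> {w}" for i b
    using that realizesD(1)[OF z, of i w] realizesD(1)[OF z', of i w] by simp
  have "z \<notin> {w}" "z' \<notin> {w}" using z z' unfolding realizes_def by auto
  then obtain g where "aut g" "g w = w" "g z = z'" using ex_aut_insert[of "{w}" z z', OF _ _ _ same] by auto
  then show False using inv zC z'C by blast
qed

lemma B_act: "aut g \<Longrightarrow> j \<in> J \<Longrightarrow> B j (g w) = g ` B j w"
  using hull_ball_family[of j] image_set_diff[OF bij_is_inj[OF aut_bij]]
  unfolding ball_family_def B_def by metis

text \<open>An arbitrary member of \<open>S\<close>, with tuples above and below it in each order of
  \<open>J\<close>, is absorbed by some point \<open>w'\<close>. An automorphism moves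
  \<open>w'\<close> to \<open>w\<close>.\<close>

lemma ex_interior: "\<exists>\<beta>\<in>D \<sigma> w. \<forall>j\<in>J. \<exists>x y. x \<in> hull_sup j w \<and> x \<notin> \<beta> j \<and> y \<in> \<beta> j \<and> y \<notin> hull_inf j w"
proof -
  obtain \<beta> where \<beta>: "\<beta> \<in> S" using S_nonempty by blast
  have "\<exists>\<xi>\<in>S. \<exists>x. x \<in> \<xi> j \<and> x \<notin> \<beta> j" "\<exists>\<zeta>\<in>S. \<exists>y. y \<in> \<beta> j \<and> y \<notin> \<zeta> j" if j: "j \<in> J" for j
    using S_members[OF \<beta> j] S_ex_above[OF j] S_ex_below[OF j] by meson+
  then obtain \<xi> \<zeta> where \<xi>: "\<And>j. j \<in> J \<Longrightarrow> \<xi> j \<in> S \<and> (\<exists>x. x \<in> \<xi> j j \<and> x \<notin> \<beta> j)"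
    and \<zeta>: "\<And>j. j \<in> J \<Longrightarrow> \<zeta> j \<in> S \<and> (\<exists>y. y \<in> \<beta> j \<and> y \<notin> \<zeta> j j)"
    by metis
  let ?T = "insert \<beta> (\<xi> ` J \<union> \<zeta> ` J)"
  have T: "?T \<subseteq> S" "finite ?T" using \<beta> \<xi> \<zeta> finite_J by auto
  obtain w' where w': "?T \<subseteq> D \<sigma> w'" using absorb_finite[OF cor T] by blast
  obtain g where g: "aut g" "g w' = w" using ex_aut_one by blast
  have bf: "hull_sup j w = g ` hull_sup j w'" "hull_inf j w = g ` hull_inf j w'" if "j \<in> J" for j
    using hull_ball_family[OF that] g unfolding ball_family_def by metis+
  have "(\<lambda>j. g ` \<beta> j) \<in> D \<sigma> w" using D_act[OF g(1), of \<beta> \<sigma> w'] w' g(2) by simp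
  moreover have "\<exists>x y. x \<in> hull_sup j w \<and> x \<notin> g ` \<beta> j \<and> y \<in> g ` \<beta> j \<and> y \<notin> hull_inf j w" if j: "j \<in> J" for j
  proof -
    obtain x y where xy: "x \<in> \<xi> j j" "x \<notin> \<beta> j" "y \<in> \<beta> j" "y \<notin> \<zeta> j j" using \<xi>[OF j] \<zeta>[OF j] by blast
    have "\<xi> j \<in> D \<sigma> w'" "\<zeta> j \<in> D \<sigma> w'" using w' j by auto
    then have "x \<in> hull_sup j w'" "y \<notin> hull_inf j w'" using xy unfolding hull_sup_def hull_inf_def by blast+
    then have "g x \<in> hull_sup j w" "g x \<notin> g ` \<beta> j" "g y \<in> g ` \<beta> j" "g y \<notin> hull_inf j w"
      using bf[OF j] aut_image_iff[OF g(1)] xy by auto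
    then show ?thesis by blast
  qed
  ultimately show ?thesis by (intro bexI[of _ "\<lambda>j. g ` \<beta> j"]) auto
qed

lemma ex_interior_realization:
  "\<exists>\<beta>\<in>S. \<exists>H. finite H \<and> (\<forall>z. realizes H z \<beta> \<longrightarrow> (\<forall>j\<in>J. z \<in> B j w))"
proof -
  obtain \<beta> where \<beta>: "\<beta> \<in> D \<sigma> w"
    and int: "\<forall>j\<in>J. \<exists>x y. x \<in> hull_sup j w \<and> x \<notin> \<beta> j \<and> y \<in> \<beta> j \<and> y \<notin> hull_inf j w"
    using ex_interior by blast
  obtain x y where xy: "\<And>j. j \<in> J \<Longrightarrow> x j \<in> hull_sup j w \<and> x j \<notin> \<beta> j \<and> y j \<in> \<beta> j \<and> y j \<notin> hull_inf j w"
    using int by metis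
  have "z \<in> B j w" if z: "realizes (x ` J \<union> y ` J) z \<beta>" and j: "j \<in> J" for z j
  proof -
    have "lt j z (x j)" "lt j (y j) z"
      using realizes_above[OF z JI[OF j], of "x j"] realizesD(1)[OF z JI[OF j], of "y j"] xy[OF j] j by auto
    moreover have "down j (hull_sup j w)" "down j (hull_inf j w)"
      using hull_ball_family[OF j] unfolding ball_family_def by auto
    ultimately show ?thesis using xy[OF j] downD unfolding B_def by blast
  qed
  then show ?thesis using D_S[OF \<beta>] finite_J by (intro bexI[of _ \<beta>] exI[of _ "x ` J \<union> y ` J"]) auto
qed

text \<open>The stabilizer of \<open>w\<close> would fix a least point \<open>x\<close>, so the
  points up to \<open>x\<close> would form an invariant cut. It lies strictly inside the ball,
  because the ball has two distinct points.\<close>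

lemma B_no_least:
  assumes j: "j \<in> J" and x: "x \<in> B j w"
  shows "\<exists>y\<in>B j w. lt j y x"
proof (rule ccontr)
  assume least: "\<not> ?thesis"
  obtain \<beta> x1 y1 where "\<beta> \<in> D \<sigma> w" "x1 \<in> hull_sup j w" "x1 \<notin> \<beta> j" "y1 \<in> \<beta> j" "y1 \<notin> hull_inf j w"
    using ex_interior j by meson
  then have two: "x1 \<in> B j w" "y1 \<in> B j w" "x1 \<noteq> y1" unfolding B_iff hull_sup_def hull_inf_def by blast+
  have dn: "down j (hull_sup j w)" "down j (hull_inf j w)"
    using hull_ball_family[OF j] unfolding ball_family_def by auto
  let ?C = "{u. \<not> lt j x u}"
  have dC: "down j ?C" unfolding down_def using lt_trans by blast
  have fix_x: "g x = x" if g: "aut g" "g w = w" for g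
  proof -
    have least': "\<not> lt j y (g x)" if "y \<in> B j w" for y
    proof -
      have "inv g y \<in> B j w"
        using B_act[OF g(1) j, of w] that g aut_inv_apply(1)[OF g(1)] by (metis imageE)
      then have "\<not> lt j (inv g y) x" using least by blast
      then show ?thesis using autD[OF g(1) JI[OF j]] aut_inv_apply(2)[OF g(1)] by metis
    qed
    have "g x \<in> B j w" using B_act[OF g(1) j, of w] x g(2) by auto
    then show ?thesis using least least'[OF x] not_lt by blast
  qed
  have "g u \<in> ?C" if "aut g" "g w = w" "u \<in> ?C" for g u
    using fix_x[OF that(1,2)] autD[OF that(1) JI[OF j]] that(3) by (metis mem_Collect_eq)
  moreover have "hull_inf j w \<subset> ?C"
  proof -
    have "x \<notin> hull_inf j w" using x unfolding B_def by blast
    then show ?thesis using dn(2) downD by fastforce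
  qed
  moreover have "?C \<subset> hull_sup j w"
  proof -
    have "x \<in> hull_sup j w" using x unfolding B_def by blast
    then have "u \<in> hull_sup j w" if "u \<in> ?C" for u
      using that dn(1) downD not_lt[of j x u] by (metis mem_Collect_eq)
    then have "?C \<subseteq> hull_sup j w" by blast
    moreover have "\<exists>u\<in>B j w. lt j x u" using two least lt_total by metis
    then have "\<exists>u\<in>hull_sup j w. u \<notin> ?C" unfolding B_def by blast
    ultimately show ?thesis by blast
  qed
  ultimately show False using hull_ball_family[OF j] dC unfolding ball_family_def by blast
qed

text \<open>As \<open>x\<close> is least in neither ball, some tuple has its cut below
  \<open>x\<close> but above a point of each ball, and \<open>D_convex\<close> puts it into both
  sets. This links the orders: once the sets of tuples are disjoint, so are the balls in every order
  of \<open>J\<close>.\<close>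

lemma balls_meet:
  assumes j: "j \<in> J" and x: "x \<in> B j w" "x \<in> B j w'"
  shows "D \<sigma> w \<inter> D \<sigma> w' \<noteq> {}"
proof -
  obtain y y' where y: "y \<in> B j w" "lt j y x" and y': "y' \<in> B j w'" "lt j y' x"
    using B_no_least[OF j] x by blast
  obtain m where m: "m \<in> {y, y'}" "\<forall>u\<in>{y, y'}. \<not> lt j m u" using finite_has_max[of "{y, y'}"] by blast
  then have "lt j m x" using y y' by blast
  then obtain \<omega> where \<omega>: "\<omega> \<in> S" "m \<in> \<omega> j" "x \<notin> \<omega> j" using S_separate[OF j] by blast
  have "\<omega> \<in> D \<sigma> v" if v: "x \<in> B j v" "u \<in> B j v" "\<not> lt j m u" for u v
  proof -
    obtain \<zeta> \<xi> where \<zeta>: "\<zeta> \<in> D \<sigma> v" "u \<notin> \<zeta> j" and \<xi>: "\<xi> \<in> D \<sigma> v" "x \<in> \<xi> j"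
      using v(1,2) unfolding B_iff by blast
    have "m \<notin> \<zeta> j" using S_lt[OF D_S[OF \<zeta>(1)] j _ \<zeta>(2)] v(3) by blast
    then show ?thesis using D_convex[OF cor j \<zeta>(1) \<xi>(1) \<omega>(1,2) _ \<xi>(2) \<omega>(3)] by blast
  qed
  then show ?thesis using x y(1) y'(1) m(2) by blast
qed

definition ball_rel :: "nat set \<Rightarrow> nat \<Rightarrow> nat \<Rightarrow> bool" where
  "ball_rel \<theta> w w' \<longleftrightarrow> (\<forall>j\<in>J. \<forall>x\<in>B j w. \<forall>x'\<in>B j w'. (j \<in> \<theta> \<longrightarrow> lt j x x') \<and> (j \<notin> \<theta> \<longrightarrow> lt j x' x))"

lemma ball_rel_iff: "ball_rel \<theta> w w' \<Longrightarrow> j \<in> J \<Longrightarrow> x \<in> B j w \<Longrightarrow> x' \<in> B j w' \<Longrightarrow> lt j x x' \<longleftrightarrow> j \<in> \<theta>"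
  unfolding ball_rel_def using lt_asym by blast

lemma B_convex:
  assumes j: "j \<in> J" and "x \<in> B j w" "y \<in> B j w" "lt j x u" "lt j u y"
  shows "u \<in> B j w"
proof -
  obtain \<zeta> \<xi> where "\<zeta> \<in> D \<sigma> w" "x \<notin> \<zeta> j" "\<xi> \<in> D \<sigma> w" "y \<in> \<xi> j" using assms(2,3) unfolding B_iff by blast
  then show ?thesis unfolding B_iff using S_down[OF D_S j] assms(4,5) by blast
qed

text \<open>The lower ends of the balls cover the structure by transitivity, so in the order
  \<open>i\<close> some ball lies above the ball of 0. Then no tuple is shared, the balls are
  disjoint in every order of \<open>J\<close>, and convexity makes them comparable;
  \<open>\<theta>\<close> records the directions.\<close>

lemma ex_ball_rel:
  assumes i: "i \<in> J"
  shows "\<exists>\<theta> w w'. ball_rel \<theta> w w'"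
proof -
  have "(\<Union>w. hull_inf i w) = UNIV"
  proof (rule invariant_set_trivial)
    fix g x assume g: "aut g" and "x \<in> (\<Union>w. hull_inf i w)"
    then obtain w where "x \<in> hull_inf i w" by blast
    moreover have "hull_inf i (g w) = g ` hull_inf i w"
      using hull_ball_family[OF i] g unfolding ball_family_def by simp
    ultimately show "g x \<in> (\<Union>w. hull_inf i w)" by blast
  next
    obtain p where "\<forall>\<zeta>\<in>D \<sigma> 0. p \<in> \<zeta> i" using D_bounded[OF i] by blast
    then have "p \<in> hull_inf i 0" unfolding hull_inf_def by blast
    then show "(\<Union>w. hull_inf i w) \<noteq> {}" by blast
  qed
  moreover obtain r where r: "\<forall>\<zeta>\<in>D \<sigma> 0. r \<notin> \<zeta> i" using D_bounded[OF i] by blast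
  ultimately obtain w' where w': "r \<in> hull_inf i w'" by blast
  have "D \<sigma> 0 \<inter> D \<sigma> w' = {}" using r w' unfolding hull_inf_def by blast
  then have disj: "B j 0 \<inter> B j w' = {}" if "j \<in> J" for j using balls_meet[OF that] by blast
  define \<theta> where "\<theta> = {j\<in>J. \<exists>x\<in>B j 0. \<exists>x'\<in>B j w'. lt j x x'}"
  have "(j \<in> \<theta> \<longrightarrow> lt j x x') \<and> (j \<notin> \<theta> \<longrightarrow> lt j x' x)" if j: "j \<in> J" and x: "x \<in> B j 0" "x' \<in> B j w'" for j x x'
  proof -
    have ne: "x \<noteq> x'" using disj[OF j] x by blast
    have "lt j x x'" if "y \<in> B j 0" "y' \<in> B j w'" "lt j y y'" for y y'
    proof (rule ccontr)
      assume "\<not> lt j x x'"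
      then have x'x: "lt j x' x" using ne not_lt by blast
      show False
      proof (cases "lt j y x'")
        case True
        then have "x' \<in> B j 0" using B_convex[OF j that(1) x(1) _ x'x] by blast
        then show False using disj[OF j] x(2) by blast
      next
        case False
        moreover have "y \<noteq> x'" using that(1) x(2) disj[OF j] by blast
        ultimately have "lt j x' y" using not_lt[of j y x'] by simp
        then have "y \<in> B j w'" using B_convex[OF j x(2) that(2) _ that(3)] by blast
        then show False using disj[OF j] that(1) by blast
      qed
    qed
    then show ?thesis using j x ne lt_total unfolding \<theta>_def by blast
  qed
  then have "ball_rel \<theta> 0 w'" unfolding ball_rel_def by blast
  then show ?thesis by blast
qed

text \<open>The balls of \<open>w1\<close> and \<open>w2\<close> are bounded, so finitely many
  tuples enclose them in all orders of \<open>J\<close>. A point that absorbs these tuples has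
  larger balls, and an automorphism moves it to \<open>w\<close>.\<close>

lemma ex_ball_rel_inside:
  assumes rel: "ball_rel \<theta> w1 w2"
  shows "\<exists>v v'. ball_rel \<theta> v v' \<and> (\<forall>j\<in>J. B j v \<subseteq> B j w \<and> B j v' \<subseteq> B j w)"
proof -
  have "\<exists>\<zeta>\<in>S. \<forall>u\<in>B j w1 \<union> B j w2. u \<notin> \<zeta> j" "\<exists>\<xi>\<in>S. \<forall>u\<in>B j w1 \<union> B j w2. u \<in> \<xi> j" if j: "j \<in> J" for j
  proof -
    have *: "\<exists>p q. (\<forall>u\<in>B j w. \<not> lt j u p) \<and> (\<forall>u\<in>B j w. \<not> lt j q u)" for w
    proof -
      obtain p q where pq: "\<forall>\<zeta>\<in>D \<sigma> w. p \<in> \<zeta> j \<and> q \<notin> \<zeta> j" using D_bounded[OF j] by blast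
      have "\<not> lt j u p" "\<not> lt j q u" if "u \<in> B j w" for u
        using that pq S_down[OF D_S j] unfolding B_iff by blast+
      then show ?thesis by blast
    qed
    obtain p1 q1 where 1: "\<forall>u\<in>B j w1. \<not> lt j u p1" "\<forall>u\<in>B j w1. \<not> lt j q1 u" using * by blast
    obtain p2 q2 where 2: "\<forall>u\<in>B j w2. \<not> lt j u p2" "\<forall>u\<in>B j w2. \<not> lt j q2 u" using * by blast
    obtain p where p: "\<forall>x\<in>{p1, p2}. \<not> lt j x p" using finite_has_min[of "{p1, p2}" j] by blast
    obtain q where q: "\<forall>x\<in>{q1, q2}. \<not> lt j q x" using finite_has_max[of "{q1, q2}" j] by blast
    obtain \<zeta> where \<zeta>: "\<zeta> \<in> S" "p \<notin> \<zeta> j" using S_ex_below[OF j] by blast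
    obtain \<xi> where \<xi>: "\<xi> \<in> S" "q \<in> \<xi> j" using S_ex_above[OF j] by blast
    have "u \<notin> \<zeta> j \<and> u \<in> \<xi> j" if "u \<in> B j w1 \<union> B j w2" for u
    proof -
      have "\<not> lt j u p" "\<not> lt j q u" using that 1 2 p q le_lt_trans lt_le_trans by blast+
      then show ?thesis using S_lt[OF \<zeta>(1) j _ \<zeta>(2)] S_lt[OF \<xi>(1) j \<xi>(2)] by blast
    qed
    then show "\<exists>\<zeta>\<in>S. \<forall>u\<in>B j w1 \<union> B j w2. u \<notin> \<zeta> j" "\<exists>\<xi>\<in>S. \<forall>u\<in>B j w1 \<union> B j w2. u \<in> \<xi> j"
      using \<zeta>(1) \<xi>(1) by blast+
  qed
  then obtain \<zeta> \<xi> where \<zeta>: "\<And>j. j \<in> J \<Longrightarrow> \<zeta> j \<in> S \<and> (\<forall>u\<in>B j w1 \<union> B j w2. u \<notin> \<zeta> j j)"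
    and \<xi>: "\<And>j. j \<in> J \<Longrightarrow> \<xi> j \<in> S \<and> (\<forall>u\<in>B j w1 \<union> B j w2. u \<in> \<xi> j j)"
    by metis
  have "\<zeta> ` J \<union> \<xi> ` J \<subseteq> S" "finite (\<zeta> ` J \<union> \<xi> ` J)" using \<zeta> \<xi> finite_J by auto
  then obtain w' where w': "\<zeta> ` J \<union> \<xi> ` J \<subseteq> D \<sigma> w'" using absorb_finite[OF cor] by meson
  have sub: "B j w1 \<union> B j w2 \<subseteq> B j w'" if j: "j \<in> J" for j
  proof
    fix u assume "u \<in> B j w1 \<union> B j w2"
    then have "u \<notin> \<zeta> j j" "u \<in> \<xi> j j" using \<zeta>[OF j] \<xi>[OF j] by blast+
    moreover have "\<zeta> j \<in> D \<sigma> w'" "\<xi> j \<in> D \<sigma> w'" using w' j by auto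
    ultimately show "u \<in> B j w'" unfolding B_iff by blast
  qed
  obtain g where g: "aut g" "g w' = w" using ex_aut_one by blast
  have "B j (g w1) \<subseteq> B j w \<and> B j (g w2) \<subseteq> B j w" if "j \<in> J" for j
    using sub[OF that] B_act[OF g(1) that] g(2) by (metis Un_subset_iff image_mono)
  moreover have "ball_rel \<theta> (g w1) (g w2)"
    using rel autD[OF g(1) JI] B_act[OF g(1)] unfolding ball_rel_def by auto
  ultimately show ?thesis by blast
qed

text \<open>Of two balls in position \<open>\<theta>\<close>, either may be replaced by two smaller
  ones in this position. Splitting \<open>w\<close> gives a chain with its first two points in the
  ball of \<open>w\<close>, splitting \<open>w'\<close> one with its last two points in the ball of
  \<open>w'\<close>.\<close>

lemma isolated_corner_contradiction:
  assumes i: "i \<in> J"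
  shows False
proof -
  obtain \<theta> w w' where rel: "ball_rel \<theta> w w'" using ex_ball_rel[OF i] by blast
  have realize: "\<exists>z1 z2 z3. (\<forall>j\<in>J. z1 \<in> B j v1 \<and> z2 \<in> B j v2 \<and> z3 \<in> B j v3) \<and>
      chain \<theta> z1 z2 \<and> chain \<theta> z1 z3 \<and> chain \<theta> z2 z3"
    if v: "ball_rel \<theta> v1 v2" "ball_rel \<theta> v1 v3" "ball_rel \<theta> v2 v3" for v1 v2 v3
  proof -
    obtain \<alpha> H1 where \<alpha>: "\<alpha> \<in> S" "finite H1" "\<And>z j. realizes H1 z \<alpha> \<Longrightarrow> j \<in> J \<Longrightarrow> z \<in> B j v1"
      using ex_interior_realization by meson
    obtain \<beta> H2 where \<beta>: "\<beta> \<in> S" "finite H2" "\<And>z j. realizes H2 z \<beta> \<Longrightarrow> j \<in> J \<Longrightarrow> z \<in> B j v2"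
      using ex_interior_realization by meson
    obtain \<gamma> H3 where \<gamma>: "\<gamma> \<in> S" "finite H3" "\<And>z j. realizes H3 z \<gamma> \<Longrightarrow> j \<in> J \<Longrightarrow> z \<in> B j v3"
      using ex_interior_realization by meson
    have fin: "finite (H1 \<union> H2 \<union> H3)" using \<alpha>(2) \<beta>(2) \<gamma>(2) by simp
    obtain z1 z2 z3 where z: "realizes (H1 \<union> H2 \<union> H3) z1 \<alpha>" "realizes (H1 \<union> H2 \<union> H3) z2 \<beta>"
        "realizes (H1 \<union> H2 \<union> H3) z3 \<gamma>"
      and ch: "(\<forall>j\<in>J. (lt j z1 z2 \<longleftrightarrow> j \<in> \<theta>) \<and> (lt j z1 z3 \<longleftrightarrow> j \<in> \<theta>) \<and> (lt j z2 z3 \<longleftrightarrow> j \<in> \<theta>)) \<Longrightarrow>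
        chain \<theta> z1 z2 \<and> chain \<theta> z1 z3 \<and> chain \<theta> z2 z3"
      using ex_chain_realization[OF \<alpha>(1) \<beta>(1) \<gamma>(1) fin] by blast
    have "realizes H1 z1 \<alpha>" "realizes H2 z2 \<beta>" "realizes H3 z3 \<gamma>"
      using realizes_subset[OF z(1)] realizes_subset[OF z(2)] realizes_subset[OF z(3)] by blast+
    then have mem: "z1 \<in> B j v1" "z2 \<in> B j v2" "z3 \<in> B j v3" if "j \<in> J" for j
      using \<alpha>(3) \<beta>(3) \<gamma>(3) that by blast+
    have "chain \<theta> z1 z2 \<and> chain \<theta> z1 z3 \<and> chain \<theta> z2 z3"
      using ball_rel_iff[OF v(1)] ball_rel_iff[OF v(2)] ball_rel_iff[OF v(3)] mem by (intro ch) blast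
    then show ?thesis using mem by blast
  qed
  have sub_rel: "ball_rel \<theta> u v" if "ball_rel \<theta> u' v'" "\<forall>j\<in>J. B j u \<subseteq> B j u'" "\<forall>j\<in>J. B j v \<subseteq> B j v'" for u v u' v'
    using that unfolding ball_rel_def by blast
  have disj: "B i w \<inter> B i w' = {}" using rel i lt_irrefl unfolding ball_rel_def by blast
  obtain v1 v2 where v: "ball_rel \<theta> v1 v2" "\<forall>j\<in>J. B j v1 \<subseteq> B j w \<and> B j v2 \<subseteq> B j w"
    using ex_ball_rel_inside[OF rel] by blast
  have "ball_rel \<theta> v1 w'" "ball_rel \<theta> v2 w'" using v(2) sub_rel[OF rel] by blast+
  then obtain z1 z2 z3 where z: "\<forall>j\<in>J. z1 \<in> B j v1 \<and> z2 \<in> B j v2 \<and> z3 \<in> B j w'"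
    and ch: "chain \<theta> z1 z2" "chain \<theta> z1 z3" "chain \<theta> z2 z3"
    using realize[OF v(1)] by blast
  obtain u1 u2 where u: "ball_rel \<theta> u1 u2" "\<forall>j\<in>J. B j u1 \<subseteq> B j w' \<and> B j u2 \<subseteq> B j w'"
    using ex_ball_rel_inside[OF rel] by blast
  have "ball_rel \<theta> w u1" "ball_rel \<theta> w u2" using u(2) sub_rel[OF rel] by blast+
  then obtain z1' z2' z3' where z': "\<forall>j\<in>J. z1' \<in> B j w \<and> z2' \<in> B j u1 \<and> z3' \<in> B j u2"
    and ch': "chain \<theta> z1' z2'" "chain \<theta> z1' z3'" "chain \<theta> z2' z3'"
    using realize[OF _ _ u(1)] by blast
  have "z1 \<in> B i w" "z2 \<in> B i w" "z3 \<notin> B i w" using z v(2) i disj by blast+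
  moreover have "z1' \<notin> B i w'" "z2' \<in> B i w'" "z3' \<in> B i w'" using z' u(2) i disj by blast+
  ultimately show False
    using no_two_combs[OF hull_ball_family[OF i] JI[OF i], of z1 w z2 z3 z1' w' z2' z3']
      chain_same_type ch ch' unfolding B_def by blast
qed

end

lemma J_subset_singleton:
  assumes "i \<in> J" "k \<in> J"
  shows "i = k"
proof (rule ccontr)
  assume ne: "i \<noteq> k"
  obtain \<sigma> where \<sigma>: "corner \<sigma>" using ex_corner assms(1) by blast
  then have opp: "corner (J - \<sigma>)" using isolated_corner_contradiction assms(1) by blast
  show False
  proof (cases "i \<in> \<sigma>")
    case True
    then show False using opposite_corners_monotone[OF \<sigma> opp, of i k] assms ne by blast
  next
    case False
    then show False using opposite_corners_monotone[OF opp \<sigma>, of i k] assms ne by blast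
  qed
qed

end

section \<open>Independence of the orders\<close>

context homogeneous_orders begin

text \<open>A tuple with fewest proper entries among those that are proper in some order that is not
  an edge spans a minimal face. The face is left with a single order, and then
  \<open>S_separate\<close> says that this order is an edge.\<close>

lemma all_edges:
  assumes "i \<in> I"
  shows "edge i"
proof (rule ccontr)
  assume "\<not> edge i"
  define P where "P \<zeta> = {j\<in>I. proper (\<zeta> j)}" for \<zeta>
  define good where "good \<zeta> \<longleftrightarrow> realizable \<zeta> \<and> (\<exists>j\<in>P \<zeta>. \<not> edge j)" for \<zeta>
  have "\<exists>\<zeta>. good \<zeta>"
    using ex_all_proper assms \<open>\<not> edge i\<close> unfolding good_def P_def by blast
  then obtain \<zeta>0 where \<zeta>0: "good \<zeta>0" and min: "\<And>\<zeta>. good \<zeta> \<Longrightarrow> card (P \<zeta>0) \<le> card (P \<zeta>)"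
    using ex_has_least_nat[of good _ "\<lambda>\<zeta>. card (P \<zeta>)"] by blast
  define J where "J = P \<zeta>0"
  have finJ: "finite J" using finite_I by (simp add: J_def P_def)
  interpret minimal_face I lt \<zeta>0 J
  proof
    show "J \<subseteq> I" by (auto simp: J_def P_def)
    show "\<exists>\<zeta>. realizable \<zeta> \<and> (\<forall>j\<in>I - J. \<zeta> j = \<zeta>0 j) \<and> (\<forall>j\<in>J. proper (\<zeta> j))"
      using \<zeta>0 unfolding good_def J_def P_def by blast
    show "\<zeta>0 j = {} \<or> \<zeta>0 j = UNIV" if "j \<in> I - J" for j
      using that unfolding J_def P_def proper_def by blast
  next
    fix \<zeta> j k
    assume \<zeta>: "realizable \<zeta>" and off: "\<And>j. j \<in> I - J \<Longrightarrow> \<zeta> j = \<zeta>0 j"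
      and j: "j \<in> J" "\<not> edge j" "proper (\<zeta> j)" and k: "k \<in> J"
    \<comment> \<open>Outside \<open>J\<close> the tuple agrees with \<open>\<zeta>0\<close>, which
      is improper there. Minimality turns the inclusion into an equality.\<close>
    have "P \<zeta> \<subseteq> J"
      using off unfolding J_def P_def by fastforce
    moreover have "j \<in> P \<zeta>" using j unfolding J_def P_def by blast
    then have "card J \<le> card (P \<zeta>)" using min[of \<zeta>] \<zeta> j(2) unfolding good_def J_def by blast
    ultimately have "P \<zeta> = J" using finJ card_seteq by blast
    then show "proper (\<zeta> k)" using k unfolding P_def by blast
  qed
  obtain j where j: "j \<in> J" "\<not> edge j" using \<zeta>0 unfolding good_def J_def by blast
  interpret edgeless_face I lt \<zeta>0 J
    by unfold_locales (use no_edge_in_face[OF j] in blast)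
  have J: "J = {j}" using j J_subset_singleton by blast
  \<comment> \<open>\<open>\<zeta>0\<close> is proper at \<open>j\<close> and arbitrary outside
    \<open>I\<close>, while \<open>edge\<close> asks for an improper value at every index; hence the
    default \<open>{}\<close>.\<close>
  define \<eta> where "\<eta> k = (if k \<in> I - J then \<zeta>0 k else {})" for k
  have "\<eta> k = {} \<or> \<eta> k = UNIV" for k using \<eta>_improper[of k] unfolding \<eta>_def by auto
  moreover have "\<exists>\<zeta>. realizable \<zeta> \<and> a \<in> \<zeta> j \<and> b \<notin> \<zeta> j \<and> (\<forall>k\<in>I - {j}. \<zeta> k = \<eta> k)" if "lt j a b" for a b
  proof -
    obtain \<zeta> where \<zeta>: "\<zeta> \<in> S" "a \<in> \<zeta> j" "b \<notin> \<zeta> j" using S_separate[OF j(1) \<open>lt j a b\<close>] by blast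
    moreover have "\<forall>k\<in>I - {j}. \<zeta> k = \<eta> k" using S_off[OF \<zeta>(1)] J unfolding \<eta>_def by simp
    ultimately show ?thesis using S_realizable by blast
  qed
  ultimately have "edge j" unfolding edge_def by blast
  then show False using j(2) by blast
qed

section \<open>Boxes and the one-point extension property\<close>

definition cut_of :: "nat set \<Rightarrow> nat \<Rightarrow> nat set \<Rightarrow> bool" where
  "cut_of F i P \<longleftrightarrow> P \<subseteq> F \<and> (\<forall>a\<in>F. \<forall>b\<in>P. lt i a b \<longrightarrow> a \<in> P)"

lemma ex_gap:
  assumes i: "i \<in> I" and F: "finite F" and P: "cut_of F i P"
  shows "\<exists>a b. lt i a b \<and> (\<forall>x\<in>P. lt i x a) \<and> (\<forall>x\<in>F - P. lt i b x)"
proof -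
  have "\<exists>c. (\<forall>x\<in>P. lt i x c) \<and> (\<forall>x\<in>F - P. lt i c x)"
  proof (cases "P = {}")
    case True
    show ?thesis
    proof (cases "F = {}")
      case False
      then obtain m where m: "\<forall>x\<in>F. \<not> lt i x m" using finite_has_min[OF F] by blast
      obtain c where "lt i c m" using no_min[OF i] by blast
      then show ?thesis using True m lt_le_trans by blast
    qed (use True in blast)
  next
    case False
    have "finite P" using F P finite_subset unfolding cut_of_def by blast
    then obtain m where m: "m \<in> P" "\<forall>x\<in>P. \<not> lt i m x" using finite_has_max False by blast
    show ?thesis
    proof (cases "F - P = {}")
      case True
      obtain c where "lt i m c" using no_max[OF i] by blast
      then show ?thesis using True m(2) le_lt_trans by blast
    next
      case False
      then obtain m' where m': "m' \<in> F - P" "\<forall>x\<in>F - P. \<not> lt i x m'" using finite_has_min[of "F - P"] F by blast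
      have "lt i m m'" using P m(1) m'(1) lt_total unfolding cut_of_def by (metis DiffD1 DiffD2)
      then obtain c where "lt i m c" "lt i c m'" using dense[OF i] by blast
      then show ?thesis using m(2) m'(2) le_lt_trans lt_le_trans by blast
    qed
  qed
  then obtain c where c: "\<forall>x\<in>P. lt i x c" "\<forall>x\<in>F - P. lt i c x" by blast
  have "\<exists>b. lt i c b \<and> (\<forall>x\<in>F - P. lt i b x)"
  proof (cases "F - P = {}")
    case True
    then show ?thesis using no_max[OF i] by blast
  next
    case False
    then obtain m' where m': "m' \<in> F - P" "\<forall>x\<in>F - P. \<not> lt i x m'" using finite_has_min[of "F - P"] F by blast
    then obtain b where "lt i c b" "lt i b m'" using dense[OF i] c(2) by blast
    then show ?thesis using m'(2) lt_le_trans by blast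
  qed
  then show ?thesis using c(1) by blast
qed

text \<open>Shrink the box around \<open>x0\<close> to one bounded by points that are at infinity in the order \<open>e\<close>. By
  \<open>edge_invariant_cut\<close> its part above \<open>a\<close> cannot have an infimum other than \<open>a\<close>.\<close>

lemma box_extend:
  assumes e: "e \<in> I" "e \<notin> K" and K: "K \<subseteq> I"
    and x0: "\<And>i. i \<in> K \<Longrightarrow> lt i (l i) x0 \<and> lt i x0 (u i)"
    and ab: "lt e a b"
  shows "\<exists>x. lt e a x \<and> lt e x b \<and> (\<forall>i\<in>K. lt i (l i) x \<and> lt i x (u i))"
proof -
  have finK: "finite K" using K finite_I finite_subset by blast
  \<comment> \<open>A margin inside \<open>(a, b)\<close>: a point above \<open>a\<close> but not
    above \<open>a'\<close> is below \<open>b\<close>, and a point below \<open>b\<close> but not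
    below \<open>a'\<close> is above \<open>a\<close>.\<close>
  obtain a' where a': "lt e a a'" "lt e a' b" using dense[OF e(1) ab] by blast
  define H where "H = {a, b, a', x0} \<union> l ` K \<union> u ` K"
  have finH: "finite H" using finK by (simp add: H_def)
  \<comment> \<open>A limit that witnesses that \<open>i\<close> is an edge, realized over
    \<open>H\<close> as well: it separates \<open>c\<close> from \<open>d\<close> in
    \<open>i\<close> and is beyond all of \<open>H\<close> in \<open>e\<close>.\<close>
  have infinitesimal: "\<exists>z. lt i c z \<and> lt i z d \<and> ((\<forall>h\<in>H. lt e h z) \<or> (\<forall>h\<in>H. lt e z h))"
    if i: "i \<in> K" and cd: "lt i c d" for i c d
  proof -
    have iI: "i \<in> I" using i K by blast
    obtain \<eta> where \<eta>: "\<forall>j. \<eta> j = {} \<or> \<eta> j = UNIV" and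
      ed: "\<forall>a b. lt i a b \<longrightarrow> (\<exists>\<zeta>. realizable \<zeta> \<and> a \<in> \<zeta> i \<and> b \<notin> \<zeta> i \<and> (\<forall>j\<in>I - {i}. \<zeta> j = \<eta> j))"
      using all_edges[OF iI] unfolding edge_def by blast
    obtain \<zeta> where \<zeta>: "realizable \<zeta>" "c \<in> \<zeta> i" "d \<notin> \<zeta> i" "\<forall>j\<in>I - {i}. \<zeta> j = \<eta> j"
      using ed cd by blast
    have fin: "finite (H \<union> {c, d})" using finH by simp
    obtain z where z: "realizes (H \<union> {c, d}) z \<zeta>" using \<zeta>(1) fin unfolding realizable_def by blast
    have "lt i c z" using realizesD(1)[OF z iI, of c] \<zeta>(2) by simp
    moreover have "lt i z d" using realizes_above[OF z iI, of d] \<zeta>(3) by simp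
    moreover have "\<zeta> e = \<eta> e" using \<zeta>(4) e i by blast
    then have "(\<forall>h\<in>H. lt e h z) \<or> (\<forall>h\<in>H. lt e z h)"
      using \<eta> realizesD(1)[OF z e(1)] realizes_above[OF z e(1)] by (metis UNIV_I UnI1 empty_iff)
    ultimately show ?thesis by blast
  qed
  have "\<exists>z. lt i (l i) z \<and> lt i z x0 \<and> ((\<forall>h\<in>H. lt e h z) \<or> (\<forall>h\<in>H. lt e z h))" if "i \<in> K" for i
    using infinitesimal[OF that] x0[OF that] by blast
  then obtain z where z: "\<And>i. i \<in> K \<Longrightarrow> lt i (l i) (z i) \<and> lt i (z i) x0 \<and>
      ((\<forall>h\<in>H. lt e h (z i)) \<or> (\<forall>h\<in>H. lt e (z i) h))"
    by metis
  have "\<exists>z. lt i x0 z \<and> lt i z (u i) \<and> ((\<forall>h\<in>H. lt e h z) \<or> (\<forall>h\<in>H. lt e z h))" if "i \<in> K" for i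
    using infinitesimal[OF that] x0[OF that] by blast
  then obtain z' where z': "\<And>i. i \<in> K \<Longrightarrow> lt i x0 (z' i) \<and> lt i (z' i) (u i) \<and>
      ((\<forall>h\<in>H. lt e h (z' i)) \<or> (\<forall>h\<in>H. lt e (z' i) h))"
    by metis
  define Q where "Q = {x. \<forall>i\<in>K. lt i (z i) x \<and> lt i x (z' i)}"
  have x0Q: "x0 \<in> Q" using z z' unfolding Q_def by blast
  have Q_box: "\<forall>i\<in>K. lt i (l i) x \<and> lt i x (u i)" if "x \<in> Q" for x
    using that z z' lt_trans unfolding Q_def by blast
  have Q_act: "g x \<in> Q" if g: "aut g" "\<forall>f\<in>z ` K \<union> z' ` K. g f = f" and x: "x \<in> Q" for g x
  proof -
    have "lt i (z i) (g x) \<and> lt i (g x) (z' i)" if i: "i \<in> K" for i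
    proof -
      have "g (z i) = z i" "g (z' i) = z' i" using g(2) i by auto
      moreover have "lt i (z i) x" "lt i x (z' i)" using x i unfolding Q_def by auto
      moreover have "i \<in> I" using i K by blast
      ultimately show ?thesis
        using autD[OF g(1), of i "z i" x] autD[OF g(1), of i x "z' i"] by simp
    qed
    then show ?thesis unfolding Q_def by blast
  qed
  have far: "(\<forall>h\<in>H. lt e h f) \<or> (\<forall>h\<in>H. lt e f h)" if "f \<in> z ` K \<union> z' ` K" for f using that z z' by blast
  have H: "a \<in> H" "b \<in> H" "a' \<in> H" "x0 \<in> H" unfolding H_def by auto
  consider "lt e a x0" "lt e x0 b" | "\<not> lt e x0 b" | "\<not> lt e a x0" by blast
  then show ?thesis
  proof cases
    case 1
    then show ?thesis using x0 by blast
  next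
    case 2
    have ax0: "lt e a x0" using lt_le_trans[OF ab 2] .
    \<comment> \<open>The cut at the infimum of the part of \<open>Q\<close> above \<open>a\<close>.
      It is fixed by the automorphisms that fix \<open>a\<close> and the bounds of
      \<open>Q\<close>.\<close>
    define W where "W = {v. \<forall>x\<in>Q. lt e a x \<longrightarrow> lt e v x}"
    have "\<exists>f\<in>insert a (z ` K \<union> z' ` K). W = {x. lt e x f} \<or> W = {x. \<not> lt e f x}"
    proof (rule edge_invariant_cut[OF all_edges[OF e(1)] e(1)])
      show "down e W" unfolding down_def W_def using lt_trans by blast
      have "a \<in> W" "x0 \<notin> W" using x0Q ax0 unfolding W_def by auto
      then show "proper W" unfolding proper_def by blast
      fix g v assume g: "aut g" and fx: "\<forall>f\<in>insert a (z ` K \<union> z' ` K). g f = f" and v: "v \<in> W"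
      have ifx: "\<forall>f\<in>insert a (z ` K \<union> z' ` K). inv g f = f" using fx aut_inv_apply(1)[OF g] by metis
      show "g v \<in> W"
        unfolding W_def
      proof (intro CollectI ballI impI)
        fix x assume "x \<in> Q" "lt e a x"
        then have "inv g x \<in> Q" "lt e a (inv g x)"
          using Q_act[OF aut_inv[OF g], of x] autD[OF aut_inv[OF g] e(1), of a x] ifx by auto
        then have "lt e v (inv g x)" using v unfolding W_def by blast
        then show "lt e (g v) x" using autD[OF g e(1)] aut_inv_apply(2)[OF g] by metis
      qed
    qed (use finK in simp)
    then obtain f where f: "f \<in> insert a (z ` K \<union> z' ` K)" "W = {x. lt e x f} \<or> W = {x. \<not> lt e f x}" by blast
    have aW: "a \<in> W" "x0 \<notin> W" using x0Q ax0 unfolding W_def by auto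
    \<comment> \<open>The bounds of \<open>Q\<close> have \<open>a\<close> and \<open>x0\<close> on
      the same side in \<open>e\<close>, so none of them is next to a cut that separates these
      two.\<close>
    have "f = a"
    proof (rule ccontr)
      assume "f \<noteq> a"
      then have "(\<forall>h\<in>H. lt e h f) \<or> (\<forall>h\<in>H. lt e f h)" using far f(1) by blast
      then show False using f(2) aW H lt_asym by auto
    qed
    then have "a' \<notin> W" using f(2) a'(1) lt_asym by auto
    then obtain x where "x \<in> Q" "lt e a x" "\<not> lt e a' x" unfolding W_def by blast
    then show ?thesis using Q_box le_lt_trans[OF _ a'(2)] by blast
  next
    case 3
    have x0b: "lt e x0 b" using le_lt_trans[OF 3 ab] .
    \<comment> \<open>Symmetrically, the cut at the supremum of the part of \<open>Q\<close> below
      \<open>b\<close>.\<close>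
    define W where "W = {v. \<exists>x\<in>Q. lt e x b \<and> \<not> lt e x v}"
    have "\<exists>f\<in>insert b (z ` K \<union> z' ` K). W = {x. lt e x f} \<or> W = {x. \<not> lt e f x}"
    proof (rule edge_invariant_cut[OF all_edges[OF e(1)] e(1)])
      show "down e W" unfolding down_def W_def using lt_trans by blast
      have "b \<notin> W" "x0 \<in> W" using x0Q x0b unfolding W_def by auto
      then show "proper W" unfolding proper_def by blast
      fix g v assume g: "aut g" and fx: "\<forall>f\<in>insert b (z ` K \<union> z' ` K). g f = f" and v: "v \<in> W"
      obtain x where x: "x \<in> Q" "lt e x b" "\<not> lt e x v" using v unfolding W_def by blast
      then have "g x \<in> Q" "lt e (g x) b" "\<not> lt e (g x) (g v)"
        using Q_act[OF g, of x] autD[OF g e(1)] fx by (auto, metis)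
      then show "g v \<in> W" unfolding W_def by blast
    qed (use finK in simp)
    then obtain f where f: "f \<in> insert b (z ` K \<union> z' ` K)" "W = {x. lt e x f} \<or> W = {x. \<not> lt e f x}" by blast
    have bW: "b \<notin> W" "x0 \<in> W" using x0Q x0b unfolding W_def by auto
    have "f = b"
    proof (rule ccontr)
      assume "f \<noteq> b"
      then have "(\<forall>h\<in>H. lt e h f) \<or> (\<forall>h\<in>H. lt e f h)" using far f(1) by blast
      then show False using f(2) bW H lt_asym by auto
    qed
    then have "a' \<in> W" using f(2) a'(2) lt_asym by auto
    then obtain x where "x \<in> Q" "lt e x b" "\<not> lt e x a'" unfolding W_def by blast
    then show ?thesis using Q_box lt_le_trans[OF a'(1)] by blast
  qed
qed

lemma box_nonempty:
  assumes "K \<subseteq> I" "\<And>i. i \<in> K \<Longrightarrow> lt i (l i) (u i)"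
  shows "\<exists>x. \<forall>i\<in>K. lt i (l i) x \<and> lt i x (u i)"
proof -
  have "finite K" using assms(1) finite_I finite_subset by blast
  then show ?thesis using assms
  proof (induction K)
    case (insert e K)
    then obtain x0 where "\<And>i. i \<in> K \<Longrightarrow> lt i (l i) x0 \<and> lt i x0 (u i)" by auto
    then have "\<exists>x. lt e (l e) x \<and> lt e x (u e) \<and> (\<forall>i\<in>K. lt i (l i) x \<and> lt i x (u i))"
      using insert by (intro box_extend) auto
    then show ?case by blast
  qed simp
qed

text \<open>In each order the prescribed cut of \<open>F\<close> leaves a gap, and these gaps are
  the sides of a box. Any point of the box has the prescribed cuts.\<close>

theorem one_point_extension:
  assumes F: "finite F" and P: "\<And>i. i \<in> I \<Longrightarrow> cut_of F i (P i)"
  shows "\<exists>x. x \<notin> F \<and> (\<forall>i\<in>I. \<forall>b\<in>F. lt i b x \<longleftrightarrow> b \<in> P i)"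
proof (cases "I = {}")
  case True
  then show ?thesis using ex_new_if_finite[OF infinite_UNIV_nat F] by blast
next
  case False
  then obtain i0 where i0: "i0 \<in> I" by blast
  obtain l u where lu: "\<And>i. i \<in> I \<Longrightarrow> lt i (l i) (u i) \<and> (\<forall>x\<in>P i. lt i x (l i)) \<and> (\<forall>x\<in>F - P i. lt i (u i) x)"
    using ex_gap[OF _ F P] by metis
  obtain x where x: "\<forall>i\<in>I. lt i (l i) x \<and> lt i x (u i)"
    using box_nonempty[of I l u] lu by blast
  have *: "(b \<in> P i \<longrightarrow> lt i b x) \<and> (b \<notin> P i \<longrightarrow> lt i x b)" if "i \<in> I" "b \<in> F" for i b
    using lu[OF that(1)] x that lt_trans by blast
  then have "x \<notin> F" using i0 lt_irrefl by blast
  moreover have "lt i b x \<longleftrightarrow> b \<in> P i" if "i \<in> I" "b \<in> F" for i b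
    using *[OF that] lt_asym by blast
  ultimately show ?thesis by blast
qed

end

section \<open>Transfer to structures\<close>

text \<open>Equivalence relations that are invariant under automorphisms are unions of types of pairs, hence
  definable without quantifiers.\<close>

definition qf_definable :: "'s set \<Rightarrow> ('s, 'a) bin_struct \<Rightarrow> ('a \<Rightarrow> 'a \<Rightarrow> bool) \<Rightarrow> bool" where
  "qf_definable L M R \<longleftrightarrow> (\<exists>p. set_fm p \<subseteq> L \<and> fv p \<subseteq> {0, 1} \<and>
     (\<forall>a b. sat M (\<lambda>k. if k = 0 then a else b) p \<longleftrightarrow> R a b))"

lemma qf_definable_eq: "qf_definable L M (\<lambda>a b. a = b)"
  unfolding qf_definable_def by (rule exI[of _ "Eq 0 1"]) simp

lemma qf_definable_rel: "s \<in> L \<Longrightarrow> qf_definable L M (\<lambda>a b. (a, b) \<in> rel M s)"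
  unfolding qf_definable_def by (rule exI[of _ "Rel s 0 1"]) simp

lemma qf_definable_neg:
  assumes "qf_definable L M R"
  shows "qf_definable L M (\<lambda>a b. \<not> R a b)"
proof -
  obtain p where "set_fm p \<subseteq> L" "fv p \<subseteq> {0, 1}" "\<forall>a b. sat M (\<lambda>k. if k = 0 then a else b) p \<longleftrightarrow> R a b"
    using assms unfolding qf_definable_def by blast
  then show ?thesis unfolding qf_definable_def by (intro exI[of _ "Neg p"]) simp
qed

lemma qf_definable_conj:
  assumes "qf_definable L M R" "qf_definable L M R'"
  shows "qf_definable L M (\<lambda>a b. R a b \<and> R' a b)"
proof -
  obtain p where "set_fm p \<subseteq> L" "fv p \<subseteq> {0, 1}" "\<forall>a b. sat M (\<lambda>k. if k = 0 then a else b) p \<longleftrightarrow> R a b"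
    using assms(1) unfolding qf_definable_def by blast
  moreover obtain q where "set_fm q \<subseteq> L" "fv q \<subseteq> {0, 1}" "\<forall>a b. sat M (\<lambda>k. if k = 0 then a else b) q \<longleftrightarrow> R' a b"
    using assms(2) unfolding qf_definable_def by blast
  ultimately show ?thesis unfolding qf_definable_def by (intro exI[of _ "Conj p q"]) simp
qed

lemma qf_definable_disj:
  assumes "qf_definable L M R" "qf_definable L M R'"
  shows "qf_definable L M (\<lambda>a b. R a b \<or> R' a b)"
  using qf_definable_neg[OF qf_definable_conj[OF assms[THEN qf_definable_neg]]] by simp

lemma qf_definable_Ball:
  assumes "finite T" "\<And>t. t \<in> T \<Longrightarrow> qf_definable L M (R t)"
  shows "qf_definable L M (\<lambda>a b. \<forall>t\<in>T. R t a b)"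
  using assms
proof (induction T rule: finite_induct)
  case empty
  show ?case using qf_definable_disj[OF qf_definable_eq qf_definable_neg[OF qf_definable_eq], of L M] by simp
next
  case (insert t T)
  then show ?case using qf_definable_conj[of L M "R t" "\<lambda>a b. \<forall>t\<in>T. R t a b"] by simp
qed

lemma qf_definable_Bex:
  assumes "finite T" "\<And>t. t \<in> T \<Longrightarrow> qf_definable L M (R t)"
  shows "qf_definable L M (\<lambda>a b. \<exists>t\<in>T. R t a b)"
  using qf_definable_neg[OF qf_definable_Ball[OF assms(1) qf_definable_neg[OF assms(2)]]] by simp

lemma qf_definable_type:
  assumes "finite L"
  shows "qf_definable L M (\<lambda>a b. {s\<in>L. (a, b) \<in> rel M s} = t)"
proof (cases "t \<subseteq> L")
  case True
  have "qf_definable L M (\<lambda>a b. (a, b) \<in> rel M s \<longleftrightarrow> s \<in> t)" if "s \<in> L" for s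
    using qf_definable_rel[OF that, of M] qf_definable_neg[OF qf_definable_rel[OF that, of M]]
    by (cases "s \<in> t") simp_all
  then have "qf_definable L M (\<lambda>a b. \<forall>s\<in>L. (a, b) \<in> rel M s \<longleftrightarrow> s \<in> t)"
    by (rule qf_definable_Ball[OF assms])
  moreover have "(\<forall>s\<in>L. (a, b) \<in> rel M s \<longleftrightarrow> s \<in> t) \<longleftrightarrow> {s\<in>L. (a, b) \<in> rel M s} = t" for a b
    using True by blast
  ultimately show ?thesis by simp
next
  case False
  have "qf_definable L M (\<lambda>a b. \<exists>s\<in>{}. True)"
    using qf_definable_Bex[of "{}" L M "\<lambda>_ _ _. True"] by simp
  moreover have "{s\<in>L. (a, b) \<in> rel M s} \<noteq> t" for a b using False by blast
  ultimately show ?thesis by simp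
qed

section \<open>From structures to orders on the natural numbers and back\<close>

lemma iso_substructI:
  assumes "inj_on h A" "\<And>s x y. s \<in> L \<Longrightarrow> x \<in> A \<Longrightarrow> y \<in> A \<Longrightarrow> (x, y) \<in> rel N s \<longleftrightarrow> (h x, h y) \<in> rel M s"
    and "\<And>s. s \<in> L \<Longrightarrow> rel N s \<subseteq> univ N \<times> univ N" "univ N = A"
  shows "iso L N (substruct M (h ` A)) h"
  using assms unfolding iso_def substruct_def bij_betw_def by auto

text \<open>The enumeration \<open>f\<close> replaces the universe by the type \<open>nat\<close>.
  This saves carrier sets and provides the sequence of points along which \<open>compactness\<close>
  proceeds.\<close>

lemma homogeneous_orders_transfer:
  fixes M :: "(nat, 'a) bin_struct"
  assumes cnt: "countable (univ M)" "infinite (univ M)" and finI: "finite I"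
    and lin: "\<And>i. i \<in> I \<Longrightarrow> linear_order_on (univ M) (rel M i)"
    and hom: "homogeneous I M" and prim: "primitive I M"
    and dist: "\<And>i j. i \<in> I \<Longrightarrow> j \<in> I \<Longrightarrow> i \<noteq> j \<Longrightarrow> rel M i \<noteq> rel M j \<and> rel M i \<noteq> (rel M j)\<inverse>"
  defines "f \<equiv> from_nat_into (univ M)"
  \<comment> \<open>outside \<open>I\<close> any linear order will do\<close>
  defines "lt \<equiv> \<lambda>i a b. if i \<in> I then (f a, f b) \<in> rel M i \<and> a \<noteq> b else a < b"
  shows "homogeneous_orders I lt"
proof -
  have bf: "bij_betw f UNIV (univ M)" unfolding f_def by (rule bij_betw_from_nat_into[OF cnt])
  have f_in: "f a \<in> univ M" for a using bf bij_betwE by blast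
  have f_eq: "f a = f b \<longleftrightarrow> a = b" for a b using bf unfolding bij_betw_def by (simp add: inj_eq)
  have f_ex: "\<exists>a. x = f a" if "x \<in> univ M" for x using bf that unfolding bij_betw_def by blast
  have lin': "refl_on (univ M) (rel M i)" "trans (rel M i)" "antisym (rel M i)" "total_on (univ M) (rel M i)"
    "rel M i \<subseteq> univ M \<times> univ M" if "i \<in> I" for i
    using lin[OF that] unfolding linear_order_on_def partial_order_on_def preorder_on_def by auto
  have rel_iff: "(f a, f b) \<in> rel M i \<longleftrightarrow> lt i a b \<or> a = b" if "i \<in> I" for i a b
    using that refl_onD[OF lin'(1)[OF that] f_in] unfolding lt_def by auto
  have irr: "\<not> lt i a a" for i a by (simp add: lt_def)
  have tr: "lt i a c" if "lt i a b" "lt i b c" for i a b c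
  proof (cases "i \<in> I")
    case True
    then have *: "(f a, f b) \<in> rel M i" "(f b, f c) \<in> rel M i" "a \<noteq> b" using that unfolding lt_def by auto
    have "a \<noteq> c" using antisymD[OF lin'(3)[OF True] *(1)] *(2,3) f_eq by blast
    then show ?thesis using True transD[OF lin'(2)[OF True] *(1,2)] unfolding lt_def by simp
  qed (use that in \<open>simp add: lt_def\<close>)
  have tot: "lt i a b \<or> lt i b a" if "a \<noteq> b" for i a b
    using that lin'(4)[of i] f_in f_eq unfolding lt_def total_on_def by auto
  have asym: "\<not> lt i b a" if "lt i a b" for i a b using that tr irr by blast
  have homog: "\<exists>g. order_aut I lt g \<and> (\<forall>a\<in>A. g a = h a)"
    if A: "finite A" and inj: "inj_on h A"
      and pres: "\<And>i a b. i \<in> I \<Longrightarrow> a \<in> A \<Longrightarrow> b \<in> A \<Longrightarrow> lt i a b \<Longrightarrow> lt i (h a) (h b)" for A h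
  proof -
    have pres': "lt i (h a) (h b) \<longleftrightarrow> lt i a b" if "i \<in> I" "a \<in> A" "b \<in> A" for i a b
      using pres[OF that] pres[OF that(1,3,2)] tot[of a b i] asym irr by blast
    \<comment> \<open>The map \<open>h\<close> conjugated by the enumeration, so that homogeneity of
      \<open>M\<close> applies; \<open>g\<close> below conjugates the automorphism back.\<close>
    define k where "k x = f (h (inv f x))" for x
    have inv_f: "inv f (f a) = a" for a using bf unfolding bij_betw_def by (simp add: inv_f_f)
    have kf: "k (f a) = f (h a)" for a by (simp add: k_def inv_f)
    have "iso I (substruct M (f ` A)) (substruct M (k ` f ` A)) k"
    proof (rule iso_substructI)
      show "inj_on k (f ` A)" using inj by (auto simp: inj_on_def kf f_eq)
      show "(x, y) \<in> rel (substruct M (f ` A)) s \<longleftrightarrow> (k x, k y) \<in> rel M s"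
        if "s \<in> I" "x \<in> f ` A" "y \<in> f ` A" for s x y
        using that pres'[OF that(1)] inj by (auto simp: substruct_def kf rel_iff inj_on_eq_iff)
    qed (auto simp: substruct_def)
    moreover have "finite (f ` A)" "f ` A \<subseteq> univ M" "finite (k ` f ` A)" "k ` f ` A \<subseteq> univ M"
      using A f_in by (auto simp: kf)
    ultimately have "\<exists>G. iso I M M G \<and> (\<forall>x\<in>f ` A. G x = k x)"
      by (intro hom[unfolded homogeneous_def, rule_format, of "f ` A" "k ` f ` A" k] conjI)
    then obtain G where G: "iso I M M G" "\<forall>x\<in>f ` A. G x = k x" by blast
    define g where "g a = inv f (G (f a))" for a
    have f_inv: "f (inv f x) = x" if "x \<in> univ M" for x
      using f_ex[OF that] inv_f by auto
    have bG: "bij_betw G (univ M) (univ M)" using G(1) unfolding iso_def by blast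
    then have fg: "f (g a) = G (f a)" for a using f_inv f_in bij_betwE unfolding g_def by blast
    have "inj g"
      by (rule injI) (metis fg f_eq f_in bG bij_betw_def inj_on_eq_iff)
    moreover have "surj g"
    proof (rule surjI)
      fix b show "g (inv f (inv_into (univ M) G (f b))) = b"
        using bG f_in[of b] f_inv[of "inv_into (univ M) G (f b)"] inv_f
        by (simp add: g_def bij_betw_inv_into_right inv_into_into bij_betw_imp_surj_on)
    qed
    ultimately have "bij g" by (simp add: bij_def)
    moreover have "lt i (g a) (g b) \<longleftrightarrow> lt i a b" if i: "i \<in> I" for i a b
    proof -
      have "(f a, f b) \<in> rel M i \<longleftrightarrow> (f (g a), f (g b)) \<in> rel M i"
        using G(1) i f_in unfolding iso_def fg by blast
      then show ?thesis using i inj_eq[OF \<open>inj g\<close>, of a b] unfolding lt_def by simp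
    qed
    moreover have "g a = h a" if "a \<in> A" for a using G(2) that by (simp add: g_def kf inv_f)
    ultimately show ?thesis unfolding order_aut_def by blast
  qed
  have primit: "(\<forall>a b. R a b \<longrightarrow> a = b) \<or> (\<forall>a b. R a b)"
    if R: "\<And>a. R a a" "\<And>a b. R a b \<Longrightarrow> R b a" "\<And>a b c. R a b \<Longrightarrow> R b c \<Longrightarrow> R a c"
      and inv: "\<And>g a b. order_aut I lt g \<Longrightarrow> R a b \<Longrightarrow> R (g a) (g b)" for R
  proof -
    define ty where "ty a b = {i\<in>I. (f a, f b) \<in> rel M i}" for a b
    define T where "T = {ty a b |a b. a \<noteq> b \<and> R a b}"
    have finT: "finite T"
    proof (rule finite_subset)
      show "T \<subseteq> Pow I" unfolding T_def ty_def by blast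
    qed (simp add: finI)
    have R_iff: "R a b \<longleftrightarrow> a = b \<or> ty a b \<in> T" for a b
    proof
      assume "a = b \<or> ty a b \<in> T"
      then show "R a b"
      proof
        assume "ty a b \<in> T"
        then obtain c d where cd: "c \<noteq> d" "R c d" "ty a b = ty c d" unfolding T_def by auto
        show "R a b"
        proof (cases "a = b")
          case False
          \<comment> \<open>The map from \<open>(c, d)\<close> to \<open>(a, b)\<close> preserves
            types, so it extends to an automorphism, under which \<open>R\<close> is
            invariant.\<close>
          let ?h = "\<lambda>x. if x = c then a else b"
          have lts: "lt i c d \<longleftrightarrow> lt i a b" if "i \<in> I" for i
            using cd(1,3) False that unfolding ty_def lt_def by auto
          then have lts': "lt i d c \<longleftrightarrow> lt i b a" if "i \<in> I" for i
            using that cd(1) False tot asym by metis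
          have "\<exists>g. order_aut I lt g \<and> (\<forall>x\<in>{c, d}. g x = ?h x)"
            using cd(1) False lts lts' irr by (intro homog) (auto simp: inj_on_def)
          then show ?thesis using inv cd(1,2) by fastforce
        qed (use R(1) in simp)
      qed (use R(1) in simp)
    qed (auto simp: T_def)
    define E where "E = {(f a, f b) |a b. R a b}"
    have E_iff: "(f a, f b) \<in> E \<longleftrightarrow> R a b" for a b unfolding E_def using f_eq by auto
    have E_sub: "E \<subseteq> univ M \<times> univ M" using f_in unfolding E_def by auto
    have "equiv (univ M) E"
    proof (rule equivI)
      show "refl_on (univ M) E" using f_ex E_iff R(1) unfolding refl_on_def by metis
      show "sym E" unfolding sym_def E_def using R(2) by blast
      show "trans E"
      proof (rule transI)
        fix x y z assume xy: "(x, y) \<in> E" and yz: "(y, z) \<in> E"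
        then obtain a b c where "x = f a" "y = f b" "z = f c" using E_sub f_ex by (metis SigmaE2 subsetD)
        then show "(x, z) \<in> E" using xy yz E_iff R(3) by blast
      qed
    qed (use E_sub in auto)
    moreover have "definable2 I M E"
    proof -
      have "qf_definable I M (\<lambda>x y. x = y \<or> (\<exists>t\<in>T. {i\<in>I. (x, y) \<in> rel M i} = t))"
        by (intro qf_definable_disj qf_definable_eq qf_definable_Bex finT qf_definable_type finI)
      then obtain p where p: "set_fm p \<subseteq> I" "fv p \<subseteq> {0, 1}"
        "\<And>x y. sat M (\<lambda>k. if k = 0 then x else y) p \<longleftrightarrow> x = y \<or> {i\<in>I. (x, y) \<in> rel M i} \<in> T"
        unfolding qf_definable_def by auto
      have "(x, y) \<in> E \<longleftrightarrow> sat M (\<lambda>k. if k = 0 then x else y) p" if xy: "x \<in> univ M" "y \<in> univ M" for x y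
      proof -
        obtain a b where "x = f a" "y = f b" using f_ex xy by meson
        then show ?thesis using E_iff R_iff p(3) f_eq unfolding ty_def by simp
      qed
      then have "E = {(x, y). x \<in> univ M \<and> y \<in> univ M \<and> sat M (\<lambda>k. if k = 0 then x else y) p}"
        using E_sub by auto
      then show ?thesis unfolding definable2_def using p(1,2) by blast
    qed
    ultimately have "E = Id_on (univ M) \<or> E = univ M \<times> univ M"
      using prim unfolding primitive_def by blast
    then show ?thesis
    proof
      assume "E = Id_on (univ M)"
      then have "a = b" if "R a b" for a b using that E_iff f_eq by (metis Id_onE prod.inject)
      then show ?thesis by blast
    next
      assume "E = univ M \<times> univ M"
      then have "R a b" for a b using E_iff f_in by blast
      then show ?thesis by blast
    qed
  qed
  have neq: "\<exists>a b. lt i a b \<and> lt j b a" if ij: "i \<in> I" "j \<in> I" "i \<noteq> j" for i j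
  proof (rule ccontr)
    assume no: "\<not> ?thesis"
    then have "lt i a b \<longleftrightarrow> lt j a b" for a b using tot asym by metis
    then have f_iff: "(f a, f b) \<in> rel M i \<longleftrightarrow> (f a, f b) \<in> rel M j" for a b using rel_iff ij by simp
    have "(x, y) \<in> rel M i \<longleftrightarrow> (x, y) \<in> rel M j" for x y
    proof (cases "x \<in> univ M \<and> y \<in> univ M")
      case True
      then obtain a b where "x = f a" "y = f b" using f_ex by meson
      then show ?thesis using f_iff by simp
    next
      case False
      then show ?thesis using lin'(5)[OF ij(1)] lin'(5)[OF ij(2)] by blast
    qed
    then show False using dist[OF ij] by auto
  qed
  have nrev: "\<exists>a b. lt i a b \<and> lt j a b" if ij: "i \<in> I" "j \<in> I" "i \<noteq> j" for i j
  proof (rule ccontr)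
    assume no: "\<not> ?thesis"
    then have "lt i a b \<longleftrightarrow> lt j b a" for a b using tot asym by metis
    then have f_iff: "(f a, f b) \<in> rel M i \<longleftrightarrow> (f b, f a) \<in> rel M j" for a b using rel_iff ij by auto
    have "(x, y) \<in> rel M i \<longleftrightarrow> (y, x) \<in> rel M j" for x y
    proof (cases "x \<in> univ M \<and> y \<in> univ M")
      case True
      then obtain a b where "x = f a" "y = f b" using f_ex by meson
      then show ?thesis using f_iff by simp
    next
      case False
      then show ?thesis using lin'(5)[OF ij(1)] lin'(5)[OF ij(2)] by blast
    qed
    then show False using dist[OF ij] by auto
  qed
  show ?thesis
  proof
    show "\<exists>g. order_aut I lt g \<and> (\<forall>a\<in>A. g a = h a)"
      if "finite A" "inj_on h A" "\<And>i a b. i \<in> I \<Longrightarrow> a \<in> A \<Longrightarrow> b \<in> A \<Longrightarrow> lt i a b \<Longrightarrow> lt i (h a) (h b)"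
      for A h by (rule homog[OF that])
    show "(\<forall>a b. R a b \<longrightarrow> a = b) \<or> (\<forall>a b. R a b)"
      if "\<And>a. R a a" "\<And>a b. R a b \<Longrightarrow> R b a" "\<And>a b c. R a b \<Longrightarrow> R b c \<Longrightarrow> R a c"
        "\<And>g a b. order_aut I lt g \<Longrightarrow> R a b \<Longrightarrow> R (g a) (g b)" for R by (rule primit[OF that])
    show "\<not> lt i a a" for i a by (rule irr)
    show "lt i a c" if "lt i a b" "lt i b c" for i a b c by (rule tr[OF that])
    show "lt i a b \<or> lt i b a" if "a \<noteq> b" for i a b by (rule tot[OF that])
  qed (use finI neq nrev in auto)
qed

text \<open>Points are added one at a time. The images of the points below the new one form a cut in
  each order, and \<open>one_point_extension\<close> fills all these cuts by a single point.\<close>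

lemma (in homogeneous_orders) ex_embedding:
  assumes "finite V" and lin: "\<And>i. i \<in> I \<Longrightarrow> linear_order_on V (r i)"
  shows "\<exists>h. inj_on h V \<and> (\<forall>i\<in>I. \<forall>x\<in>V. \<forall>y\<in>V. x \<noteq> y \<longrightarrow> ((x, y) \<in> r i \<longleftrightarrow> lt i (h x) (h y)))"
proof -
  have tr: "trans (r i)" and as: "antisym (r i)" and tt: "total_on V (r i)" if "i \<in> I" for i
    using lin[OF that] unfolding linear_order_on_def partial_order_on_def preorder_on_def by auto
  have "\<exists>h. inj_on h W \<and> (\<forall>i\<in>I. \<forall>x\<in>W. \<forall>y\<in>W. x \<noteq> y \<longrightarrow> ((x, y) \<in> r i \<longleftrightarrow> lt i (h x) (h y)))"
    if "W \<subseteq> V" "finite W" for W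
    using that(2,1)
  proof (induction W rule: finite_induct)
    case (insert v W)
    then have "\<exists>h. inj_on h W \<and> (\<forall>i\<in>I. \<forall>x\<in>W. \<forall>y\<in>W. x \<noteq> y \<longrightarrow> ((x, y) \<in> r i \<longleftrightarrow> lt i (h x) (h y)))"
      by (intro insert.IH) simp
    then obtain h where
      "inj_on h W \<and> (\<forall>i\<in>I. \<forall>x\<in>W. \<forall>y\<in>W. x \<noteq> y \<longrightarrow> ((x, y) \<in> r i \<longleftrightarrow> lt i (h x) (h y)))" ..
    then have h: "inj_on h W"
      "\<And>i x y. i \<in> I \<Longrightarrow> x \<in> W \<Longrightarrow> y \<in> W \<Longrightarrow> x \<noteq> y \<Longrightarrow> (x, y) \<in> r i \<longleftrightarrow> lt i (h x) (h y)"
      by simp_all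
    define P where "P i = h ` {x\<in>W. (x, v) \<in> r i}" for i
    have "cut_of (h ` W) i (P i)" if i: "i \<in> I" for i
      unfolding cut_of_def
    proof (intro conjI ballI impI)
      show "P i \<subseteq> h ` W" by (auto simp: P_def)
      fix a b assume "a \<in> h ` W" "b \<in> P i" and ab: "lt i a b"
      then obtain x y where xy: "a = h x" "b = h y" "x \<in> W" "y \<in> W" "(y, v) \<in> r i" by (auto simp: P_def)
      then have "x \<noteq> y" using ab lt_irrefl by blast
      then have "(x, y) \<in> r i" using ab h(2)[OF i xy(3,4)] xy(1,2) by simp
      then have "(x, v) \<in> r i" using xy(5) transD[OF tr[OF i]] by blast
      then show "a \<in> P i" using xy by (auto simp: P_def)
    qed
    then obtain z where z: "z \<notin> h ` W" "\<forall>i\<in>I. \<forall>b\<in>h ` W. lt i b z \<longleftrightarrow> b \<in> P i"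
      using one_point_extension[of "h ` W" P] insert.hyps(1) by blast
    have zv: "lt i (h x) z \<longleftrightarrow> (x, v) \<in> r i" if "i \<in> I" "x \<in> W" for i x
      using z(2) that h(1) by (auto simp: P_def inj_on_eq_iff)
    have vz: "lt i z (h x) \<longleftrightarrow> (v, x) \<in> r i" if "i \<in> I" "x \<in> W" for i x
    proof -
      have "x \<noteq> v" "z \<noteq> h x" using that insert.hyps(2) z(1) by auto
      moreover have "x \<in> V" "v \<in> V" using that insert.prems by auto
      ultimately have "(v, x) \<in> r i \<longleftrightarrow> (x, v) \<notin> r i"
        using tt[OF that(1)] antisymD[OF as[OF that(1)]] unfolding total_on_def by blast
      then show ?thesis using zv[OF that] \<open>z \<noteq> h x\<close> not_lt[of i z "h x"] not_lt[of i "h x" z] lt_asym by blast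
    qed
    let ?h = "h(v := z)"
    have "inj_on ?h (insert v W)" using h(1) z(1) insert.hyps(2) by (auto simp: inj_on_def)
    moreover have "(x, y) \<in> r i \<longleftrightarrow> lt i (?h x) (?h y)"
      if "i \<in> I" "x \<in> insert v W" "y \<in> insert v W" "x \<noteq> y" for i x y
      using that h(2)[OF that(1)] zv[OF that(1)] vz[OF that(1)] insert.hyps(2) by auto
    ultimately show ?case by blast
  qed simp
  then show ?thesis using assms(1) by blast
qed

text \<open>Only the age has to be computed: linear orders restrict along embeddings, and conversely
  \<open>ex_embedding\<close> places every finite multi-order inside the structure.\<close>

theorem theorem1p4:
  fixes M :: "(nat, 'a) bin_struct" and n :: nat
  assumes "countable (univ M)" and "infinite (univ M)"
    and "\<And>i. i \<in> {1..n} \<Longrightarrow> linear_order_on (univ M) (rel M i)"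
    and "homogeneous {1..n} M"
    and "primitive {1..n} M"
    and "\<And>i j. i \<in> {1..n} \<Longrightarrow> j \<in> {1..n} \<Longrightarrow> i \<noteq> j \<Longrightarrow>
           rel M i \<noteq> rel M j \<and> rel M i \<noteq> (rel M j)\<inverse>"
  shows "is_fraisse_limit {1..n} (finite_multi_orders {1..n}) M"
proof -
  let ?I = "{1..n}"
  let ?f = "from_nat_into (univ M)"
  let ?lt = "\<lambda>i a b. if i \<in> ?I then (?f a, ?f b) \<in> rel M i \<and> a \<noteq> b else a < b"
  interpret homogeneous_orders ?I ?lt
    using homogeneous_orders_transfer[OF assms(1,2) _ assms(3-6)] by simp
  have bf: "bij_betw ?f UNIV (univ M)" by (rule bij_betw_from_nat_into[OF assms(1,2)])
  have lin: "refl_on (univ M) (rel M i)" "trans (rel M i)" "antisym (rel M i)" "total_on (univ M) (rel M i)"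
    "rel M i \<subseteq> univ M \<times> univ M" if "i \<in> ?I" for i
    using assms(3)[OF that] unfolding linear_order_on_def partial_order_on_def preorder_on_def by auto
  have "A \<in> finite_multi_orders ?I" if A: "A \<in> age ?I M" for A
  proof -
    obtain B h where AB: "is_struct ?I A" "finite (univ A)" "B \<subseteq> univ M" "iso ?I A (substruct M B) h"
      using A unfolding age_def by blast
    have h: "inj_on h (univ A)" "h ` univ A = B"
      using AB(4) unfolding iso_def bij_betw_def substruct_def by auto
    have "linear_order_on (univ A) (rel A i)" if i: "i \<in> ?I" for i
    proof -
      have sub: "rel A i \<subseteq> univ A \<times> univ A" using AB(1) i unfolding is_struct_def by blast
      have iff: "(x, y) \<in> rel A i \<longleftrightarrow> (h x, h y) \<in> rel M i" if "x \<in> univ A" "y \<in> univ A" for x y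
        using AB(4) i that h(2) unfolding iso_def substruct_def by auto
      have hU: "h x \<in> univ M" if "x \<in> univ A" for x using that h(2) AB(3) by blast
      have "refl_on (univ A) (rel A i)"
        using iff refl_onD[OF lin(1)[OF i] hU] unfolding refl_on_def by blast
      moreover have "trans (rel A i)"
      proof (rule transI)
        fix x y z assume xyz: "(x, y) \<in> rel A i" "(y, z) \<in> rel A i"
        then have "x \<in> univ A" "y \<in> univ A" "z \<in> univ A" using sub by auto
        then show "(x, z) \<in> rel A i" using xyz iff transD[OF lin(2)[OF i]] by blast
      qed
      moreover have "antisym (rel A i)"
      proof (rule antisymI)
        fix x y assume xy: "(x, y) \<in> rel A i" "(y, x) \<in> rel A i"
        then have U: "x \<in> univ A" "y \<in> univ A" using sub by auto
        then have "h x = h y" using xy iff antisymD[OF lin(3)[OF i]] by blast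
        then show "x = y" using U h(1) by (simp add: inj_on_eq_iff)
      qed
      moreover have "total_on (univ A) (rel A i)"
      proof (rule total_onI)
        fix x y assume U: "x \<in> univ A" "y \<in> univ A" and "x \<noteq> y"
        then have "h x \<noteq> h y" using h(1) by (simp add: inj_on_eq_iff)
        then show "(x, y) \<in> rel A i \<or> (y, x) \<in> rel A i"
          using lin(4)[OF i] hU[OF U(1)] hU[OF U(2)] iff U unfolding total_on_def by blast
      qed
      ultimately show ?thesis
        using sub unfolding linear_order_on_def partial_order_on_def preorder_on_def by blast
    qed
    then show ?thesis using AB(2) unfolding finite_multi_orders_def by blast
  qed
  moreover have "A \<in> age ?I M" if A: "A \<in> finite_multi_orders ?I" for A
  proof -
    have linA: "linear_order_on (univ A) (rel A i)" if "i \<in> ?I" for i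
      using A that unfolding finite_multi_orders_def by auto
    have fin: "finite (univ A)" using A unfolding finite_multi_orders_def by auto
    have sub: "rel A i \<subseteq> univ A \<times> univ A" "refl_on (univ A) (rel A i)" if "i \<in> ?I" for i
      using linA[OF that] unfolding linear_order_on_def partial_order_on_def preorder_on_def by auto
    have "\<exists>h. inj_on h (univ A) \<and>
      (\<forall>i\<in>?I. \<forall>x\<in>univ A. \<forall>y\<in>univ A. x \<noteq> y \<longrightarrow> ((x, y) \<in> rel A i \<longleftrightarrow> ?lt i (h x) (h y)))"
      by (rule ex_embedding[OF fin]) (rule linA)
    then obtain h where "inj_on h (univ A) \<and>
      (\<forall>i\<in>?I. \<forall>x\<in>univ A. \<forall>y\<in>univ A. x \<noteq> y \<longrightarrow> ((x, y) \<in> rel A i \<longleftrightarrow> ?lt i (h x) (h y)))" ..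
    then have h: "inj_on h (univ A)"
      "\<forall>i\<in>?I. \<forall>x\<in>univ A. \<forall>y\<in>univ A. x \<noteq> y \<longrightarrow> ((x, y) \<in> rel A i \<longleftrightarrow> ?lt i (h x) (h y))"
      by (rule conjunct1, rule conjunct2)
    let ?e = "\<lambda>x. ?f (h x)"
    have e_eq: "?e x = ?e y \<longleftrightarrow> x = y" if "x \<in> univ A" "y \<in> univ A" for x y
      using that h(1) bf unfolding bij_betw_def by (simp add: inj_eq inj_on_eq_iff)
    have eU: "?e x \<in> univ M" for x using bf bij_betwE by blast
    have "iso ?I A (substruct M (?e ` univ A)) ?e"
    proof (rule iso_substructI)
      show "inj_on ?e (univ A)" using e_eq by (auto simp: inj_on_def)
      show "(x, y) \<in> rel A s \<longleftrightarrow> (?e x, ?e y) \<in> rel M s" if "s \<in> ?I" "x \<in> univ A" "y \<in> univ A" for s x y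
      proof (cases "x = y")
        case True
        then show ?thesis using that refl_onD[OF sub(2)] refl_onD[OF lin(1)] eU by blast
      next
        case False
        then have "h x \<noteq> h y" using that h(1) by (simp add: inj_on_eq_iff)
        then show ?thesis using False h(2) that by auto
      qed
    qed (use sub(1) in auto)
    moreover have "?e ` univ A \<subseteq> univ M" using eU by blast
    moreover have "is_struct ?I A" using sub(1) unfolding is_struct_def by blast
    ultimately show ?thesis using fin unfolding age_def by blast
  qed
  ultimately have "age ?I M = finite_multi_orders ?I" by blast
  moreover have "is_struct ?I M" using lin(5) unfolding is_struct_def by blast
  ultimately show ?thesis using assms(1,4) unfolding is_fraisse_limit_def by blast
qed

end
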